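(* Let $\mathfrak{A}$ be a strongly maximal TAF algebra with diagonal $\mathfrak{D}=\mathfrak{A}\cap\mathfrak{A}^*$ and spectral triple $(X,\mathcal{P},\mathcal{R})$. The following are equivalent: (1) $C^*(\mathfrak{A})$ admits a continuous (pointwise-norm continuous) action $\alpha$ of $\mathbb{T}$ by $*$-automorphisms whose fixed point algebra is $\mathfrak{D}$ and such that $\mathfrak{A}=\{b\in C^*(\mathfrak{A}) : \int_{\mathbb{T}}\alpha_t(b)e^{2\pi i n t}\,dt=0 \text{ for all } n\ge 1\}$. (2) There is a sequence $\{\mathfrak{A}(n)\}_{n\ge 0}$ of closed linear subspaces of $\mathfrak{A}$ such that: (a) $\mathfrak{A}(0)=\mathfrak{D}$; (b) $\mathfrak{A}(n)\cap\mathfrak{A}(m)=(0)$ for $n\ne m$; (c) $[\mathfrak{A}(n)\cdot\mathfrak{A}(m)]\subseteq\mathfrak{A}(n+m)$ for all $n,m\ge 0$; (d) the algebraic direct sum $\bigoplus_{n\ge0}\mathfrak{A}(n)$ is dense in $\mathfrak{A}$. (3) $\mathfrak{A}$ is $\mathbb{Z}$-analytic. (4) There is a nested sequence $\{\varphi_n\}_{n\in\mathbb{Z}}$ of partial homeomorphisms of $X$ with $\varphi_0=\mathrm{id}_X$, each graph $\Gamma_{\varphi_n}=\{(x,\varphi_n(x)):x\in\mathrm{dom}\,\varphi_n\}$ ($n\ge0$) open in $\mathcal{P}$, and $\mathcal{P}=\bigsqcup_{n=0}^{\infty}\Gamma_{\varphi_n}$ (disjoint union).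
   Context: Strongly maximal TAF algebra: a norm-closed subalgebra $\mathfrak{A}$ of an AF C*-algebra $\mathfrak{B}=C^*(\mathfrak{A})$ for which there exist finite-dimensional C*-subalgebras $\mathfrak{B}_1\subseteq\mathfrak{B}_2\subseteq\cdots$ of $\mathfrak{B}$ with dense union, $\mathfrak{B}_n=\bigoplus_{k=1}^{r(n)}M_{m(n,k)}$, and a compatible system of matrix units $\{e^{(n,k)}_{ij}\}$ for $\bigcup_n\mathfrak{B}_n$ (each matrix unit of $\mathfrak{B}_n$ is a sum of matrix units of $\mathfrak{B}_{n+1}$) such that $\mathfrak{A}\cap\mathfrak{B}_n=\bigoplus_k T_{m(n,k)}$ (upper triangular matrices) and $\mathfrak{A}=\overline{\bigcup_n(\mathfrak{A}\cap\mathfrak{B}_n)}$. The diagonal $\mathfrak{D}=\mathfrak{A}\cap\mathfrak{A}^*$ is the closed span of the diagonal matrix units, a commutative C*-algebra. Spectral triple: $X$ is the Gelfand spectrum of $\mathfrak{D}$ (a compact zero-dimensional metric space); each matrix unit $v$ of $\mathfrak{B}$ induces a partial homeomorphism of $X$ (from the spectrum of $v^*v$ to that of $vv^*$) whose graph is denoted $\hat v\subseteq X\times X$; $\mathcal{R}=\bigcup\{\hat v: v \text{ a matrix unit of } \mathfrak{B}\}$, an equivalence relation on $X$ topologized by the basis $\{\hat v\}$; $\mathcal{P}=\bigcup\{\hat v: v \text{ a matrix unit of } \mathfrak{A}\}$, an open subset of $\mathcal{R}$ with $\mathcal{P}\circ\mathcal{P}\subseteq\mathcal{P}$, $\mathcal{P}\cap\mathcal{P}^{-1}=\Delta(X)=\{(x,x)\}$,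 $\mathcal{P}\cup\mathcal{P}^{-1}=\mathcal{R}$. A cocycle is a continuous map $c:\mathcal{R}\to\mathbb{R}$ with $c(x,y)+c(y,z)=c(x,z)$ whenever $(x,y),(y,z)\in\mathcal{R}$. $\mathfrak{A}$ is $\mathbb{Z}$-analytic if there is an integer-valued cocycle $d$ with $\mathcal{P}=d^{-1}([0,\infty))$. A partial homeomorphism of $X$ is a homeomorphism between open subsets $\mathrm{dom}\,\varphi$ and $\mathrm{ran}\,\varphi$ of $X$. A nested sequence of partial homeomorphisms is $\{\varphi_n\}_{n\in\mathbb{Z}}$ with $\varphi_0=\mathrm{id}_X$, $\varphi_{-n}=\varphi_n^{-1}$, and $\Gamma(\varphi_n\circ\varphi_m)\subseteq\Gamma(\varphi_{n+m})$ for all $n,m\in\mathbb{Z}$. For subsets $A,B$ of $\mathfrak{A}$, $[A\cdot B]$ is the closed linear span of $\{ab:a\in A,b\in B\}$. $\mathbb{T}=[0,1]$ with endpoints identified. *)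

theory Defs
  imports "HOL-Analysis.Analysis"
begin

text \<open>HOL has no class of complex normed algebras, so the ambient (unital) C*-algebra is a real
Banach algebra 'a with an involution st and a central element ii with ii*ii = -1 that
implements multiplication by the imaginary unit.  Complex scalar multiplication is csc.\<close>

definition csc :: "'a::real_normed_algebra_1 \<Rightarrow> complex \<Rightarrow> 'a \<Rightarrow> 'a" where
  "csc ii c x = Re c *\<^sub>R x + Im c *\<^sub>R (ii * x)"

definition cstar_algebra :: "('a::{real_normed_algebra_1,banach} \<Rightarrow> 'a) \<Rightarrow> 'a \<Rightarrow> bool" where
  "cstar_algebra st ii \<longleftrightarrow>
     (\<forall>x. ii * x = x * ii) \<and> ii * ii = - 1 \<and>
     (\<forall>c x. norm (csc ii c x) = cmod c * norm x) \<and>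
     (\<forall>x y. st (x + y) = st x + st y) \<and>
     (\<forall>c x. st (csc ii c x) = csc ii (cnj c) (st x)) \<and>
     (\<forall>x y. st (x * y) = st y * st x) \<and>
     (\<forall>x. st (st x) = x) \<and>
     (\<forall>x. norm (st x * x) = (norm x)\<^sup>2)"

definition csubspace :: "'a::real_normed_algebra_1 \<Rightarrow> 'a set \<Rightarrow> bool" where
  "csubspace ii V \<longleftrightarrow> 0 \<in> V \<and> (\<forall>x\<in>V. \<forall>y\<in>V. x + y \<in> V) \<and> (\<forall>c. \<forall>x\<in>V. csc ii c x \<in> V)"

definition cspan :: "'a::real_normed_algebra_1 \<Rightarrow> 'a set \<Rightarrow> 'a set" where
  "cspan ii S = \<Inter>{V. csubspace ii V \<and> S \<subseteq> V}"

definition mult_closed :: "'a::real_normed_algebra_1 set \<Rightarrow> bool" where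
  "mult_closed S \<longleftrightarrow> (\<forall>x\<in>S. \<forall>y\<in>S. x * y \<in> S)"

definition cstar_gen :: "('a::{real_normed_algebra_1,banach} \<Rightarrow> 'a) \<Rightarrow> 'a \<Rightarrow> 'a set \<Rightarrow> 'a set" where
  "cstar_gen st ii S = \<Inter>{T. csubspace ii T \<and> closed T \<and> mult_closed T \<and> st ` T \<subseteq> T \<and> S \<subseteq> T}"

definition prod_span :: "'a::{real_normed_algebra_1,banach} \<Rightarrow> 'a set \<Rightarrow> 'a set \<Rightarrow> 'a set" where
  "prod_span ii S T = closure (cspan ii {s * t |s t. s \<in> S \<and> t \<in> T})"

text \<open>Matrix units: level n, block k < r n, indices i, j < m n k.\<close>
definition mu_idx :: "(nat \<Rightarrow> nat) \<Rightarrow> (nat \<Rightarrow> nat \<Rightarrow> nat) \<Rightarrow> nat \<Rightarrow> (nat \<times> nat \<times> nat) set" where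
  "mu_idx r m n = {(k, i, j). k < r n \<and> i < m n k \<and> j < m n k}"

definition Bn :: "'a::real_normed_algebra_1 \<Rightarrow> (nat \<Rightarrow> nat) \<Rightarrow> (nat \<Rightarrow> nat \<Rightarrow> nat)
    \<Rightarrow> (nat \<Rightarrow> nat \<Rightarrow> nat \<Rightarrow> nat \<Rightarrow> 'a) \<Rightarrow> nat \<Rightarrow> 'a set" where
  "Bn ii r m e n = cspan ii ((\<lambda>(k, i, j). e n k i j) ` mu_idx r m n)"

definition Tn :: "'a::real_normed_algebra_1 \<Rightarrow> (nat \<Rightarrow> nat) \<Rightarrow> (nat \<Rightarrow> nat \<Rightarrow> nat)
    \<Rightarrow> (nat \<Rightarrow> nat \<Rightarrow> nat \<Rightarrow> nat \<Rightarrow> 'a) \<Rightarrow> nat \<Rightarrow> 'a set" where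
  "Tn ii r m e n = cspan ii ((\<lambda>(k, i, j). e n k i j) ` {(k, i, j) \<in> mu_idx r m n. i \<le> j})"

definition matrix_unit_system :: "('a::{real_normed_algebra_1,banach} \<Rightarrow> 'a) \<Rightarrow> 'a
    \<Rightarrow> (nat \<Rightarrow> nat) \<Rightarrow> (nat \<Rightarrow> nat \<Rightarrow> nat) \<Rightarrow> (nat \<Rightarrow> nat \<Rightarrow> nat \<Rightarrow> nat \<Rightarrow> 'a) \<Rightarrow> bool" where
  "matrix_unit_system st ii r m e \<longleftrightarrow>
     (\<forall>n k. k < r n \<longrightarrow> 0 < m n k) \<and>
     (\<forall>n. \<forall>(k, i, j) \<in> mu_idx r m n. e n k i j \<noteq> 0 \<and> st (e n k i j) = e n k j i) \<and>
     (\<forall>n. \<forall>(k, i, j) \<in> mu_idx r m n. \<forall>(k', i', j') \<in> mu_idx r m n.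
         e n k i j * e n k' i' j' = (if k = k' \<and> j = i' then e n k i j' else 0)) \<and>
     (\<forall>n. \<forall>(k, i, j) \<in> mu_idx r m n. \<exists>F. finite F \<and> F \<subseteq> mu_idx r m (Suc n) \<and>
         e n k i j = (\<Sum>(k', i', j') \<in> F. e (Suc n) k' i' j'))"

definition sm_TAF :: "('a::{real_normed_algebra_1,banach} \<Rightarrow> 'a) \<Rightarrow> 'a \<Rightarrow> 'a set
    \<Rightarrow> (nat \<Rightarrow> nat) \<Rightarrow> (nat \<Rightarrow> nat \<Rightarrow> nat) \<Rightarrow> (nat \<Rightarrow> nat \<Rightarrow> nat \<Rightarrow> nat \<Rightarrow> 'a) \<Rightarrow> bool" where
  "sm_TAF st ii A r m e \<longleftrightarrow>
     csubspace ii A \<and> closed A \<and> mult_closed A \<and>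
     matrix_unit_system st ii r m e \<and>
     closure (\<Union>n. Bn ii r m e n) = cstar_gen st ii A \<and>
     (\<forall>n. A \<inter> Bn ii r m e n = Tn ii r m e n) \<and>
     A = closure (\<Union>n. A \<inter> Bn ii r m e n)"

definition diag :: "('a \<Rightarrow> 'a) \<Rightarrow> 'a set \<Rightarrow> 'a set" where
  "diag st A = {a \<in> A. st a \<in> A}"

definition character :: "'a::real_normed_algebra_1 \<Rightarrow> 'a set \<Rightarrow> ('a \<Rightarrow> complex) \<Rightarrow> bool" where
  "character ii D f \<longleftrightarrow> f \<in> extensional D \<and>
     (\<forall>x\<in>D. \<forall>y\<in>D. f (x + y) = f x + f y \<and> f (x * y) = f x * f y) \<and>
     (\<forall>c. \<forall>x\<in>D. f (csc ii c x) = c * f x) \<and> (\<exists>x\<in>D. f x \<noteq> 0)"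

definition gelfand_top :: "'a::real_normed_algebra_1 \<Rightarrow> 'a set \<Rightarrow> ('a \<Rightarrow> complex) topology" where
  "gelfand_top ii D = subtopology (product_topology (\<lambda>_. euclidean) D) {f. character ii D f}"

text \<open>The partial homeomorphism induced by a matrix unit v: from the spectrum of v*v to that of vv*.\<close>
definition mu_map :: "('a::real_normed_algebra_1 \<Rightarrow> 'a) \<Rightarrow> 'a set \<Rightarrow> 'a \<Rightarrow> ('a \<Rightarrow> complex) \<Rightarrow> ('a \<Rightarrow> complex)" where
  "mu_map st D v x = restrict (\<lambda>d. x (st v * d * v)) D"

definition mu_graph :: "('a::real_normed_algebra_1 \<Rightarrow> 'a) \<Rightarrow> 'a \<Rightarrow> 'a set \<Rightarrow> 'a
    \<Rightarrow> (('a \<Rightarrow> complex) \<times> ('a \<Rightarrow> complex)) set" where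
  "mu_graph st ii D v = {(x, mu_map st D v x) |x. character ii D x \<and> x (st v * v) = 1}"

definition all_mus :: "(nat \<Rightarrow> nat) \<Rightarrow> (nat \<Rightarrow> nat \<Rightarrow> nat) \<Rightarrow> (nat \<Rightarrow> nat \<Rightarrow> nat \<Rightarrow> nat \<Rightarrow> 'a) \<Rightarrow> 'a set" where
  "all_mus r m e = {e n k i j |n k i j. (k, i, j) \<in> mu_idx r m n}"

definition upper_mus :: "(nat \<Rightarrow> nat) \<Rightarrow> (nat \<Rightarrow> nat \<Rightarrow> nat) \<Rightarrow> (nat \<Rightarrow> nat \<Rightarrow> nat \<Rightarrow> nat \<Rightarrow> 'a) \<Rightarrow> 'a set" where
  "upper_mus r m e = {e n k i j |n k i j. (k, i, j) \<in> mu_idx r m n \<and> i \<le> j}"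

definition specR where
  "specR st ii D r m e = (\<Union>v \<in> all_mus r m e. mu_graph st ii D v)"

definition specP where
  "specP st ii D r m e = (\<Union>v \<in> upper_mus r m e. mu_graph st ii D v)"

definition specR_top where
  "specR_top st ii D r m e = topology_generated_by ((\<lambda>v. mu_graph st ii D v) ` all_mus r m e)"

definition cocycle :: "('b \<times> 'b) topology \<Rightarrow> ('b \<times> 'b) set \<Rightarrow> ('b \<times> 'b \<Rightarrow> real) \<Rightarrow> bool" where
  "cocycle T R c \<longleftrightarrow> continuous_map T euclideanreal c \<and>
     (\<forall>x y z. (x, y) \<in> R \<and> (y, z) \<in> R \<longrightarrow> c (x, y) + c (y, z) = c (x, z))"

definition Z_analytic where
  "Z_analytic st ii A r m e \<longleftrightarrow>
     (\<exists>d. cocycle (specR_top st ii (diag st A) r m e) (specR st ii (diag st A) r m e) d \<and>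
          (\<forall>p \<in> specR st ii (diag st A) r m e. d p \<in> \<int>) \<and>
          specP st ii (diag st A) r m e = {p \<in> specR st ii (diag st A) r m e. d p \<ge> 0})"

definition partial_homeo :: "'b topology \<Rightarrow> 'b set \<Rightarrow> ('b \<Rightarrow> 'b) \<Rightarrow> bool" where
  "partial_homeo T U f \<longleftrightarrow> openin T U \<and> openin T (f ` U) \<and>
     homeomorphic_map (subtopology T U) (subtopology T (f ` U)) f"

definition graph_on :: "'b set \<Rightarrow> ('b \<Rightarrow> 'b) \<Rightarrow> ('b \<times> 'b) set" where
  "graph_on U f = {(x, f x) |x. x \<in> U}"

definition nested_seq :: "'b topology \<Rightarrow> (int \<Rightarrow> 'b set) \<Rightarrow> (int \<Rightarrow> 'b \<Rightarrow> 'b) \<Rightarrow> bool" where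
  "nested_seq T dm f \<longleftrightarrow>
     (\<forall>n. partial_homeo T (dm n) (f n)) \<and>
     dm 0 = topspace T \<and> (\<forall>x \<in> topspace T. f 0 x = x) \<and>
     (\<forall>n. dm (- n) = f n ` dm n \<and> (\<forall>x \<in> dm n. f (- n) (f n x) = x)) \<and>
     (\<forall>n m. graph_on {x \<in> dm m. f m x \<in> dm n} (\<lambda>x. f n (f m x)) \<subseteq> graph_on (dm (n + m)) (f (n + m)))"

end

theory Submission
  imports Defs
begin

text \<open>All four conditions are equivalent to a fifth one: the open set P is partitioned into open
pieces S(0), S(1), ... with S(0) the diagonal and S(n) S(m) contained in S(n + m). Antisymmetry of P extends
such a partition to an integer cocycle, and each level set of a cocycle is the graph of a partial
homeomorphism, which gives (3) and (4).

The analytic conditions are handled through matrix coefficients. The expectation E onto the diagonal D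
is the limit of pinchings by the minimal diagonal projections of level N, and the coefficient of b at a point
(x, y) of the graph of a matrix unit v is x(E(v* b)). Pinching by the orbits of the level n equivalence relation
shows that b is a limit of sums of v E(v* b) with v of level n; hence an element whose coefficients vanish off a
set W lies in the closed span of the matrix units whose graphs are contained in W.

For (2), the pieces are S(n) = the points at which some element of A(n) has a nonzero coefficient. For (1), a cocycle is a
coboundary on each level, so it is implemented there by diagonal unitaries, and conjugation by these converges
to the action; conversely, if D is fixed by the action, then v* alpha_t(v) commutes with D, hence lies in D, and
evaluating it at x yields a continuous character of the circle whose degree is the value of the cocycle.\<close>

section \<open>C*-identities\<close>

text \<open>The levels may be embedded in each other non-unitally, so the algebra in which
  everything happens need not have a unit; the sums of the diagonal matrix units of one level only
  form an approximate unit. Multiplicativity of the limit action and the computation of the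
  commutant of the diagonal go through it, and the theory of characters is arranged to avoid 1. The
  decisive norm bounds come from one estimate that rests on the C*-identity alone: a sum of
  orthogonal diagonal blocks is no larger than its largest block. It makes the expectation, the
  expansion at one level and the conjugation by diagonal unitaries contractive, and contractivity is
  what carries identities from matrix units to the closure. The other recurring device is to cut a
  matrix unit v by a diagonal projection q of a finer level: v q is zero or a matrix unit with a
  smaller graph. Matrix units of different levels are compared after such a cut, and by compactness
  a cocycle becomes constant on the graphs of all cuts at one deep level.\<close>

lemma csubspace_sum:
  assumes "csubspace ii S" "\<And>i. i \<in> I \<Longrightarrow> f i \<in> S"
  shows "sum f I \<in> S"
  using assms(2) by (induction I rule: infinite_finite_induct) (use assms(1) in \<open>auto simp: csubspace_def\<close>)

lemma csubspace_scaleR: "csubspace ii S \<Longrightarrow> x \<in> S \<Longrightarrow> a *\<^sub>R x \<in> S"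
  unfolding csubspace_def csc_def by (metis Im_complex_of_real Re_complex_of_real add.right_neutral scaleR_zero_left)

lemma csubspace_diff:
  assumes "csubspace ii S" "x \<in> S" "y \<in> S"
  shows "x - y \<in> S"
proof -
  have "-1 *\<^sub>R y \<in> S" by (rule csubspace_scaleR) fact+
  then show ?thesis using assms unfolding csubspace_def by force
qed

lemma csubspace_cspan: "csubspace ii (cspan ii S)"
  unfolding cspan_def csubspace_def by blast

lemma cspan_base: "x \<in> S \<Longrightarrow> x \<in> cspan ii S"
  unfolding cspan_def by blast

lemma cspan_minimal: "csubspace ii T \<Longrightarrow> S \<subseteq> T \<Longrightarrow> cspan ii S \<subseteq> T"
  unfolding cspan_def by blast

lemma cspan_mono: "S \<subseteq> T \<Longrightarrow> cspan ii S \<subseteq> cspan ii T"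
  unfolding cspan_def by blast

lemma csubspace_zero: "csubspace ii {0}"
  unfolding csubspace_def csc_def by auto

locale cstar =
  fixes st :: "'a::{real_normed_algebra_1,banach} \<Rightarrow> 'a" and ii :: 'a
  assumes cstar: "cstar_algebra st ii"
begin

abbreviation sc :: "complex \<Rightarrow> 'a \<Rightarrow> 'a" where "sc \<equiv> csc ii"

lemma ii_comm: "x * ii = ii * x" and ii_ii: "ii * ii = -1"
  using cstar unfolding cstar_algebra_def by metis+

lemma norm_sc: "norm (sc c x) = cmod c * norm x"
  and st_add: "st (x + y) = st x + st y"
  and st_sc: "st (sc c x) = sc (cnj c) (st x)"
  and st_mult: "st (x * y) = st y * st x"
  and st_st [simp]: "st (st x) = x"
  and norm_st_mult: "norm (st x * x) = (norm x)\<^sup>2"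
  using cstar unfolding cstar_algebra_def by metis+

lemma sc_add: "sc c (x + y) = sc c x + sc c y"
  and sc_add_left: "sc (a + b) x = sc a x + sc b x"
  and sc_1 [simp]: "sc 1 x = x" and sc_0 [simp]: "sc 0 x = 0" and sc_zero [simp]: "sc c 0 = 0"
  and sc_of_real: "sc (of_real u) x = u *\<^sub>R x"
  by (auto simp: csc_def algebra_simps)

lemma sc_diff_left: "sc (a - b) x = sc a x - sc b x"
  and sc_diff: "sc c (x - y) = sc c x - sc c y"
  by (auto simp: csc_def algebra_simps)

lemma sc_sc [simp]: "sc a (sc b x) = sc (a * b) x"
proof -
  have "ii * (ii * y) = - y" for y by (metis ii_ii mult.assoc mult_minus1)
  then show ?thesis by (simp add: csc_def algebra_simps)
qed

lemma sc_mult_left [simp]: "sc c x * y = sc c (x * y)"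
  by (simp add: csc_def algebra_simps)

lemma sc_mult_right [simp]: "x * sc c y = sc c (x * y)"
  by (simp add: csc_def algebra_simps) (metis ii_comm mult.assoc)

lemma sc_sum: "sc c (sum f I) = (\<Sum>i\<in>I. sc c (f i))"
  by (induction I rule: infinite_finite_induct) (auto simp: sc_add)

lemma st_zero [simp]: "st 0 = 0"
  by (metis add_cancel_right_right st_add)

lemma st_sum: "st (sum f I) = (\<Sum>i\<in>I. st (f i))"
  by (induction I rule: infinite_finite_induct) (auto simp: st_add)

lemma norm_st [simp]: "norm (st x) = norm x"
proof -
  have le: "norm y \<le> norm (st y)" for y
  proof (cases "y = 0")
    case False
    have "norm y * norm y \<le> norm (st y) * norm y"
      using norm_mult_ineq[of "st y" y] by (simp add: norm_st_mult power2_eq_square)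
    with False show ?thesis by simp
  qed simp
  from le[of x] le[of "st x"] show ?thesis by simp
qed

lemma bounded_linear_st: "bounded_linear st"
proof (rule bounded_linear_intro[where K=1])
  show "st (u *\<^sub>R x) = u *\<^sub>R st x" for u x
    using st_sc[of "of_real u" x] by (simp only: complex_cnj_complex_of_real sc_of_real)
qed (auto simp: st_add)

lemma bounded_bilinear_sc: "bounded_bilinear sc"
proof
  show "\<exists>K. \<forall>a b. norm (sc a b) \<le> norm a * norm b * K"
    by (rule exI[of _ 1]) (simp add: norm_sc)
qed (auto simp: csc_def algebra_simps)

lemmas tendsto_st = bounded_linear.tendsto[OF bounded_linear_st]
lemmas tendsto_sc = bounded_bilinear.tendsto[OF bounded_bilinear_sc]
lemmas continuous_on_sc = bounded_bilinear.continuous_on[OF bounded_bilinear_sc]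

lemma csubspace_closure:
  assumes "csubspace ii S" shows "csubspace ii (closure S)"
  unfolding csubspace_def
proof (intro conjI ballI allI)
  show "0 \<in> closure S" using assms unfolding csubspace_def by (meson closure_subset subsetD)
next
  fix x y assume "x \<in> closure S" "y \<in> closure S"
  then obtain f g where "\<forall>n. f n \<in> S" "f \<longlonglongrightarrow> x" "\<forall>n. g n \<in> S" "g \<longlonglongrightarrow> y"
    unfolding closure_sequential by blast
  then show "x + y \<in> closure S" unfolding closure_sequential
    using assms by (intro exI[of _ "\<lambda>n. f n + g n"]) (auto simp: csubspace_def intro: tendsto_add)
next
  fix x c assume "x \<in> closure S"
  then obtain f where "\<forall>n. f n \<in> S" "f \<longlonglongrightarrow> x" unfolding closure_sequential by blast
  then show "sc c x \<in> closure S" unfolding closure_sequential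
    using assms by (intro exI[of _ "\<lambda>n. sc c (f n)"]) (auto simp: csubspace_def intro: tendsto_sc)
qed

lemma closed_cspan_minimal:
  assumes "csubspace ii T" "closed T" "S \<subseteq> T"
  shows "closure (cspan ii S) \<subseteq> T"
  using assms by (simp add: closure_minimal cspan_minimal)

lemma cspan_finite:
  assumes "finite I" "x \<in> cspan ii (f ` I)"
  obtains c where "x = (\<Sum>i\<in>I. sc (c i) (f i))"
proof -
  let ?T = "{x. \<exists>c. x = (\<Sum>i\<in>I. sc (c i) (f i))}"
  have "csubspace ii ?T" unfolding csubspace_def
  proof (intro conjI ballI allI)
    show "0 \<in> ?T" by (auto intro: exI[of _ "\<lambda>_. 0"])
    fix x y assume "x \<in> ?T" "y \<in> ?T"
    then obtain c d where "x = (\<Sum>i\<in>I. sc (c i) (f i))" "y = (\<Sum>i\<in>I. sc (d i) (f i))" by blast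
    then show "x + y \<in> ?T" by (auto simp: sc_add_left sum.distrib intro!: exI[of _ "\<lambda>i. c i + d i"])
  next
    fix x a assume "x \<in> ?T"
    then obtain c where "x = (\<Sum>i\<in>I. sc (c i) (f i))" by blast
    then show "sc a x \<in> ?T" by (auto simp: sc_sum intro!: exI[of _ "\<lambda>i. a * c i"])
  qed
  moreover have "f ` I \<subseteq> ?T"
  proof (clarsimp)
    fix i assume "i \<in> I"
    then have "f i = (\<Sum>k\<in>I. sc (if k = i then 1 else 0) (f k))"
      using assms(1) by (simp add: if_distrib[of "\<lambda>c. sc c _"] sum.If_cases cong: if_cong)
    then show "\<exists>c. f i = (\<Sum>k\<in>I. sc (c k) (f k))" by (intro exI[of _ "\<lambda>k. if k = i then 1 else 0"])
  qed
  ultimately have "cspan ii (f ` I) \<subseteq> ?T" by (rule cspan_minimal)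
  with assms(2) that show thesis by blast
qed

lemma cspan_finite_set:
  assumes "finite S" "x \<in> cspan ii S"
  obtains c where "x = (\<Sum>s\<in>S. sc (c s) s)"
  using cspan_finite[OF assms(1), of x "\<lambda>x. x"] assms(2) by auto

section \<open>Norm estimates from the C*-identity\<close>

lemma norm_projection_le_1:
  assumes "st p = p" "p * p = p" shows "norm p \<le> 1"
proof -
  have "norm p = norm p * norm p" using norm_st_mult[of p] assms by (simp add: power2_eq_square)
  then show ?thesis by (cases "p = 0") auto
qed

text \<open>If M bounds the norms of all such sums with blocks of norm at most 1, then so does the
  square root of M, by the C*-identity; hence M = 1 is a bound.\<close>
lemma norm_orthogonal_sum_le:
  assumes fin: "finite I" and st: "\<And>i. i \<in> I \<Longrightarrow> st (p i) = p i"
    and orth: "\<And>i j. i \<in> I \<Longrightarrow> j \<in> I \<Longrightarrow> p i * p j = (if i = j then p i else 0)"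
    and blk: "\<And>i. i \<in> I \<Longrightarrow> p i * b i * p i = b i"
    and K: "\<And>i. i \<in> I \<Longrightarrow> norm (b i) \<le> K" "0 \<le> K"
  shows "norm (sum b I) \<le> K"
proof -
  define F where "F = {b. \<forall>i\<in>I. p i * b i * p i = b i \<and> norm (b i) \<le> 1}"
  have bd: "norm (sum b I) \<le> real (card I)" if "b \<in> F" for b
    using sum_norm_bound[of I b 1] that unfolding F_def by simp
  define M where "M = (SUP b\<in>F. norm (sum b I))"
  have bdd: "bdd_above ((\<lambda>b. norm (sum b I)) ` F)" using bd by (intro bdd_aboveI2) auto
  have le: "norm (sum b I) \<le> M" if "b \<in> F" for b unfolding M_def by (rule cSUP_upper[OF that bdd])
  have sq: "(norm (sum b I))\<^sup>2 \<le> M" if b: "b \<in> F" for b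
  proof -
    have bl: "p i * b i = b i" "b i * p i = b i" if i: "i \<in> I" for i
    proof -
      have e: "p i * b i * p i = b i" using b i unfolding F_def by auto
      have pp: "p i * p i = p i" using orth[OF i i] by simp
      have "p i * (p i * b i * p i) = (p i * p i) * b i * p i" "p i * b i * (p i * p i) = p i * b i * p i * p i"
        by (simp_all only: mult.assoc)
      then show "p i * b i = b i" "b i * p i = b i" unfolding pp e by simp_all
    qed
    have "st (sum b I) * sum b I = (\<Sum>i\<in>I. \<Sum>j\<in>I. st (b i) * b j)"
      by (simp add: st_sum sum_product)
    also have "\<dots> = (\<Sum>i\<in>I. \<Sum>j\<in>I. if i = j then st (b i) * b i else 0)"
    proof (intro sum.cong refl)
      fix i j assume ij: "i \<in> I" "j \<in> I"
      have "st (b i) = st (b i) * p i" using bl(1)[OF ij(1)] st[OF ij(1)] st_mult by metis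
      moreover have "st (b i) * p i * (p j * b j) = st (b i) * (p i * p j) * b j" by (simp only: mult.assoc)
      ultimately have "st (b i) * b j = st (b i) * (p i * p j) * b j"
        using bl(1)[OF ij(2)] by simp
      then show "st (b i) * b j = (if i = j then st (b i) * b i else 0)"
        using orth[OF ij] bl(1)[OF ij(1)] by (auto simp: mult.assoc)
    qed
    also have "\<dots> = (\<Sum>i\<in>I. st (b i) * b i)" using fin by simp
    finally have eq: "st (sum b I) * sum b I = (\<Sum>i\<in>I. st (b i) * b i)" .
    have "(\<lambda>i. st (b i) * b i) \<in> F" unfolding F_def
    proof (clarify, intro conjI)
      fix i assume i: "i \<in> I"
      have "p i * st (b i) = st (b i)" using bl(2)[OF i] st[OF i] st_mult by metis
      then show "p i * (st (b i) * b i) * p i = st (b i) * b i"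
        using bl(2)[OF i] by (metis mult.assoc)
      have "norm (b i) \<le> 1" using b i unfolding F_def by auto
      then show "norm (st (b i) * b i) \<le> 1" by (simp add: norm_st_mult power_le_one)
    qed
    from le[OF this] show ?thesis using norm_st_mult[of "sum b I"] eq by simp
  qed
  have "(\<lambda>_. 0) \<in> F" unfolding F_def by auto
  then have ne: "F \<noteq> {}" by blast
  have M0: "0 \<le> M" using le[OF \<open>(\<lambda>_. 0) \<in> F\<close>] by simp
  have "M \<le> sqrt M" unfolding M_def
    using sq by (intro cSUP_least ne) (simp add: real_le_rsqrt M_def)
  then have "M * M \<le> M * 1"
    using M0 by (metis mult.right_neutral real_sqrt_mult_self abs_of_nonneg mult_mono real_sqrt_ge_zero)
  then have M1: "M \<le> 1" using M0 by (cases "M = 0") auto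
  show ?thesis
  proof (cases "K = 0")
    case True
    then have "\<And>i. i \<in> I \<Longrightarrow> b i = 0" using K(1) by force
    then show ?thesis using K by (simp add: sum.neutral)
  next
    case False
    with K have Kp: "K > 0" by simp
    have "(\<lambda>i. b i /\<^sub>R K) \<in> F" unfolding F_def using blk K Kp by (auto simp: field_simps)
    from le[OF this] M1 have "norm (sum b I /\<^sub>R K) \<le> 1" by (simp add: scaleR_sum_right)
    then show ?thesis using Kp by (simp add: field_simps)
  qed
qed

lemma norm_compress_le:
  assumes "st p = p" "p * p = p" shows "norm (p * b * p) \<le> norm b"
proof -
  have p: "norm p \<le> 1" by (rule norm_projection_le_1) fact+
  have "norm (p * b * p) \<le> norm p * norm b * norm p"
    by (meson norm_ge_zero norm_mult_ineq mult_right_mono order_trans)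
  also have "\<dots> \<le> 1 * norm b * 1" using p by (intro mult_mono) auto
  finally show ?thesis by simp
qed

text \<open>An equivalence relation is the disjoint union of the squares of its classes, and the
  sums over the classes are again orthogonal projections. So the left side is a compression of
  \<open>b\<close> to diagonal blocks, and the block estimate applies.\<close>

lemma norm_pinch_le:
  assumes fin: "finite P" and st: "\<And>p. p \<in> P \<Longrightarrow> st p = p"
    and orth: "\<And>p q. p \<in> P \<Longrightarrow> q \<in> P \<Longrightarrow> p * q = (if p = q then p else 0)"
    and eq: "equiv P \<rho>"
  shows "norm (\<Sum>(p, q)\<in>\<rho>. p * b * q) \<le> norm b"
proof -
  have sub: "C \<subseteq> P" if "C \<in> P // \<rho>" for C using in_quotient_imp_subset[OF eq that] .
  have finQ: "finite (P // \<rho>)" using finite_equiv_class[OF fin] eq finite_quotient[OF fin] equiv_type by blast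
  have finC: "finite C" if "C \<in> P // \<rho>" for C using sub[OF that] fin finite_subset by blast
  have rho: "\<rho> = (\<Union>C\<in>P // \<rho>. C \<times> C)"
  proof (intro equalityI subrelI)
    fix p q assume pq: "(p, q) \<in> \<rho>"
    then have "p \<in> P" using equiv_type[OF eq] by blast
    then show "(p, q) \<in> (\<Union>C\<in>P // \<rho>. C \<times> C)"
      using pq equiv_class_self[OF eq \<open>p \<in> P\<close>] by (intro UN_I[of "\<rho> `` {p}"]) (auto simp: quotientI)
  next
    fix p q assume "(p, q) \<in> (\<Union>C\<in>P // \<rho>. C \<times> C)"
    then show "(p, q) \<in> \<rho>" using in_quotient_imp_in_rel[OF eq] by blast
  qed
  have disj: "C \<inter> C' = {}" if "C \<in> P // \<rho>" "C' \<in> P // \<rho>" "C \<noteq> C'" for C C'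
    using quotient_disj[OF eq that(1,2)] that(3) by blast
  have "(\<Sum>(p, q)\<in>\<rho>. p * b * q) = (\<Sum>C\<in>P // \<rho>. \<Sum>(p, q)\<in>C \<times> C. p * b * q)"
    by (subst (1) rho, rule sum.UNION_disjoint) (use finQ finC disj in auto)
  also have "\<dots> = (\<Sum>C\<in>P // \<rho>. \<Sum>C * b * \<Sum>C)"
    by (intro sum.cong refl)
       (simp add: sum.cartesian_product[symmetric] sum_distrib_right sum_distrib_left sum_product,
        rule sum.swap)
  finally have e: "(\<Sum>(p, q)\<in>\<rho>. p * b * q) = (\<Sum>C\<in>P // \<rho>. \<Sum>C * b * \<Sum>C)" .
  have stC: "st (\<Sum>C) = \<Sum>C" if "C \<in> P // \<rho>" for C
    unfolding st_sum using sub[OF that] st by (intro sum.cong) auto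
  have orthC: "\<Sum>C * \<Sum>C' = (if C = C' then \<Sum>C else 0)" if C: "C \<in> P // \<rho>" "C' \<in> P // \<rho>" for C C'
  proof -
    have "\<Sum>C * \<Sum>C' = (\<Sum>p\<in>C. \<Sum>q\<in>C'. p * q)" by (simp add: sum_product)
    also have "\<dots> = (\<Sum>p\<in>C. \<Sum>q\<in>C'. if p = q then p else 0)"
      using sub[OF C(1)] sub[OF C(2)] by (intro sum.cong refl orth) auto
    also have "\<dots> = (\<Sum>p\<in>C. if p \<in> C' then p else 0)" using finC[OF C(2)] by simp
    also have "\<dots> = (if C = C' then \<Sum>C else 0)"
    proof (cases "C = C'")
      case False
      then have "\<And>p. p \<in> C \<Longrightarrow> p \<notin> C'" using disj[OF C False] by blast
      then show ?thesis using False by simp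
    qed simp
    finally show ?thesis .
  qed
  show ?thesis unfolding e
  proof (rule norm_orthogonal_sum_le[where p="\<lambda>C. \<Sum>C", OF finQ stC orthC])
    fix C assume C: "C \<in> P // \<rho>"
    have CC: "\<Sum>C * \<Sum>C = \<Sum>C" using orthC[OF C C] by simp
    show "\<Sum>C * (\<Sum>C * b * \<Sum>C) * \<Sum>C = \<Sum>C * b * \<Sum>C"
      using CC by (metis mult.assoc)
    show "norm (\<Sum>C * b * \<Sum>C) \<le> norm b" by (rule norm_compress_le[OF stC[OF C] CC])
  qed auto
qed

text \<open>Three-epsilon argument. A pointwise limit of contractions exists on a closed span once
  convergence is known on the spanning set; both the conditional expectation and the circle action
  arise this way.\<close>

lemma closed_convergent_contractions:
  fixes T :: "nat \<Rightarrow> 'a \<Rightarrow> 'a"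
  assumes diff: "\<And>N x y. T N (x - y) = T N x - T N y" and contr: "\<And>N x. norm (T N x) \<le> norm x"
  shows "closed {x. convergent (\<lambda>N. T N x)}"
  unfolding closed_sequential_limits
proof (intro allI impI, elim conjE)
  fix f x assume f: "\<forall>k. f k \<in> {x. convergent (\<lambda>N. T N x)}" and lim: "f \<longlonglongrightarrow> x"
  have "Cauchy (\<lambda>N. T N x)"
  proof (rule metric_CauchyI)
    fix e :: real assume e: "0 < e"
    from lim obtain k where k: "norm (f k - x) < e / 3"
      using e by (metis LIMSEQ_D order_refl divide_pos_pos zero_less_numeral)
    have "Cauchy (\<lambda>N. T N (f k))" using f by (simp add: convergent_Cauchy)
    then obtain M where M: "\<And>i j. i \<ge> M \<Longrightarrow> j \<ge> M \<Longrightarrow> norm (T i (f k) - T j (f k)) < e / 3"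
      using e unfolding Cauchy_def dist_norm by (metis divide_pos_pos zero_less_numeral)
    have d: "norm (T i (f k) - T i x) < e / 3" for i
      using contr[of i "f k - x"] diff[of i "f k" x] k by simp
    show "\<exists>M. \<forall>i\<ge>M. \<forall>j\<ge>M. dist (T i x) (T j x) < e"
    proof (intro exI allI impI)
      fix i j assume "i \<ge> M" "j \<ge> M"
      have "norm (T i (f k) - T i x) < e / 3" "norm (T j (f k) - T j x) < e / 3"
        "norm (T i (f k) - T j (f k)) < e / 3" using d M \<open>i \<ge> M\<close> \<open>j \<ge> M\<close> by auto
      then show "dist (T i x) (T j x) < e" unfolding dist_norm by norm
    qed
  qed
  then show "x \<in> {x. convergent (\<lambda>N. T N x)}" by (simp add: Cauchy_convergent)
qed

text \<open>One factor at a time is extended from generators to the closed span: for fixed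
  \<open>s\<close> the admissible second factors form a closed subspace, and then so do the
  admissible first factors for \<open>y\<close>.\<close>

lemma closed_cspan_mult:
  assumes U: "csubspace ii U" "closed U" and ST: "\<And>s t. s \<in> S \<Longrightarrow> t \<in> T \<Longrightarrow> s * t \<in> U"
    and x: "x \<in> closure (cspan ii S)" and y: "y \<in> closure (cspan ii T)"
  shows "x * y \<in> U"
proof -
  have cl: "closed {z. f z \<in> U}" if "continuous_on UNIV f" for f :: "'a \<Rightarrow> 'a"
    using closed_vimage[OF U(2) that] by (simp add: vimage_def)
  have 1: "s * y \<in> U" if s: "s \<in> S" for s
  proof -
    have "csubspace ii {t. s * t \<in> U}" using U(1) unfolding csubspace_def by (auto simp: distrib_left)
    moreover have "closed {t. s * t \<in> U}" by (intro cl continuous_intros)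
    ultimately have "closure (cspan ii T) \<subseteq> {t. s * t \<in> U}" using ST s by (intro closed_cspan_minimal) auto
    with y show ?thesis by blast
  qed
  have "csubspace ii {s. s * y \<in> U}" using U(1) unfolding csubspace_def by (auto simp: distrib_right)
  moreover have "closed {s. s * y \<in> U}" by (intro cl continuous_intros)
  ultimately have "closure (cspan ii S) \<subseteq> {s. s * y \<in> U}" using 1 by (intro closed_cspan_minimal) auto
  with x show ?thesis by blast
qed

end

section \<open>Systems of matrix units\<close>

text \<open>Index-free form of a matrix unit system: \<open>V n\<close> stands for all matrix units
  of level n, \<open>Q n\<close> for the diagonal ones. \<open>V_eqI\<close> replaces the indices,
  since a matrix unit is determined by its source and range projections. The last three axioms
  describe one refinement step; a projection of level n+1 need not lie below one of level n.\<close>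

locale matrix_units = cstar st ii
  for st :: "'a::{real_normed_algebra_1,banach} \<Rightarrow> 'a" and ii :: 'a +
  fixes V Q :: "nat \<Rightarrow> 'a set"
  assumes finite_V: "finite (V n)"
    and Q_sub_V: "Q n \<subseteq> V n"
    and V_nonzero: "v \<in> V n \<Longrightarrow> v \<noteq> 0"
    and V_st: "v \<in> V n \<Longrightarrow> st v \<in> V n"
    and V_mult: "v \<in> V n \<Longrightarrow> w \<in> V n \<Longrightarrow> v * w = 0 \<or> v * w \<in> V n"
    and V_source: "v \<in> V n \<Longrightarrow> st v * v \<in> Q n"
    and V_partial_isometry: "v \<in> V n \<Longrightarrow> v * (st v * v) = v"
    and Q_st: "q \<in> Q n \<Longrightarrow> st q = q"
    and Q_orth: "p \<in> Q n \<Longrightarrow> q \<in> Q n \<Longrightarrow> p * q = (if p = q then p else 0)"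
    and V_eqI: "v \<in> V n \<Longrightarrow> w \<in> V n \<Longrightarrow> st v * v = st w * w \<Longrightarrow> v * st v = w * st w \<Longrightarrow> v = w"
    and restrict_step: "v \<in> V n \<Longrightarrow> q \<in> Q (Suc n) \<Longrightarrow> v * q = 0 \<or> v * q \<in> V (Suc n)"
    and sum_step: "v \<in> V n \<Longrightarrow> (\<Sum>q\<in>Q (Suc n). v * q) = v"
    and Q_step: "p \<in> Q n \<Longrightarrow> q \<in> Q (Suc n) \<Longrightarrow> p * q = 0 \<or> p * q = q"
begin

lemma finite_Q: "finite (Q n)" using finite_V Q_sub_V finite_subset by blast

lemma Q_V: "q \<in> Q n \<Longrightarrow> q \<in> V n" using Q_sub_V by blast

lemma Q_idem: "q \<in> Q n \<Longrightarrow> q * q = q" using Q_orth by simp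

lemma Q_nonzero: "q \<in> Q n \<Longrightarrow> q \<noteq> 0" using Q_V V_nonzero by blast

lemma V_range: "v \<in> V n \<Longrightarrow> v * st v \<in> Q n" using V_source[of "st v"] V_st by simp

text \<open>If source and range agree, \<open>V_eqI\<close> identifies \<open>q\<close> with its own
  source projection.\<close>

lemma Q_iff: "q \<in> Q n \<longleftrightarrow> q \<in> V n \<and> st q * q = q * st q"
proof
  show "q \<in> Q n" if "q \<in> V n \<and> st q * q = q * st q"
  proof -
    let ?p = "st q * q"
    have q: "q \<in> V n" "st q * q = q * st q" using that by blast+
    then have p: "?p \<in> Q n" using V_source by blast
    have x: "st ?p * ?p = ?p" "?p * st ?p = ?p" unfolding Q_st[OF p] Q_idem[OF p] by simp_all
    have "q = ?p"
      by (rule V_eqI[OF q(1) Q_V[OF p] x(1)[symmetric] trans[OF q(2)[symmetric] x(2)[symmetric]]])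
    with p show ?thesis by metis
  qed
qed (simp add: Q_V Q_st)

lemma norm_V_le: "v \<in> V n \<Longrightarrow> norm v \<le> 1"
proof -
  assume v: "v \<in> V n"
  have "norm (st v * v) \<le> 1" by (rule norm_projection_le_1[OF Q_st Q_idem]) (rule V_source[OF v])+
  then show ?thesis using norm_st_mult[of v] by (metis abs_le_square_iff abs_norm_cancel abs_one one_power2)
qed

lemma norm_Q: "q \<in> Q n \<Longrightarrow> norm q = 1"
proof -
  assume q: "q \<in> Q n"
  have "norm q = norm q * norm q" using norm_st_mult[of q] q by (simp add: power2_eq_square Q_st Q_idem)
  then show ?thesis using Q_nonzero[OF q] by simp
qed

text \<open>Iterated refinement. A projection of level N+1 either has a parent of level N, through
  which every product factors, or is orthogonal to all of \<open>Q N\<close> and therefore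
  annihilated by the matrix units of level n.\<close>

lemma Q_le: "p \<in> Q n \<Longrightarrow> n \<le> N \<Longrightarrow> q \<in> Q N \<Longrightarrow> p * q = 0 \<or> p * q = q"
  and V_restrict: "v \<in> V n \<Longrightarrow> n \<le> N \<Longrightarrow> q \<in> Q N \<Longrightarrow> v * q = 0 \<or> v * q \<in> V N"
  and V_sum: "v \<in> V n \<Longrightarrow> n \<le> N \<Longrightarrow> (\<Sum>q\<in>Q N. v * q) = v"
proof -
  have "(\<forall>p\<in>Q n. \<forall>q\<in>Q N. p * q = 0 \<or> p * q = q) \<and> (\<forall>v\<in>V n. \<forall>q\<in>Q N. v * q = 0 \<or> v * q \<in> V N)
     \<and> (\<forall>v\<in>V n. (\<Sum>q\<in>Q N. v * q) = v)" if "n \<le> N"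
    using that
  proof (induction N rule: dec_induct)
    case base
    have "(\<Sum>q\<in>Q n. v * q) = v" if v: "v \<in> V n" for v
    proof -
      have "(\<Sum>q\<in>Q n. v * q) = (\<Sum>q\<in>Q n. if q = st v * v then v else 0)"
      proof (intro sum.cong refl)
        fix q assume q: "q \<in> Q n"
        have "v * (st v * v * q) = v * (st v * v) * q" by (simp only: mult.assoc)
        then show "v * q = (if q = st v * v then v else 0)"
          using Q_orth[OF V_source[OF v] q] V_partial_isometry[OF v] by (auto split: if_splits)
      qed
      then show ?thesis using V_source[OF v] finite_Q by simp
    qed
    then show ?case using Q_orth V_mult Q_V by metis
  next
    case (step N)
    have par: "(\<exists>q'\<in>Q N. q' * q = q) \<or> (\<forall>v\<in>V n. v * q = 0)" if q: "q \<in> Q (Suc N)" for q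
    proof (cases "\<exists>q'\<in>Q N. q' * q = q")
      case False
      then have 0: "q' * q = 0" if "q' \<in> Q N" for q' using Q_step[OF that q] that by blast
      have "v * q = 0" if "v \<in> V n" for v
      proof -
        have "v * q = (\<Sum>q'\<in>Q N. v * q') * q" using step.IH that by simp
        also have "\<dots> = 0" by (simp add: sum_distrib_right mult.assoc 0)
        finally show ?thesis .
      qed
      then show ?thesis by blast
    qed blast
    show ?case
    proof (intro conjI ballI)
      fix p q assume p: "p \<in> Q n" and q: "q \<in> Q (Suc N)"
      show "p * q = 0 \<or> p * q = q" using par[OF q]
      proof
        assume "\<exists>q'\<in>Q N. q' * q = q"
        then obtain q' where q': "q' \<in> Q N" "q' * q = q" by blast
        then have "p * q = p * q' * q" by (simp add: mult.assoc)
        then show ?thesis using step.IH p q' by (metis mult_zero_left)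
      qed (use p Q_V in blast)
    next
      fix v q assume v: "v \<in> V n" and q: "q \<in> Q (Suc N)"
      show "v * q = 0 \<or> v * q \<in> V (Suc N)" using par[OF q]
      proof
        assume "\<exists>q'\<in>Q N. q' * q = q"
        then obtain q' where q': "q' \<in> Q N" "q' * q = q" by blast
        then have "v * q = v * q' * q" by (simp add: mult.assoc)
        then show ?thesis using step.IH v q' restrict_step[OF _ q, of "v * q'"] by (metis mult_zero_left)
      qed (use v in blast)
    next
      fix v assume v: "v \<in> V n"
      have s: "(\<Sum>q\<in>Q (Suc N). v * q' * q) = v * q'" if "q' \<in> Q N" for q'
        using step.IH v that sum_step[of "v * q'" N] by (metis mult_zero_left sum.neutral)
      have "(\<Sum>q\<in>Q (Suc N). v * q) = (\<Sum>q\<in>Q (Suc N). (\<Sum>q'\<in>Q N. v * q') * q)"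
        using step.IH v by simp
      also have "\<dots> = (\<Sum>q'\<in>Q N. \<Sum>q\<in>Q (Suc N). v * q' * q)"
        by (simp add: sum_distrib_right) (rule sum.swap)
      also have "\<dots> = v" using step.IH v by (simp add: s)
      finally show "(\<Sum>q\<in>Q (Suc N). v * q) = v" .
    qed
  qed
  then show "p \<in> Q n \<Longrightarrow> n \<le> N \<Longrightarrow> q \<in> Q N \<Longrightarrow> p * q = 0 \<or> p * q = q"
    "v \<in> V n \<Longrightarrow> n \<le> N \<Longrightarrow> q \<in> Q N \<Longrightarrow> v * q = 0 \<or> v * q \<in> V N"
    "v \<in> V n \<Longrightarrow> n \<le> N \<Longrightarrow> (\<Sum>q\<in>Q N. v * q) = v" by blast+
qed

text \<open>With \<open>p\<close> of the coarser level, \<open>p * q\<close> is 0 or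
  \<open>q\<close>; both are self-adjoint, so taking adjoints swaps the factors.\<close>

lemma Q_comm: "p \<in> Q n \<Longrightarrow> q \<in> Q N \<Longrightarrow> p * q = q * p"
proof -
  have *: "p * q = q * p" if "p \<in> Q n" "q \<in> Q N" "n \<le> N" for p q n N
    using Q_le[OF that(1,3,2)] st_mult[of p q] Q_st[OF that(1)] Q_st[OF that(2)] by (metis st_zero)
  assume "p \<in> Q n" "q \<in> Q N"
  then show ?thesis using *[of p n q N] *[of q N p n] by (cases "n \<le> N") auto
qed

text \<open>The source projection of \<open>v\<close> is orthogonal to \<open>q\<close> or dominates
  it; in the second case the cut \<open>v * q\<close> is a matrix unit with source exactly
  \<open>q\<close>.\<close>

lemma V_restrict_cases:
  assumes v: "v \<in> V n" and N: "n \<le> N" and q: "q \<in> Q N"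
  obtains "v * q = 0" "st v * v * q = 0" | "v * q \<in> V N" "st v * v * q = q" "st (v * q) * (v * q) = q"
proof (cases "st v * v * q = 0")
  case True
  then have "v * (st v * v * q) = 0" by simp
  then have "v * (st v * v) * q = 0" by (simp only: mult.assoc)
  then have "v * q = 0" using V_partial_isometry[OF v] by simp
  then show thesis using True that(1) by blast
next
  case False
  then have e: "st v * v * q = q" using Q_le[OF V_source[OF v] N q] by auto
  have "v * q \<noteq> 0" using e Q_nonzero[OF q] by (metis mult.assoc mult_zero_right)
  moreover have "st (v * q) * (v * q) = q"
  proof -
    have "st (v * q) * (v * q) = q * (st v * v * q)" by (simp only: st_mult Q_st[OF q] mult.assoc)
    then show ?thesis using e Q_idem[OF q] by simp
  qed
  ultimately show thesis using V_restrict[OF v N q] that(2) e by blast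
qed

lemma V_conj: 
  assumes v: "v \<in> V n" and N: "n \<le> N" and q: "q \<in> Q N"
  shows "v * q * st v = 0 \<or> v * q * st v \<in> Q N"
proof (cases rule: V_restrict_cases[OF v N q])
  case 2
  have "(v * q) * st (v * q) = v * (q * q) * st v" by (simp only: st_mult Q_st[OF q] mult.assoc)
  then show ?thesis using V_range[OF 2(1)] Q_idem[OF q] by simp
qed simp

text \<open>An increasing approximate unit, not an identity: the levels may be embedded
  non-unitally.\<close>

definition unit :: "nat \<Rightarrow> 'a" where "unit n = \<Sum>(Q n)"

lemma V_unit: "v \<in> V n \<Longrightarrow> n \<le> N \<Longrightarrow> v * unit N = v"
  using V_sum by (simp add: unit_def sum_distrib_left)

lemma Q_child:
  assumes "p \<in> Q n" "n \<le> N" obtains q where "q \<in> Q N" "p * q = q"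
proof -
  have "\<not> (\<forall>q\<in>Q N. p * q = 0)"
    using V_sum[OF Q_V[OF assms(1)] assms(2)] Q_nonzero[OF assms(1)] by (metis sum.neutral)
  then show thesis using Q_le[OF assms] that by blast
qed

lemma Q_parent_unique:
  assumes "p \<in> Q n" "p' \<in> Q n" "q \<noteq> 0" "p * q = q" "p' * q = q" shows "p = p'"
proof (rule ccontr)
  assume "p \<noteq> p'"
  have "q = p * (p' * q)" using assms by simp
  also have "\<dots> = 0" using Q_orth[OF assms(1,2)] \<open>p \<noteq> p'\<close> by (simp add: mult.assoc[symmetric])
  finally show False using assms(3) by simp
qed

section \<open>The closed spans of the matrix units and of the diagonal matrix units\<close>

definition VV :: "'a set" where "VV = (\<Union>n. V n)"
definition QQ :: "'a set" where "QQ = (\<Union>n. Q n)"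
text \<open>Later identified with \<open>cstar_gen st ii A\<close>, just as \<open>DD\<close> is
  with \<open>diag st A\<close>.\<close>

definition BB :: "'a set" where "BB = closure (cspan ii VV)"
definition DD :: "'a set" where "DD = closure (cspan ii QQ)"

lemma V_in_cspan: "v \<in> V n \<Longrightarrow> n \<le> N \<Longrightarrow> v \<in> cspan ii (V N)"
proof -
  assume v: "v \<in> V n" and N: "n \<le> N"
  have "(\<Sum>q\<in>Q N. v * q) \<in> cspan ii (V N)"
  proof (rule csubspace_sum[OF csubspace_cspan])
    fix q assume "q \<in> Q N"
    from V_restrict[OF v N this] show "v * q \<in> cspan ii (V N)"
      using csubspace_cspan[of ii "V N"] cspan_base[of "v * q" "V N" ii] unfolding csubspace_def by metis
  qed
  then show ?thesis using V_sum[OF v N] by simp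
qed

lemma Q_in_cspan: "p \<in> Q n \<Longrightarrow> n \<le> N \<Longrightarrow> p \<in> cspan ii (Q N)"
proof -
  assume p: "p \<in> Q n" and N: "n \<le> N"
  have "(\<Sum>q\<in>Q N. p * q) \<in> cspan ii (Q N)"
  proof (rule csubspace_sum[OF csubspace_cspan])
    fix q assume "q \<in> Q N"
    with Q_le[OF p N this] show "p * q \<in> cspan ii (Q N)"
      using csubspace_cspan[of ii "Q N"] cspan_base[of "q" "Q N" ii] unfolding csubspace_def by metis
  qed
  then show ?thesis using V_sum[OF Q_V[OF p] N] by simp
qed

lemma csubspace_UN_mono:
  assumes "\<And>n N. n \<le> N \<Longrightarrow> S n \<subseteq> S N" "\<And>n. csubspace ii (S n)"
  shows "csubspace ii (\<Union>n::nat. S n)"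
  unfolding csubspace_def
proof (intro conjI ballI allI)
  show "0 \<in> (\<Union>n. S n)" using assms(2) unfolding csubspace_def by blast
  fix x y assume "x \<in> (\<Union>n. S n)" "y \<in> (\<Union>n. S n)"
  then obtain i j where "x \<in> S i" "y \<in> S j" by blast
  then have "x \<in> S (max i j)" "y \<in> S (max i j)"
    using assms(1)[of i "max i j"] assms(1)[of j "max i j"] by auto
  then show "x + y \<in> (\<Union>n. S n)" using assms(2) unfolding csubspace_def by blast
next
  fix x c assume "x \<in> (\<Union>n. S n)"
  then show "sc c x \<in> (\<Union>n. S n)" using assms(2) unfolding csubspace_def by blast
qed

lemma cspan_V_mono: "n \<le> N \<Longrightarrow> cspan ii (V n) \<subseteq> cspan ii (V N)"
  by (intro cspan_minimal csubspace_cspan) (auto intro: V_in_cspan)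

lemma cspan_Q_mono: "n \<le> N \<Longrightarrow> cspan ii (Q n) \<subseteq> cspan ii (Q N)"
  by (intro cspan_minimal csubspace_cspan) (auto intro: Q_in_cspan)

lemma cspan_VV: "cspan ii VV = (\<Union>n. cspan ii (V n))"
proof
  show "cspan ii VV \<subseteq> (\<Union>n. cspan ii (V n))"
    by (intro cspan_minimal csubspace_UN_mono cspan_V_mono csubspace_cspan)
       (auto simp: VV_def intro: cspan_base)
  show "(\<Union>n. cspan ii (V n)) \<subseteq> cspan ii VV"
    by (intro UN_least cspan_mono) (auto simp: VV_def)
qed

lemma cspan_QQ: "cspan ii QQ = (\<Union>n. cspan ii (Q n))"
proof
  show "cspan ii QQ \<subseteq> (\<Union>n. cspan ii (Q n))"
    by (intro cspan_minimal csubspace_UN_mono cspan_Q_mono csubspace_cspan)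
       (auto simp: QQ_def intro: cspan_base)
  show "(\<Union>n. cspan ii (Q n)) \<subseteq> cspan ii QQ"
    by (intro UN_least cspan_mono) (auto simp: QQ_def)
qed

lemma csubspace_BB: "csubspace ii BB" and closed_BB: "closed BB"
  and csubspace_DD: "csubspace ii DD" and closed_DD: "closed DD"
  unfolding BB_def DD_def by (auto intro: csubspace_closure csubspace_cspan)

lemma V_BB: "v \<in> V n \<Longrightarrow> v \<in> BB"
  unfolding BB_def VV_def by (meson UNIV_I UN_I closure_subset cspan_base subsetD)

lemma Q_DD: "q \<in> Q n \<Longrightarrow> q \<in> DD"
  unfolding DD_def QQ_def by (meson UNIV_I UN_I closure_subset cspan_base subsetD)

lemma BB_minimal:
  assumes "csubspace ii T" "closed T" "\<And>n v. v \<in> V n \<Longrightarrow> v \<in> T" shows "BB \<subseteq> T"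
  unfolding BB_def using assms by (intro closed_cspan_minimal) (auto simp: VV_def)

lemma DD_minimal:
  assumes "csubspace ii T" "closed T" "\<And>n v. v \<in> Q n \<Longrightarrow> v \<in> T" shows "DD \<subseteq> T"
  unfolding DD_def using assms by (intro closed_cspan_minimal) (auto simp: QQ_def)

lemma DD_BB: "DD \<subseteq> BB"
  by (intro DD_minimal csubspace_BB closed_BB) (auto intro: V_BB Q_V)

lemma BB_mult: "a \<in> BB \<Longrightarrow> b \<in> BB \<Longrightarrow> a * b \<in> BB"
proof -
  have "v * w \<in> BB" if "v \<in> VV" "w \<in> VV" for v w
  proof -
    from that obtain i j where "v \<in> V i" "w \<in> V j" unfolding VV_def by blast
    then have "v \<in> closure (cspan ii (V (max i j)))" "w \<in> closure (cspan ii (V (max i j)))"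
      using V_in_cspan[of v i "max i j"] V_in_cspan[of w j "max i j"] closure_subset by auto
    then show ?thesis
    proof (rule closed_cspan_mult[OF csubspace_BB closed_BB, rotated])
      show "s * t \<in> BB" if "s \<in> V (max i j)" "t \<in> V (max i j)" for s t
        using V_mult[OF that] V_BB csubspace_BB unfolding csubspace_def by metis
    qed
  qed
  then show "a \<in> BB \<Longrightarrow> b \<in> BB \<Longrightarrow> a * b \<in> BB"
    using closed_cspan_mult[OF csubspace_BB closed_BB, of VV VV a b] unfolding BB_def by blast
qed

lemma DD_mult: "a \<in> DD \<Longrightarrow> b \<in> DD \<Longrightarrow> a * b \<in> DD"
proof -
  have "v * w \<in> DD" if "v \<in> QQ" "w \<in> QQ" for v w
  proof -
    from that obtain i j where v: "v \<in> Q i" and w: "w \<in> Q j" unfolding QQ_def by blast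
    then show ?thesis using Q_le[OF v _ w] Q_le[OF w _ v] Q_comm[OF v w] Q_DD csubspace_DD
      unfolding csubspace_def by (metis nat_le_linear)
  qed
  then show "a \<in> DD \<Longrightarrow> b \<in> DD \<Longrightarrow> a * b \<in> DD"
    using closed_cspan_mult[OF csubspace_DD closed_DD, of QQ QQ a b] unfolding DD_def by blast
qed

lemma closed_st_preimage:
  assumes "csubspace ii T" "closed T" shows "csubspace ii {a. st a \<in> T}" "closed {a. st a \<in> T}"
proof -
  show "csubspace ii {a. st a \<in> T}" using assms(1) unfolding csubspace_def by (auto simp: st_add st_sc)
  show "closed {a. st a \<in> T}"
    using closed_vimage[OF assms(2), of st] bounded_linear.continuous_on[OF bounded_linear_st continuous_on_id]
    by (simp add: vimage_def)
qed

lemma BB_st: "a \<in> BB \<Longrightarrow> st a \<in> BB"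
  using BB_minimal[OF closed_st_preimage[OF csubspace_BB closed_BB]] V_st V_BB by blast

lemma DD_st: "a \<in> DD \<Longrightarrow> st a \<in> DD"
  using DD_minimal[OF closed_st_preimage[OF csubspace_DD closed_DD]] Q_st Q_DD by force

lemma closed_commutant: "csubspace ii {a. a * b = b * a}" "closed {a. a * b = b * a}"
proof -
  show "csubspace ii {a. a * b = b * a}" unfolding csubspace_def by (auto simp: distrib_left distrib_right)
  show "closed {a. a * b = b * a}" by (intro closed_Collect_eq continuous_intros)
qed

lemma DD_Q_comm: "a \<in> DD \<Longrightarrow> q \<in> Q n \<Longrightarrow> a * q = q * a"
  using DD_minimal[OF closed_commutant, of q] Q_comm by blast

lemma DD_comm: "a \<in> DD \<Longrightarrow> b \<in> DD \<Longrightarrow> a * b = b * a"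
proof -
  assume a: "a \<in> DD" and b: "b \<in> DD"
  have "DD \<subseteq> {x. x * b = b * x}"
    by (rule DD_minimal[OF closed_commutant]) (use DD_Q_comm[OF b] in simp)
  with a show ?thesis by blast
qed

text \<open>A diagonal projection is split at a common level, where conjugation by \<open>v\<close>
  sends each projection to zero or to a projection of that level.\<close>

lemma DD_conj: "d \<in> DD \<Longrightarrow> v \<in> V n \<Longrightarrow> st v * d * v \<in> DD"
proof -
  assume d: "d \<in> DD" and v: "v \<in> V n"
  have "DD \<subseteq> {a. st v * a * v \<in> DD}"
  proof (rule DD_minimal)
    show "csubspace ii {a. st v * a * v \<in> DD}"
      using csubspace_DD unfolding csubspace_def by (auto simp: distrib_left distrib_right)
    show "closed {a. st v * a * v \<in> DD}"
      using closed_vimage[OF closed_DD, of "\<lambda>a. st v * a * v"]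
      by (simp add: vimage_def continuous_on_mult_left continuous_on_mult_right)
    fix N p assume p: "p \<in> Q N"
    let ?M = "max n N"
    have s: "st v * p * v = (\<Sum>q\<in>Q ?M. st v * (p * q) * v)"
      using V_sum[OF Q_V[OF p], of ?M] by (simp add: sum_distrib_left[symmetric] sum_distrib_right[symmetric])
    have "st v * (p * q) * v \<in> DD" if q: "q \<in> Q ?M" for q
      using Q_le[OF p _ q] V_conj[OF V_st[OF v] _ q] Q_DD csubspace_DD unfolding csubspace_def
      by (metis max.cobounded1 max.cobounded2 mult_zero_left mult_zero_right st_st)
    then show "p \<in> {a. st v * a * v \<in> DD}" by (simp add: s csubspace_sum[OF csubspace_DD])
  qed
  with d show ?thesis by blast
qed

lemma BB_approx:
  assumes "b \<in> BB" "e > 0"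
  obtains n c where "n \<ge> k" "norm (b - (\<Sum>v\<in>V n. sc (c v) v)) < e"
proof -
  from assms obtain y where y: "y \<in> cspan ii VV" "dist y b < e"
    unfolding BB_def closure_approachable by blast
  then obtain i where "y \<in> cspan ii (V i)" unfolding cspan_VV by blast
  then have "y \<in> cspan ii (V (max i k))" using cspan_V_mono[of i "max i k"] by auto
  from cspan_finite_set[OF finite_V this] obtain c where "y = (\<Sum>v\<in>V (max i k). sc (c v) v)" .
  with y that[of "max i k" c] show thesis by (auto simp: dist_norm norm_minus_commute)
qed

lemma DD_approx:
  assumes "b \<in> DD" "e > 0"
  obtains n c where "n \<ge> k" "norm (b - (\<Sum>v\<in>Q n. sc (c v) v)) < e"
proof -
  from assms obtain y where y: "y \<in> cspan ii QQ" "dist y b < e"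
    unfolding DD_def closure_approachable by blast
  then obtain i where "y \<in> cspan ii (Q i)" unfolding cspan_QQ by blast
  then have "y \<in> cspan ii (Q (max i k))" using cspan_Q_mono[of i "max i k"] by auto
  from cspan_finite_set[OF finite_Q this] obtain c where "y = (\<Sum>v\<in>Q (max i k). sc (c v) v)" .
  with y that[of "max i k" c] show thesis by (auto simp: dist_norm norm_minus_commute)
qed

end

section \<open>The conditional expectation onto the diagonal\<close>

context matrix_units begin

lemma continuous_on_BB_if:
  fixes f :: "'a \<Rightarrow> 'b::real_normed_vector"
  assumes "\<And>a b. a \<in> BB \<Longrightarrow> b \<in> BB \<Longrightarrow> norm (f a - f b) \<le> norm (a - b)"
  shows "continuous_on BB f"
  using assms unfolding continuous_on_iff dist_norm by (meson order_le_less_trans)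

definition EN :: "nat \<Rightarrow> 'a \<Rightarrow> 'a" where "EN N b = (\<Sum>q\<in>Q N. q * b * q)"

lemma EN_diff: "EN N (a - b) = EN N a - EN N b"
  by (simp add: EN_def algebra_simps sum_subtractf)

lemma EN_add: "EN N (a + b) = EN N a + EN N b"
  by (simp add: EN_def algebra_simps sum.distrib)

lemma EN_sc: "EN N (sc c a) = sc c (EN N a)"
  by (simp add: EN_def sc_sum)

lemma norm_EN_le: "norm (EN N b) \<le> norm b"
  unfolding EN_def
proof (rule norm_orthogonal_sum_le[where p="\<lambda>q. q", OF finite_Q Q_st Q_orth])
  fix q assume q: "q \<in> Q N"
  show "q * (q * b * q) * q = q * b * q" using Q_idem[OF q] by (metis mult.assoc)
  show "norm (q * b * q) \<le> norm b" by (rule norm_compress_le[OF Q_st[OF q] Q_idem[OF q]])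
qed auto

text \<open>An off-diagonal \<open>v\<close> has distinct, hence orthogonal, source and range. A
  \<open>q\<close> below the source then kills \<open>v\<close> from the left, and any other
  \<open>q\<close> kills it from the right.\<close>

lemma EN_V: assumes v: "v \<in> V n" and N: "n \<le> N" shows "EN N v = (if v \<in> Q n then v else 0)"
proof (cases "v \<in> Q n")
  case True
  have "q * v * q = v * q" if q: "q \<in> Q N" for q
    using Q_comm[OF True q] Q_idem[OF q] by (metis mult.assoc)
  then show ?thesis unfolding EN_def using True V_sum[OF v N] by simp
next
  case False
  have "q * v * q = 0" if q: "q \<in> Q N" for q
  proof (cases rule: V_restrict_cases[OF v N q])
    case 2
    have "st v * v * (v * st v) = 0"
      using Q_orth[OF V_source[OF v] V_range[OF v]] False Q_iff v by auto
    moreover have "v * st v * v = v" using V_partial_isometry[OF v] by (simp add: mult.assoc)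
    ultimately have 0: "st v * v * v = 0" by (metis mult.assoc mult_zero_left)
    have "st (st v * v * q) = q" using 2(2) Q_st[OF q] by simp
    then have "q * (st v * v) = q" by (simp add: st_mult Q_st[OF q])
    then have "q * v = q * (st v * v * v)" by (metis mult.assoc)
    then show ?thesis using 0 by simp
  qed (simp add: mult.assoc)
  then show ?thesis unfolding EN_def using False by simp
qed

lemma convergent_EN: "b \<in> BB \<Longrightarrow> convergent (\<lambda>N. EN N b)"
proof -
  have "BB \<subseteq> {b. convergent (\<lambda>N. EN N b)}"
  proof (rule BB_minimal)
    show "csubspace ii {b. convergent (\<lambda>N. EN N b)}"
      unfolding csubspace_def convergent_def mem_Collect_eq
    proof (intro conjI ballI allI; (elim CollectE exE)?)
      show "\<exists>L. (\<lambda>N. EN N 0) \<longlonglongrightarrow> L" by (intro exI[of _ 0]) (simp add: EN_def)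
      fix x y L L' assume "(\<lambda>N. EN N x) \<longlonglongrightarrow> L" "(\<lambda>N. EN N y) \<longlonglongrightarrow> L'"
      from tendsto_add[OF this] show "\<exists>L. (\<lambda>N. EN N (x + y)) \<longlonglongrightarrow> L" unfolding EN_add by blast
    next
      fix c x L assume "(\<lambda>N. EN N x) \<longlonglongrightarrow> L"
      from tendsto_sc[OF tendsto_const this] show "\<exists>L. (\<lambda>N. EN N (sc c x)) \<longlonglongrightarrow> L" unfolding EN_sc by blast
    qed
    show "closed {b. convergent (\<lambda>N. EN N b)}"
      by (rule closed_convergent_contractions[OF EN_diff norm_EN_le])
    fix n v assume "v \<in> V n"
    then have "eventually (\<lambda>N. EN N v = (if v \<in> Q n then v else 0)) sequentially"
      by (intro eventually_sequentiallyI[of n] EN_V)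
    then show "v \<in> {b. convergent (\<lambda>N. EN N b)}"
      by (auto simp: convergent_def intro!: tendsto_eventually exI)
  qed
  then show "b \<in> BB \<Longrightarrow> convergent (\<lambda>N. EN N b)" by blast
qed

definition E :: "'a \<Rightarrow> 'a" where "E b = lim (\<lambda>N. EN N b)"

lemma EN_tendsto: "b \<in> BB \<Longrightarrow> (\<lambda>N. EN N b) \<longlonglongrightarrow> E b"
  using convergent_EN by (simp add: E_def convergent_LIMSEQ_iff)

lemma E_eqI: "b \<in> BB \<Longrightarrow> (\<lambda>N. EN N b) \<longlonglongrightarrow> y \<Longrightarrow> E b = y"
  using EN_tendsto LIMSEQ_unique by blast

lemma BB_add: "a \<in> BB \<Longrightarrow> b \<in> BB \<Longrightarrow> a + b \<in> BB"
  and BB_sc: "a \<in> BB \<Longrightarrow> sc c a \<in> BB"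
  and BB_diff: "a \<in> BB \<Longrightarrow> b \<in> BB \<Longrightarrow> a - b \<in> BB"
  and BB_0: "0 \<in> BB"
  using csubspace_BB csubspace_diff[OF csubspace_BB] unfolding csubspace_def by blast+

lemma DD_add: "a \<in> DD \<Longrightarrow> b \<in> DD \<Longrightarrow> a + b \<in> DD"
  and DD_sc: "a \<in> DD \<Longrightarrow> sc c a \<in> DD"
  and DD_diff: "a \<in> DD \<Longrightarrow> b \<in> DD \<Longrightarrow> a - b \<in> DD"
  and DD_0: "0 \<in> DD"
  using csubspace_DD csubspace_diff[OF csubspace_DD] unfolding csubspace_def by blast+

lemma E_add: "a \<in> BB \<Longrightarrow> b \<in> BB \<Longrightarrow> E (a + b) = E a + E b"
  by (rule E_eqI[OF BB_add]) (auto simp: EN_add intro: tendsto_add EN_tendsto)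

lemma E_diff: "a \<in> BB \<Longrightarrow> b \<in> BB \<Longrightarrow> E (a - b) = E a - E b"
  by (rule E_eqI[OF BB_diff]) (auto simp: EN_diff intro: tendsto_diff EN_tendsto)

lemma E_sc: "a \<in> BB \<Longrightarrow> E (sc c a) = sc c (E a)"
  by (rule E_eqI[OF BB_sc]) (auto simp: EN_sc intro: tendsto_sc EN_tendsto)

lemma norm_E_le: "b \<in> BB \<Longrightarrow> norm (E b) \<le> norm b"
  by (rule LIMSEQ_le_const2[OF tendsto_norm[OF EN_tendsto]]) (auto intro: norm_EN_le)

lemma E_V: "v \<in> V n \<Longrightarrow> E v = (if v \<in> Q n then v else 0)"
  by (intro E_eqI[OF V_BB tendsto_eventually] eventually_sequentiallyI[of n] EN_V)

lemma E_0 [simp]: "E 0 = 0"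
  using norm_E_le[OF BB_0] by simp

lemma continuous_on_E: "continuous_on BB E"
  by (rule continuous_on_BB_if) (metis E_diff norm_E_le BB_diff)

lemma E_DD: "b \<in> BB \<Longrightarrow> E b \<in> DD"
proof -
  have "BB \<subseteq> {b \<in> BB. E b \<in> DD}"
  proof (rule BB_minimal)
    show "csubspace ii {b \<in> BB. E b \<in> DD}" unfolding csubspace_def
      by (auto simp: E_add E_sc BB_0 DD_0 BB_add DD_add BB_sc DD_sc)
    show "closed {b \<in> BB. E b \<in> DD}"
      using continuous_closed_preimage[OF continuous_on_E closed_BB closed_DD]
      by (simp add: vimage_def Int_def)
    show "\<And>n v. v \<in> V n \<Longrightarrow> v \<in> {b \<in> BB. E b \<in> DD}" by (auto simp: V_BB E_V DD_0 Q_DD)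
  qed
  then show "b \<in> BB \<Longrightarrow> E b \<in> DD" by blast
qed

lemma E_mult_right: assumes b: "b \<in> BB" and d: "d \<in> DD" shows "E (b * d) = E b * d"
proof (rule E_eqI)
  show "b * d \<in> BB" using b d DD_BB BB_mult by blast
  have "EN N (b * d) = EN N b * d" for N
    unfolding EN_def sum_distrib_right
    by (intro sum.cong refl) (simp add: mult.assoc DD_Q_comm[OF d])
  then show "(\<lambda>N. EN N (b * d)) \<longlonglongrightarrow> E b * d" using EN_tendsto[OF b] by (auto intro: tendsto_mult)
qed

lemma E_mult_left: assumes b: "b \<in> BB" and d: "d \<in> DD" shows "E (d * b) = d * E b"
proof (rule E_eqI)
  show "d * b \<in> BB" using b d DD_BB BB_mult by blast
  have "EN N (d * b) = d * EN N b" for N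
    unfolding EN_def sum_distrib_left
    by (intro sum.cong refl) (simp add: mult.assoc[symmetric] DD_Q_comm[OF d])
  then show "(\<lambda>N. EN N (d * b)) \<longlonglongrightarrow> d * E b" using EN_tendsto[OF b] by (auto intro: tendsto_mult)
qed

lemma E_id: "d \<in> DD \<Longrightarrow> E d = d"
proof -
  have "DD \<subseteq> {b \<in> BB. E b - b = 0}"
  proof (rule DD_minimal)
    show "csubspace ii {b \<in> BB. E b - b = 0}" unfolding csubspace_def
      by (auto simp: E_add E_sc BB_0 BB_add BB_sc)
    show "closed {b \<in> BB. E b - b = 0}"
      by (intro continuous_closed_preimage_constant closed_BB continuous_on_diff continuous_on_E continuous_on_id)
    show "\<And>n v. v \<in> Q n \<Longrightarrow> v \<in> {b \<in> BB. E b - b = 0}" using Q_V V_BB E_V by (metis (mono_tags, lifting) mem_Collect_eq eq_iff_diff_eq_0)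
  qed
  then show "d \<in> DD \<Longrightarrow> E d = d" by auto
qed

lemma norm_unit_le: "norm (unit N) \<le> 1"
  unfolding unit_def
  by (rule norm_orthogonal_sum_le[where p="\<lambda>q. q", OF finite_Q Q_st Q_orth]) (auto simp: Q_idem norm_Q)

lemma BB_unit_tendsto: "b \<in> BB \<Longrightarrow> (\<lambda>N. b * unit N) \<longlonglongrightarrow> b"
proof -
  assume b: "b \<in> BB"
  show ?thesis
  proof (rule LIMSEQ_I)
    fix e :: real assume "0 < e"
    then obtain n c where n: "norm (b - (\<Sum>v\<in>V n. sc (c v) v)) < e / 2"
      using BB_approx[OF b half_gt_zero] by metis
    define y where "y = (\<Sum>v\<in>V n. sc (c v) v)"
    have "norm (b * unit N - b) < e" if "N \<ge> n" for N
    proof -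
      have "y * unit N = y" unfolding y_def sum_distrib_right using V_unit that by (intro sum.cong) auto
      then have "b * unit N - b = (b - y) * unit N - (b - y)" by (simp add: algebra_simps)
      also have "norm \<dots> \<le> norm ((b - y) * unit N) + norm (b - y)" by (rule norm_triangle_ineq4)
      also have "norm ((b - y) * unit N) \<le> norm (b - y) * 1"
        using norm_mult_ineq mult_left_mono[OF norm_unit_le norm_ge_zero] order_trans by blast
      finally show ?thesis using n unfolding y_def by simp
    qed
    then show "\<exists>no. \<forall>N\<ge>no. norm (b * unit N - b) < e" by blast
  qed
qed

text \<open>Commuting with every \<open>q\<close> turns the pinching \<open>EN N b\<close> into
  \<open>b * unit N\<close>, whose limit is \<open>b\<close> as well as \<open>E b\<close>. Thus the
  diagonal is maximal abelian in \<open>BB\<close>.\<close>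

lemma commutant_DD: assumes b: "b \<in> BB" and comm: "\<And>n q. q \<in> Q n \<Longrightarrow> b * q = q * b" shows "b \<in> DD"
proof -
  have "EN N b = b * unit N" for N
    unfolding EN_def unit_def sum_distrib_left
    by (intro sum.cong refl) (metis comm mult.assoc Q_idem)
  then have "E b = b" using E_eqI[OF b] BB_unit_tendsto[OF b] by simp
  then show ?thesis using E_DD[OF b] by simp
qed

section \<open>Expansion in the matrix units of one level over the diagonal\<close>

lemma V_mult_nonzero:
  assumes v: "v \<in> V n" and w: "w \<in> V n" and nz: "v * w \<noteq> 0"
  shows "v * w \<in> V n" "st v * v = w * st w" "st (v * w) * (v * w) = st w * w" "v * w * st (v * w) = v * st v"
proof -
  show "v * w \<in> V n" using V_mult[OF v w] nz by blast
  have "v * w = v * (st v * v) * (w * (st w * w))" using V_partial_isometry v w by simp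
  also have "\<dots> = v * ((st v * v) * (w * st w)) * w" by (simp only: mult.assoc)
  finally show e: "st v * v = w * st w" using nz Q_orth[OF V_source[OF v] V_range[OF w]] by (metis mult_zero_left mult_zero_right)
  have "st (v * w) * (v * w) = st w * (st v * v) * w" by (simp only: st_mult mult.assoc)
  also have "\<dots> = st w * (w * (st w * w))" unfolding e by (simp only: mult.assoc)
  finally show "st (v * w) * (v * w) = st w * w" using V_partial_isometry[OF w] by simp
  have "v * w * st (v * w) = v * (w * st w) * st v" by (simp only: st_mult mult.assoc)
  also have "\<dots> = v * (st v * v) * st v" unfolding e ..
  finally show "v * w * st (v * w) = v * st v" using V_partial_isometry[OF v] by simp
qed

text \<open>Orthogonality for the \<open>DD\<close>-valued inner product
  \<open>E (st v * w)\<close>: a product \<open>st v * w\<close> in \<open>Q n\<close> has equal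
  source and range, which forces \<open>v\<close> and \<open>w\<close> to share theirs.\<close>

lemma E_st_mult: assumes v: "v \<in> V n" and w: "w \<in> V n" shows "E (st v * w) = (if v = w then st v * v else 0)"
proof (cases "st v * w \<in> Q n")
  case True
  note nz = V_mult_nonzero[OF V_st[OF v] w Q_nonzero[OF True]]
  have "st w * w = st v * v" using nz(3,4) True Q_iff by (metis st_st)
  moreover have "v * st v = w * st w" using nz(2) by simp
  ultimately have "v = w" using V_eqI v w by metis
  then show ?thesis using True E_V[OF Q_V[OF True]] by auto
next
  case False
  then have "v \<noteq> w" using V_source v by blast
  have "st v * w = 0 \<or> st v * w \<in> V n" by (rule V_mult[OF V_st[OF v] w])
  then show ?thesis using \<open>v \<noteq> w\<close> False E_V[of "st v * w" n] by auto
qed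

text \<open>The orthogonal projection onto the combinations of level-n matrix units with diagonal
  coefficients, for the inner product \<open>E (st v * w)\<close>.\<close>

definition Phi :: "nat \<Rightarrow> 'a \<Rightarrow> 'a" where "Phi n b = (\<Sum>v\<in>V n. v * E (st v * b))"

lemma stV_mult_BB: "v \<in> V n \<Longrightarrow> b \<in> BB \<Longrightarrow> st v * b \<in> BB"
  using V_st V_BB BB_mult by blast

lemma Phi_diff: "a \<in> BB \<Longrightarrow> b \<in> BB \<Longrightarrow> Phi n (a - b) = Phi n a - Phi n b"
  unfolding Phi_def sum_subtractf[symmetric]
  by (intro sum.cong refl) (simp add: right_diff_distrib E_diff stV_mult_BB)

lemma Phi_sum_V: "Phi n (\<Sum>w\<in>V n. sc (c w) w) = (\<Sum>w\<in>V n. sc (c w) w)" (is "Phi n ?y = _")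
proof -
  have y: "?y \<in> BB" by (intro csubspace_sum[OF csubspace_BB] BB_sc V_BB)
  have "E (st v * ?y) = sc (c v) (st v * v)" if v: "v \<in> V n" for v
  proof -
    have "E (\<Sum>w\<in>W. sc (c w) (st v * w)) = (\<Sum>w\<in>W. sc (c w) (E (st v * w)))" if "finite W" "W \<subseteq> V n" for W
      using that
    proof (induction W)
      case (insert w W)
      have "st v * w \<in> BB" if "w \<in> V n" for w using stV_mult_BB[OF v V_BB[OF that]] .
      then have "(\<Sum>w\<in>W. sc (c w) (st v * w)) \<in> BB" "sc (c w) (st v * w) \<in> BB" "st v * w \<in> BB"
        using insert.prems by (auto intro!: csubspace_sum[OF csubspace_BB] BB_sc)
      then show ?case using insert by (simp add: E_add E_sc)
    qed simp
    from this[OF finite_V] have "E (st v * ?y) = (\<Sum>w\<in>V n. sc (c w) (E (st v * w)))"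
      by (simp add: sum_distrib_left)
    also have "\<dots> = (\<Sum>w\<in>V n. if v = w then sc (c v) (st v * v) else 0)"
      by (intro sum.cong refl) (auto simp: E_st_mult[OF v])
    finally show ?thesis using v finite_V by simp
  qed
  then show ?thesis unfolding Phi_def by (intro sum.cong refl) (simp add: V_partial_isometry)
qed

text \<open>The terms are \<open>v * q * st v * b * q\<close>. The pairs of a translate
  \<open>v * q * st v\<close> and \<open>q\<close> form an equivalence relation on projections of
  level N, and each pair arises from exactly one \<open>v\<close>; so the sum is a pinching of
  \<open>b\<close>.\<close>

lemma norm_PhiN_le:
  assumes N: "n \<le> N" shows "norm (\<Sum>v\<in>V n. v * EN N (st v * b)) \<le> norm b"
proof -
  \<comment> \<open>Projections not below level n are annihilated by all of \<open>V n\<close>, so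
    the relation would not be reflexive on them.\<close>
  define P where "P = {q \<in> Q N. \<exists>p\<in>Q n. p * q = q}"
  define \<rho> where "\<rho> = {(p, q). q \<in> Q N \<and> p \<noteq> 0 \<and> (\<exists>v\<in>V n. p = v * q * st v)}"
  define S where "S = {(v, q). v \<in> V n \<and> q \<in> Q N \<and> v * q * st v \<noteq> 0}"
  have key: "v * q * st v \<in> Q N \<and> (st v * v) * q = q \<and> (v * st v) * (v * q * st v) = v * q * st v
      \<and> st v * (v * q * st v) * v = q \<and> q \<noteq> 0"
    if v: "v \<in> V n" and q: "q \<in> Q N" and nz: "v * q * st v \<noteq> 0" for v q
  proof -
    have 1: "v * q * st v \<in> Q N" using V_conj[OF v N q] nz by blast
    have 2: "(st v * v) * q = q" using nz by (cases rule: V_restrict_cases[OF v N q]) auto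
    then have 3: "q * (st v * v) = q" using Q_comm[OF V_source[OF v] q] by simp
    have "v * st v * (v * q * st v) = v * ((st v * v) * q) * st v" by (simp only: mult.assoc)
    moreover have "st v * (v * q * st v) * v = (st v * v) * q * (st v * v)" by (simp only: mult.assoc)
    ultimately show ?thesis using 1 2 3 Q_nonzero[OF q] by simp
  qed
  have eq: "equiv P \<rho>"
  proof (rule equivI)
    show "\<rho> \<subseteq> P \<times> P" unfolding \<rho>_def P_def using key V_source V_range by blast
    show "refl_on P \<rho>"
    proof (rule refl_onI)
      fix q assume "q \<in> P"
      then obtain p where p: "p \<in> Q n" "p * q = q" and q: "q \<in> Q N" unfolding P_def by blast
      then have "q * p = q" using Q_comm by metis
      then have "p * q * st p = q" using p Q_st[OF p(1)] by simp
      then show "(q, q) \<in> \<rho>" unfolding \<rho>_def using Q_nonzero[OF q] q Q_V[OF p(1)] by force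
    qed
    show "sym \<rho>"
    proof (rule symI)
      fix p q assume "(p, q) \<in> \<rho>"
      then obtain v where v: "v \<in> V n" "p = v * q * st v" "q \<in> Q N" "p \<noteq> 0" unfolding \<rho>_def by blast
      with key[of v q] have "p \<in> Q N" "q = st v * p * st (st v)" "q \<noteq> 0" by auto
      then show "(q, p) \<in> \<rho>" unfolding \<rho>_def using V_st[OF v(1)] by blast
    qed
    show "trans \<rho>"
    proof (rule transI)
      fix p q s assume "(p, q) \<in> \<rho>" "(q, s) \<in> \<rho>"
      then obtain v w where v: "v \<in> V n" "p = v * q * st v" "p \<noteq> 0"
        and w: "w \<in> V n" "q = w * s * st w" "s \<in> Q N" unfolding \<rho>_def by blast
      have e: "p = (v * w) * s * st (v * w)" unfolding v(2) w(2) by (simp only: st_mult mult.assoc)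
      then have "v * w \<noteq> 0" using v(3) by auto
      then have "v * w \<in> V n" using V_mult[OF v(1) w(1)] by blast
      with e w v show "(p, s) \<in> \<rho>" unfolding \<rho>_def by blast
    qed
  qed
  have fin: "finite P" "\<And>p. p \<in> P \<Longrightarrow> st p = p"
    and orth: "\<And>p q. p \<in> P \<Longrightarrow> q \<in> P \<Longrightarrow> p * q = (if p = q then p else 0)"
    unfolding P_def using finite_Q Q_st Q_orth by auto
  \<comment> \<open>\<open>q\<close> lies below a unique source and its translate below a unique
    range, so the pair determines \<open>v\<close>.\<close>
  have inj: "inj_on (\<lambda>(v, q). (v * q * st v, q)) S"
  proof (rule inj_onI)
    fix s s' assume s: "s \<in> S" "s' \<in> S"
      "(case s of (v, q) \<Rightarrow> (v * q * st v, q)) = (case s' of (v, q) \<Rightarrow> (v * q * st v, q))"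
    obtain v q w q' where ss: "s = (v, q)" "s' = (w, q')" by fastforce
    with s have v: "v \<in> V n" and w: "w \<in> V n" and q: "q \<in> Q N" and [simp]: "q' = q"
      and e: "v * q * st v = w * q * st w" and nz: "w * q * st w \<noteq> 0"
      unfolding S_def by auto
    have nz': "v * q * st v \<noteq> 0" unfolding e by (rule nz)
    note kv = key[OF v q nz'] and kw = key[OF w q nz]
    have "st v * v * q = q" "st w * w * q = q" "q \<noteq> 0" using kv kw by blast+
    then have "st v * v = st w * w" by (intro Q_parent_unique[OF V_source[OF v] V_source[OF w]])
    moreover have "v * st v * (v * q * st v) = v * q * st v" "w * st w * (w * q * st w) = w * q * st w"
      using kv kw by blast+
    then have "v * st v = w * st w"
      by (intro Q_parent_unique[OF V_range[OF v] V_range[OF w] nz']) (simp_all only: e)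
    ultimately have "v = w" using V_eqI[OF v w] by blast
    then show "s = s'" using ss by simp
  qed
  have img: "(\<lambda>(v, q). (v * q * st v, q)) ` S = \<rho>" unfolding S_def \<rho>_def by force
  have "(\<Sum>v\<in>V n. v * EN N (st v * b)) = (\<Sum>(v, q)\<in>V n \<times> Q N. v * q * st v * b * q)"
    unfolding EN_def sum.cartesian_product[symmetric] sum_distrib_left
    by (intro sum.cong refl) (simp only: mult.assoc)
  also have "\<dots> = (\<Sum>(v, q)\<in>S. v * q * st v * b * q)"
    using finite_V finite_Q by (intro sum.mono_neutral_right) (auto simp: S_def)
  also have "\<dots> = (\<Sum>(p, q)\<in>\<rho>. p * b * q)"
    unfolding img[symmetric] by (subst sum.reindex[OF inj]) (simp add: case_prod_unfold)
  finally show ?thesis using norm_pinch_le[OF fin orth eq, of b] by simp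
qed

lemma norm_Phi_le: assumes b: "b \<in> BB" shows "norm (Phi n b) \<le> norm b"
proof (rule LIMSEQ_le_const2)
  show "(\<lambda>N. norm (\<Sum>v\<in>V n. v * EN N (st v * b))) \<longlonglongrightarrow> norm (Phi n b)"
    unfolding Phi_def
    by (intro tendsto_norm tendsto_sum tendsto_mult tendsto_const EN_tendsto stV_mult_BB b)
  show "\<exists>N. \<forall>n'\<ge>N. norm (\<Sum>v\<in>V n. v * EN n' (st v * b)) \<le> norm b"
    using norm_PhiN_le by blast
qed

text \<open>\<open>Phi n\<close> is contractive and fixes an approximating combination of level n,
  so \<open>Phi n b\<close> is as close to that combination as \<open>b\<close> is.\<close>

lemma Phi_approx: assumes b: "b \<in> BB" "e > 0" obtains n where "norm (b - Phi n b) < e"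
proof -
  obtain n c where n: "norm (b - (\<Sum>v\<in>V n. sc (c v) v)) < e / 2"
    using BB_approx[OF b(1) half_gt_zero[OF b(2)]] by metis
  let ?y = "\<Sum>v\<in>V n. sc (c v) v"
  have y: "?y \<in> BB" by (intro csubspace_sum[OF csubspace_BB] BB_sc V_BB)
  have "norm (Phi n b - ?y) \<le> norm (b - ?y)"
    using norm_Phi_le[OF BB_diff[OF b(1) y], of n] Phi_diff[OF b(1) y] Phi_sum_V by simp
  then have "norm (b - Phi n b) < e" using n by norm
  then show thesis using that by blast
qed

end

section \<open>Characters of the diagonal\<close>

context matrix_units begin

abbreviation chr :: "('a \<Rightarrow> complex) \<Rightarrow> bool" where "chr x \<equiv> character ii DD x"

lemma chr_add: "chr x \<Longrightarrow> a \<in> DD \<Longrightarrow> b \<in> DD \<Longrightarrow> x (a + b) = x a + x b"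
  and chr_mult: "chr x \<Longrightarrow> a \<in> DD \<Longrightarrow> b \<in> DD \<Longrightarrow> x (a * b) = x a * x b"
  and chr_sc: "chr x \<Longrightarrow> a \<in> DD \<Longrightarrow> x (sc c a) = c * x a"
  and chr_extensional: "chr x \<Longrightarrow> x \<in> extensional DD"
  unfolding character_def by blast+

lemma chr_0: "chr x \<Longrightarrow> x 0 = 0"
  using chr_add[of x 0 0] DD_0 by simp

lemma chr_diff: "chr x \<Longrightarrow> a \<in> DD \<Longrightarrow> b \<in> DD \<Longrightarrow> x (a - b) = x a - x b"
  using chr_add[of x "a - b" b] DD_diff[of a b] by simp

text \<open>Otherwise a multiple \<open>f\<close> of \<open>d\<close> has norm below 1 and
  \<open>x f = 1\<close>. The series \<open>g\<close> of its powers satisfies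
  \<open>g = f + f * g\<close>, and applying \<open>x\<close> is contradictory. The series starts at
  the first power because 1 need not lie in \<open>DD\<close>.\<close>

lemma chr_norm_le:
  assumes x: "chr x" and d: "d \<in> DD" shows "cmod (x d) \<le> norm d"
proof (rule ccontr)
  assume "\<not> ?thesis"
  then have lt: "norm d < cmod (x d)" by simp
  then have nz: "x d \<noteq> 0" by force
  define f where "f = sc (1 / x d) d"
  have f: "f \<in> DD" unfolding f_def by (rule DD_sc[OF d])
  have xf: "x f = 1" unfolding f_def using chr_sc[OF x d] nz by simp
  have "norm f < 1" unfolding f_def norm_sc using lt nz by (simp add: norm_divide field_simps)
  then have sm: "summable (\<lambda>n. f ^ n)" by (rule complete_algebra_summable_geometric)
  define g where "g = (\<Sum>n. f ^ Suc n)"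
  have sm': "summable (\<lambda>n. f ^ Suc n)" using sm summable_Suc_iff[of "\<lambda>n. f ^ n"] by simp
  have pw: "f ^ Suc n \<in> DD" for n by (induction n) (auto simp: f DD_mult)
  have "(\<lambda>k. \<Sum>n<k. f ^ Suc n) \<longlonglongrightarrow> g" unfolding g_def using summable_LIMSEQ[OF sm'] .
  then have g: "g \<in> DD"
    by (rule closed_sequentially[OF closed_DD, rotated]) (intro csubspace_sum[OF csubspace_DD] pw)
  have "(\<Sum>n. f ^ n) = 1 + g" unfolding g_def using suminf_split_initial_segment[OF sm, of 1] by simp
  moreover have "g = f * (\<Sum>n. f ^ n)" unfolding g_def using suminf_mult[OF sm, of f] by simp
  ultimately have "g = f * (1 + g)" by metis
  then have "g = f + f * g" by (simp add: distrib_left)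
  then have "x g = x f + x f * x g" using chr_add[OF x f DD_mult[OF f g]] chr_mult[OF x f g] by simp
  then show False using xf by simp
qed

lemma continuous_on_chr: "chr x \<Longrightarrow> continuous_on DD x"
  unfolding continuous_on_iff dist_norm
  by (metis chr_diff chr_norm_le DD_diff order_le_less_trans)

lemma chr_Q: "chr x \<Longrightarrow> q \<in> Q n \<Longrightarrow> x q = 0 \<or> x q = 1"
  using chr_mult[of x q q] Q_idem[of q n] Q_DD[of q n] by auto

lemma chr_Q_unique: "chr x \<Longrightarrow> p \<in> Q n \<Longrightarrow> q \<in> Q n \<Longrightarrow> x p = 1 \<Longrightarrow> x q = 1 \<Longrightarrow> p = q"
  using chr_mult[of x p q] Q_orth[of p n q] Q_DD[of p n] Q_DD[of q n] chr_0[of x] by (auto split: if_splits)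

lemma chr_sum: "chr x \<Longrightarrow> (\<And>i. i \<in> I \<Longrightarrow> f i \<in> DD) \<Longrightarrow> x (sum f I) = (\<Sum>i\<in>I. x (f i))"
proof (induction I rule: infinite_finite_induct)
  case (insert i I)
  then have "sum f I \<in> DD" by (intro csubspace_sum[OF csubspace_DD]) auto
  with insert show ?case by (simp add: chr_add)
qed (auto simp: chr_0)

text \<open>Expanding \<open>p\<close> over level N, \<open>x p = 1\<close> forces some
  \<open>x (p * q)\<close> to be nonzero.\<close>

lemma chr_child:
  assumes x: "chr x" and p: "p \<in> Q n" "x p = 1" and N: "n \<le> N"
  obtains q where "q \<in> Q N" "x q = 1" "p * q = q"
proof -
  have pq: "p * q \<in> DD" if "q \<in> Q N" for q using that p Q_DD DD_mult by blast
  have "1 = x (\<Sum>q\<in>Q N. p * q)" using V_sum[OF Q_V[OF p(1)] N] p by simp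
  also have "\<dots> = (\<Sum>q\<in>Q N. x (p * q))" by (rule chr_sum[OF x pq])
  finally obtain q where q: "q \<in> Q N" "x (p * q) \<noteq> 0" by (metis sum.neutral zero_neq_one)
  then have "p * q = q" using Q_le[OF p(1) N q(1)] chr_0[OF x] by auto
  then show thesis using q that chr_Q[OF x q(1)] by auto
qed

text \<open>Otherwise \<open>x\<close> vanishes on a spanning set of the diagonal, hence everywhere
  by continuity.\<close>

lemma chr_Q_exists: assumes x: "chr x" obtains n q where "q \<in> Q n" "x q = 1"
proof (rule ccontr)
  assume "\<not> thesis"
  then have a: "\<not> (\<exists>n q. q \<in> Q n \<and> x q = 1)" using that by blast
  have 0: "x q = 0" if "q \<in> Q n" for n q using chr_Q[OF x that] a that by blast
  have "DD \<subseteq> {d \<in> DD. x d = 0}"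
  proof (rule DD_minimal)
    show "csubspace ii {d \<in> DD. x d = 0}" unfolding csubspace_def using x
      by (auto simp: DD_0 DD_add DD_sc chr_0 chr_add chr_sc)
    show "closed {d \<in> DD. x d = 0}"
      by (intro continuous_closed_preimage_constant closed_DD continuous_on_chr x)
    show "\<And>n v. v \<in> Q n \<Longrightarrow> v \<in> {d \<in> DD. x d = 0}" using 0 Q_DD by auto
  qed
  then show False using x unfolding character_def by blast
qed

lemma chr_level: assumes x: "chr x" obtains n where "\<And>N. n \<le> N \<Longrightarrow> \<exists>q\<in>Q N. x q = 1"
proof -
  obtain n p where "p \<in> Q n" "x p = 1" using chr_Q_exists[OF x] .
  then show thesis using that[of n] chr_child[OF x] by metis
qed

text \<open>A decreasing chain of projections, one from each level, shrinks to a point of the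
  spectrum: the value at \<open>d\<close> is the scalar that \<open>d\<close> approaches on the
  corners \<open>qs k\<close>. Existence of this scalar is a closed condition on \<open>d\<close>,
  and it holds for a diagonal projection because the chain is eventually below it or orthogonal to
  it.\<close>

lemma chain_character:
  assumes qs: "\<And>k. qs k \<in> Q (n + k)" and desc: "\<And>k. qs k * qs (Suc k) = qs (Suc k)"
  obtains x where "chr x" "\<And>k. x (qs k) = 1"
proof -
  define val where "val d c \<longleftrightarrow> (\<lambda>k. qs k * d - sc c (qs k)) \<longlonglongrightarrow> 0" for d c
  have le: "qs k * qs (k + j) = qs (k + j)" for k j
  proof (induction j)
    case 0 then show ?case using Q_idem[OF qs] by simp
  next
    case (Suc j)
    then show ?case using desc[of "k + j"] by (metis mult.assoc add_Suc_right)
  qed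
  have nq: "norm (sc c (qs k)) = cmod c" for c k unfolding norm_sc using norm_Q[OF qs] by simp
  \<comment> \<open>Each \<open>qs k\<close> has norm 1, so elements that are close have close
    scalars. This yields uniqueness, and convergence of the scalars along a convergent
    sequence.\<close>
  have val_bound: "cmod (c - c') \<le> norm (d - d')" if "val d c" "val d' c'" for d d' c c'
  proof (rule LIMSEQ_le_const)
    have "(\<lambda>k. norm (d - d') + (norm (qs k * d - sc c (qs k)) + norm (qs k * d' - sc c' (qs k)))) \<longlonglongrightarrow> norm (d - d') + (0 + 0)"
      using that unfolding val_def by (intro tendsto_intros tendsto_norm_zero)
    then show "(\<lambda>k. norm (d - d') + (norm (qs k * d - sc c (qs k)) + norm (qs k * d' - sc c' (qs k)))) \<longlonglongrightarrow> norm (d - d')"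
      by simp
    have "cmod (c - c') \<le> norm (d - d') + (norm (qs k * d - sc c (qs k)) + norm (qs k * d' - sc c' (qs k)))" for k
    proof -
      have "norm (qs k * (d - d')) \<le> norm (d - d')"
        using norm_mult_ineq[of "qs k" "d - d'"] norm_Q[OF qs, of k] by simp
      then have 1: "norm (qs k * d - qs k * d') \<le> norm (d - d')" by (simp add: right_diff_distrib)
      have "norm (sc c (qs k) - sc c' (qs k)) \<le> norm (qs k * d - qs k * d') + (norm (qs k * d - sc c (qs k)) + norm (qs k * d' - sc c' (qs k)))"
        by norm
      then show ?thesis using 1 nq[of "c - c'" k] unfolding sc_diff_left by linarith
    qed
    then show "\<exists>N. \<forall>k\<ge>N. cmod (c - c') \<le> norm (d - d') + (norm (qs k * d - sc c (qs k)) + norm (qs k * d' - sc c' (qs k)))"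
      by blast
  qed
  have val_unique: "c = c'" if "val d c" "val d c'" for d c c'
    using val_bound[OF that] by simp
  have val_add: "val (d + d') (c + c')" if "val d c" "val d' c'" for d d' c c'
    using tendsto_add[OF that[unfolded val_def]] unfolding val_def by (simp add: algebra_simps sc_add_left)
  have val_sc: "val (sc a d) (a * c)" if "val d c" for a d c
    using tendsto_sc[OF tendsto_const[of a] that[unfolded val_def]] unfolding val_def by (simp add: sc_diff)
  have val_mult: "val (d * d') (c * c')" if "val d c" "val d' c'" for d d' c c'
  proof -
    have "(\<lambda>k. (qs k * d - sc c (qs k)) * d' + sc c (qs k * d' - sc c' (qs k))) \<longlonglongrightarrow> 0 * d' + sc c 0"
      using that unfolding val_def by (intro tendsto_add tendsto_mult tendsto_sc tendsto_const)
    moreover have "(qs k * d - sc c (qs k)) * d' + sc c (qs k * d' - sc c' (qs k)) = qs k * (d * d') - sc (c * c') (qs k)" for k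
      by (simp add: left_diff_distrib sc_diff mult.assoc)
    ultimately show ?thesis unfolding val_def by simp
  qed
  have val_1: "val (qs k) 1" for k
    unfolding val_def
  proof (rule tendsto_eventually, rule eventually_sequentiallyI[of k])
    fix j assume "k \<le> j"
    then show "qs j * qs k - sc 1 (qs j) = 0" using le[of k "j - k"] Q_comm[OF qs qs, of k j] by simp
  qed
  have ex: "\<exists>c. val d c" if "d \<in> DD" for d
  proof -
    have "DD \<subseteq> {d. \<exists>c. val d c}"
    proof (rule DD_minimal)
      have "val 0 0" unfolding val_def by simp
      then show "csubspace ii {d. \<exists>c. val d c}" unfolding csubspace_def using val_add val_sc by blast
      show "closed {d. \<exists>c. val d c}" unfolding closed_sequential_limits
      proof (intro allI impI, elim conjE)
        fix f d assume f: "\<forall>j. f j \<in> {d. \<exists>c. val d c}" and lim: "f \<longlonglongrightarrow> d"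
        from f have "\<forall>j. \<exists>c. val (f j) c" by blast
        from choice[OF this] obtain c where c: "\<And>j. val (f j) (c j)" by blast
        have "Cauchy c"
        proof (rule metric_CauchyI)
          fix e :: real assume "0 < e"
          then obtain M where M: "\<forall>i\<ge>M. \<forall>j\<ge>M. dist (f i) (f j) < e"
            using LIMSEQ_imp_Cauchy[OF lim] unfolding Cauchy_def by blast
          show "\<exists>M. \<forall>i\<ge>M. \<forall>j\<ge>M. dist (c i) (c j) < e"
            using M val_bound[OF c c] unfolding dist_norm by (intro exI[of _ M]) (meson order_le_less_trans)
        qed
        then obtain c0 where c0: "c \<longlonglongrightarrow> c0" using Cauchy_convergent convergent_def by blast
        have "val d c0" unfolding val_def
        proof (rule LIMSEQ_I)
          fix e :: real assume e: "0 < e"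
          then obtain j1 j2 where "\<forall>j\<ge>j1. norm (f j - d) < e / 3" "\<forall>j\<ge>j2. cmod (c j - c0) < e / 3"
            using LIMSEQ_D[OF lim, of "e/3"] LIMSEQ_D[OF c0, of "e/3"] by auto
          then obtain j where j: "norm (f j - d) < e / 3" "cmod (c j - c0) < e / 3"
            by (metis max.cobounded1 max.cobounded2)
          obtain K where K: "\<And>k. k \<ge> K \<Longrightarrow> norm (qs k * f j - sc (c j) (qs k)) < e / 3"
            using LIMSEQ_D[OF c[unfolded val_def], of "e/3" j] e by auto
          have "norm (qs k * d - sc c0 (qs k) - 0) < e" if "k \<ge> K" for k
          proof -
            have "norm (qs k * (f j - d)) \<le> norm (f j - d)"
              using norm_mult_ineq[of "qs k" "f j - d"] norm_Q[OF qs, of k] by simp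
            then have 1: "norm (qs k * f j - qs k * d) < e / 3" using j by (simp add: right_diff_distrib)
            have 2: "norm (sc (c j) (qs k) - sc c0 (qs k)) < e / 3"
              using nq[of "c j - c0" k] j unfolding sc_diff_left by simp
            show ?thesis using 1 2 K[OF that] by norm
          qed
          then show "\<exists>K. \<forall>k\<ge>K. norm (qs k * d - sc c0 (qs k) - 0) < e" by blast
        qed
        then show "d \<in> {d. \<exists>c. val d c}" by blast
      qed
      fix N q assume q: "q \<in> Q N"
      show "q \<in> {d. \<exists>c. val d c}"
      proof -
        have le0: "q * qs N = 0 \<or> q * qs N = qs N" by (rule Q_le[OF q _ qs]) simp
        have "qs j * q - sc (if q * qs N = 0 then 0 else 1) (qs j) = 0" if "N \<le> j" for j
        proof -
          have "qs N * qs j = qs j" using le[of N "j - N"] that by simp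
          then have "q * qs j = q * qs N * qs j" by (simp add: mult.assoc)
          then have "q * qs j = (if q * qs N = 0 then 0 else qs j)" using le0 \<open>qs N * qs j = qs j\<close> by auto
          then show ?thesis using Q_comm[OF q qs] by auto
        qed
        then have "val q (if q * qs N = 0 then 0 else 1)" unfolding val_def
          by (intro tendsto_eventually eventually_sequentiallyI[of N])
        then show ?thesis by blast
      qed
    qed
    with that show ?thesis by blast
  qed
  define x where "x = restrict (\<lambda>d. THE c. val d c) DD"
  have x: "val d (x d)" if "d \<in> DD" for d
    unfolding x_def using that ex[OF that] val_unique by (auto intro: theI2)
  have xeq: "x d = c" if "d \<in> DD" "val d c" for d c using x[OF that(1)] that(2) val_unique by blast
  have x1: "x (qs k) = 1" for k using xeq[OF Q_DD[OF qs] val_1] .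
  have "chr x" unfolding character_def
  proof (intro conjI ballI allI)
    show "x \<in> extensional DD" unfolding x_def by simp
    show "\<exists>d\<in>DD. x d \<noteq> 0" using x1[of 0] Q_DD[OF qs, of 0] by (metis zero_neq_one)
  qed (use x val_add val_mult val_sc DD_add DD_mult DD_sc in \<open>auto intro!: xeq\<close>)
  then show thesis using x1 that by blast
qed

lemma chr_exists: assumes p: "p \<in> Q n" obtains x where "chr x" "x p = 1"
proof -
  have "\<exists>qs. qs 0 = p \<and> (\<forall>k. qs k \<in> Q (n + k) \<and> qs k * qs (Suc k) = qs (Suc k))"
  proof -
    have "\<exists>qs. \<forall>k. (qs k \<in> Q (n + k) \<and> (k = 0 \<longrightarrow> qs k = p)) \<and> qs k * qs (Suc k) = qs (Suc k)"
    proof (rule dependent_nat_choice)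
      fix q k assume "q \<in> Q (n + k) \<and> (k = 0 \<longrightarrow> q = p)"
      then obtain q' where "q' \<in> Q (n + Suc k)" "q * q' = q'" using Q_child[of q "n + k" "n + Suc k"] by auto
      then show "\<exists>y. (y \<in> Q (n + Suc k) \<and> (Suc k = 0 \<longrightarrow> y = p)) \<and> q * y = y" by auto
    qed (use p in auto)
    then show ?thesis by blast
  qed
  then obtain qs where "qs 0 = p" "\<And>k. qs k \<in> Q (n + k)" "\<And>k. qs k * qs (Suc k) = qs (Suc k)" by blast
  then show thesis using chain_character[of qs n] that by metis
qed

end

section \<open>Graphs of matrix units and spectral synthesis\<close>

context matrix_units begin

definition dom :: "'a \<Rightarrow> ('a \<Rightarrow> complex) set" where "dom v = {x. chr x \<and> x (st v * v) = 1}"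

abbreviation mp :: "'a \<Rightarrow> ('a \<Rightarrow> complex) \<Rightarrow> ('a \<Rightarrow> complex)" where "mp \<equiv> mu_map st DD"
abbreviation gr :: "'a \<Rightarrow> (('a \<Rightarrow> complex) \<times> ('a \<Rightarrow> complex)) set" where "gr \<equiv> mu_graph st ii DD"

lemma gr_iff: "(x, y) \<in> gr v \<longleftrightarrow> x \<in> dom v \<and> y = mp v x"
  unfolding mu_graph_def dom_def by auto

lemma dom_chr: "x \<in> dom v \<Longrightarrow> chr x" and dom_source: "x \<in> dom v \<Longrightarrow> x (st v * v) = 1"
  unfolding dom_def by auto

lemma mp_apply: "d \<in> DD \<Longrightarrow> mp v x d = x (st v * d * v)"
  unfolding mu_map_def by simp

lemma source_DD: "v \<in> V n \<Longrightarrow> st v * v \<in> DD" using V_source Q_DD by blast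
lemma range_DD: "v \<in> V n \<Longrightarrow> v * st v \<in> DD" using V_range Q_DD by blast

text \<open>For multiplicativity, the range projection \<open>v * st v\<close> is inserted between
  the two factors; it commutes with the diagonal and splits the conjugate of a product.\<close>

lemma mp_chr: assumes v: "v \<in> V n" and x: "x \<in> dom v" shows "chr (mp v x)"
  unfolding character_def
proof (intro conjI ballI allI)
  note c = dom_chr[OF x]
  show "mp v x \<in> extensional DD" unfolding mu_map_def by simp
  fix a b assume a: "a \<in> DD" and b: "b \<in> DD"
  note ca = DD_conj[OF a v] and cb = DD_conj[OF b v]
  have "st v * (a + b) * v = st v * a * v + st v * b * v" by (simp add: algebra_simps)
  then show "mp v x (a + b) = mp v x a + mp v x b"
    using chr_add[OF c ca cb] by (simp add: mp_apply a b DD_add)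
  have "st v * (a * b) * v = st v * (a * b) * (v * (st v * v))" using V_partial_isometry[OF v] by simp
  also have "\<dots> = st v * a * (b * (v * st v)) * v" by (simp only: mult.assoc)
  also have "b * (v * st v) = v * st v * b" by (rule DD_comm[OF b range_DD[OF v]])
  also have "st v * a * (v * st v * b) * v = (st v * a * v) * (st v * b * v)" by (simp only: mult.assoc)
  finally show "mp v x (a * b) = mp v x a * mp v x b"
    using chr_mult[OF c ca cb] by (simp add: mp_apply a b DD_mult)
next
  note c = dom_chr[OF x]
  fix k a assume a: "a \<in> DD"
  show "mp v x (sc k a) = k * mp v x a"
    using chr_sc[OF c DD_conj[OF a v], of k] by (simp add: mp_apply a DD_sc)
next
  have "mp v x (v * st v) = x (st v * v)"
    using V_partial_isometry[OF v] by (simp add: mp_apply[OF range_DD[OF v]] mult.assoc)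
  then show "\<exists>a\<in>DD. mp v x a \<noteq> 0" using dom_source[OF x] range_DD[OF v] by force
qed

lemma mp_range: assumes v: "v \<in> V n" and x: "x \<in> dom v" shows "mp v x (v * st v) = 1"
  using V_partial_isometry[OF v] dom_source[OF x] by (simp add: mp_apply[OF range_DD[OF v]] mult.assoc)

lemma mp_dom_st: assumes v: "v \<in> V n" and x: "x \<in> dom v" shows "mp v x \<in> dom (st v)"
  unfolding dom_def using mp_chr[OF v x] mp_range[OF v x] by simp

lemma mp_st: assumes v: "v \<in> V n" and x: "x \<in> dom v" shows "mp (st v) (mp v x) = x"
proof (rule extensionalityI)
  show "mp (st v) (mp v x) \<in> extensional DD" unfolding mu_map_def by simp
  show "x \<in> extensional DD" using chr_extensional dom_chr[OF x] .
  fix d assume d: "d \<in> DD"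
  have "v * d * st v \<in> DD" using DD_conj[OF d V_st[OF v]] by simp
  then have "mp (st v) (mp v x) d = x (st v * (v * d * st v) * v)" using d by (simp add: mp_apply)
  also have "st v * (v * d * st v) * v = st v * v * d * (st v * v)" by (simp only: mult.assoc)
  also have "x \<dots> = x d"
    using dom_source[OF x] by (simp add: chr_mult[OF dom_chr[OF x]] DD_mult d source_DD[OF v])
  finally show "mp (st v) (mp v x) d = x d" .
qed

lemma gr_st: assumes v: "v \<in> V n" and xy: "(x, y) \<in> gr v" shows "(y, x) \<in> gr (st v)"
  using xy mp_st[OF v] mp_dom_st[OF v] unfolding gr_iff by auto

text \<open>Products and graphs compose in opposite order: the map of \<open>w * v\<close> is that
  of \<open>v\<close> followed by that of \<open>w\<close>.\<close>

lemma gr_mult: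
  assumes v: "v \<in> V n" and w: "w \<in> V n" and xy: "(x, y) \<in> gr v" and yz: "(y, z) \<in> gr w"
  shows "w * v \<in> V n" "(x, z) \<in> gr (w * v)"
proof -
  have x: "x \<in> dom v" and y: "y = mp v x" "y \<in> dom w" and z: "z = mp w y"
    using xy yz unfolding gr_iff by auto
  have "x (st v * (st w * w) * v) = 1"
    using dom_source[OF y(2)] unfolding y(1) mp_apply[OF source_DD[OF w]] .
  then have nz: "w * v \<noteq> 0" using chr_0[OF dom_chr[OF x]] by (auto simp: mult.assoc)
  show "w * v \<in> V n" using V_mult_nonzero(1)[OF w v nz] .
  have "x \<in> dom (w * v)" using x V_mult_nonzero(3)[OF w v nz] unfolding dom_def by simp
  moreover have "mp (w * v) x = z"
  proof (rule extensionalityI[of _ DD])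
    show "mp (w * v) x \<in> extensional DD" "z \<in> extensional DD" unfolding z mu_map_def by simp_all
    fix d assume d: "d \<in> DD"
    have "st (w * v) * d * (w * v) = st v * (st w * d * w) * v" by (simp only: st_mult mult.assoc)
    then show "mp (w * v) x d = z d" unfolding z y(1) by (simp add: mp_apply d DD_conj[OF d w])
  qed
  ultimately show "(x, z) \<in> gr (w * v)" unfolding gr_iff by simp
qed

lemma gr_chr: assumes "v \<in> V n" "(x, y) \<in> gr v" shows "chr x" "chr y"
  using assms mp_chr dom_chr unfolding gr_iff by auto

text \<open>At a single level \<open>x\<close> selects the source projection and \<open>y\<close>
  the range projection, and these determine the matrix unit.\<close>

lemma gr_unique:
  assumes v: "v \<in> V n" and w: "w \<in> V n" and "(x, y) \<in> gr v" "(x, y) \<in> gr w" shows "v = w"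
proof -
  have x: "x \<in> dom v" "x \<in> dom w" "y = mp v x" "y = mp w x" using assms unfolding gr_iff by auto
  have "st v * v = st w * w"
    using chr_Q_unique[OF dom_chr[OF x(1)] V_source[OF v] V_source[OF w]] dom_source x by blast
  moreover have "v * st v = w * st w"
    using chr_Q_unique[OF mp_chr[OF v x(1)] V_range[OF v] V_range[OF w]] mp_range[OF v x(1)] mp_range[OF w x(2)] x by simp
  ultimately show ?thesis using V_eqI[OF v w] by blast
qed

lemma mp_restrict:
  assumes v: "v \<in> V n" and N: "n \<le> N" and q: "q \<in> Q N" and x: "x \<in> dom v" "x q = 1"
  shows "v * q \<in> V N" "x \<in> dom (v * q)" "mp (v * q) x = mp v x"
proof -
  note c = dom_chr[OF x(1)]
  have "x (st v * v * q) = 1" using chr_mult[OF c source_DD[OF v] Q_DD[OF q]] dom_source[OF x(1)] x by simp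
  then have "st v * v * q \<noteq> 0" using chr_0[OF c] by auto
  then have "v * q \<in> V N \<and> st (v * q) * (v * q) = q" by (cases rule: V_restrict_cases[OF v N q]) auto
  then show "v * q \<in> V N" "x \<in> dom (v * q)" unfolding dom_def using c x by auto
  show "mp (v * q) x = mp v x"
  proof (rule extensionalityI[of _ DD])
    show "mp (v * q) x \<in> extensional DD" "mp v x \<in> extensional DD" unfolding mu_map_def by simp_all
    fix d assume d: "d \<in> DD"
    have "st (v * q) * d * (v * q) = q * (st v * d * v) * q" by (simp only: st_mult Q_st[OF q] mult.assoc)
    then have "mp (v * q) x d = x (q * (st v * d * v) * q)" using d by (simp add: mp_apply)
    also have "\<dots> = x (st v * d * v)"
      using x by (simp add: chr_mult[OF c] DD_mult Q_DD[OF q] DD_conj[OF d v])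
    finally show "mp (v * q) x d = mp v x d" using d by (simp add: mp_apply)
  qed
qed

lemma dom_restrictD:
  assumes v: "v \<in> V n" and N: "n \<le> N" and q: "q \<in> Q N" and x: "x \<in> dom (v * q)"
  shows "x q = 1" "x \<in> dom v"
proof -
  note c = dom_chr[OF x]
  have "x q = 1 \<and> x (st v * v) = 1"
  proof (cases rule: V_restrict_cases[OF v N q])
    case 1
    then show ?thesis using dom_source[OF x] chr_0[OF c] by simp
  next
    case 2
    then have "x q = 1" using dom_source[OF x] by simp
    then show ?thesis using 2 chr_mult[OF c source_DD[OF v] Q_DD[OF q]] by simp
  qed
  then show "x q = 1" "x \<in> dom v" unfolding dom_def using c by auto
qed

lemma gr_restrict_subset:
  assumes v: "v \<in> V n" and N: "n \<le> N" and q: "q \<in> Q N" shows "gr (v * q) \<subseteq> gr v"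
proof
  fix z assume "z \<in> gr (v * q)"
  then obtain x where x: "z = (x, mp (v * q) x)" "x \<in> dom (v * q)" using gr_iff by (cases z) auto
  then show "z \<in> gr v" using dom_restrictD[OF assms x(2)] mp_restrict(3)[OF assms] unfolding x gr_iff by simp
qed

lemma gr_restrict:
  assumes v: "v \<in> V n" and N: "n \<le> N" and xy: "(x, y) \<in> gr v"
  obtains q where "q \<in> Q N" "x q = 1" "v * q \<in> V N" "(x, y) \<in> gr (v * q)"
proof -
  have x: "x \<in> dom v" "y = mp v x" using xy gr_iff by auto
  obtain q where q: "q \<in> Q N" "x q = 1"
    using chr_child[OF dom_chr[OF x(1)] V_source[OF v] dom_source[OF x(1)] N] .
  then show thesis using that mp_restrict[OF v N q(1) x(1) q(2)] x gr_iff by auto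
qed

text \<open>Both cuts have level N and pass through the same point, so they coincide. Hence the
  graphs form a base of a topology, and what is read off a matrix unit locally depends on the point
  alone.\<close>

lemma gr_common:
  assumes v: "v \<in> V n" and w: "w \<in> V m" and N: "n \<le> N" "m \<le> N" and q: "q \<in> Q N" "x q = 1"
    and "(x, y) \<in> gr v" "(x, y) \<in> gr w"
  shows "v * q = w * q" "v * q \<in> V N" "(x, y) \<in> gr (v * q)"
proof -
  have x: "x \<in> dom v" "y = mp v x" "x \<in> dom w" "y = mp w x" using assms gr_iff by auto
  note a = mp_restrict[OF v N(1) q(1) x(1) q(2)] and b = mp_restrict[OF w N(2) q(1) x(3) q(2)]
  show "v * q \<in> V N" "(x, y) \<in> gr (v * q)" using a x unfolding gr_iff by auto
  moreover have "w * q \<in> V N" "(x, y) \<in> gr (w * q)" using b x unfolding gr_iff by auto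
  ultimately show "v * q = w * q" using gr_unique by blast
qed

lemma gr_Q: assumes q: "q \<in> Q n" shows "(x, y) \<in> gr q \<longleftrightarrow> chr x \<and> x q = 1 \<and> y = x"
proof -
  have "st q * q = q" using Q_st[OF q] Q_idem[OF q] by simp
  then have d: "x \<in> dom q \<longleftrightarrow> chr x \<and> x q = 1" unfolding dom_def by simp
  have "mp q x = x" if x: "chr x" "x q = 1"
  proof (rule extensionalityI[of _ DD])
    show "mp q x \<in> extensional DD" "x \<in> extensional DD" using chr_extensional x unfolding mu_map_def by simp_all
    fix d assume "d \<in> DD"
    then show "mp q x d = x d" using x by (simp add: mp_apply Q_st[OF q] chr_mult DD_mult Q_DD[OF q])
  qed
  then show ?thesis unfolding gr_iff d by auto
qed

text \<open>A fixed point puts \<open>x\<close> on both the source and the range projection, so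
  these coincide.\<close>

lemma gr_diag: assumes v: "v \<in> V n" and x: "(x, x) \<in> gr v" shows "v \<in> Q n"
proof -
  have "st v * v = v * st v"
    using chr_Q_unique[OF gr_chr(1)[OF v x] V_source[OF v] V_range[OF v]] x mp_range[OF v, of x]
      dom_source[of x v] unfolding gr_iff by simp
  then show ?thesis using Q_iff v by blast
qed

lemma dom_nonempty: assumes v: "v \<in> V n" obtains x where "x \<in> dom v"
  using chr_exists[OF V_source[OF v]] unfolding dom_def by blast

text \<open>The matrix coefficient of b at the point (x, y) of the graph of v.\<close>
definition ev :: "'a \<Rightarrow> ('a \<Rightarrow> complex) \<Rightarrow> 'a \<Rightarrow> complex" where "ev v x b = x (E (st v * b))"

lemma Ev_DD: "v \<in> V n \<Longrightarrow> b \<in> BB \<Longrightarrow> E (st v * b) \<in> DD"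
  using E_DD stV_mult_BB by blast

lemma ev_add: "v \<in> V n \<Longrightarrow> chr x \<Longrightarrow> a \<in> BB \<Longrightarrow> b \<in> BB \<Longrightarrow> ev v x (a + b) = ev v x a + ev v x b"
  unfolding ev_def by (simp add: distrib_left E_add stV_mult_BB chr_add Ev_DD)

lemma ev_diff: "v \<in> V n \<Longrightarrow> chr x \<Longrightarrow> a \<in> BB \<Longrightarrow> b \<in> BB \<Longrightarrow> ev v x (a - b) = ev v x a - ev v x b"
  unfolding ev_def by (simp add: right_diff_distrib E_diff stV_mult_BB chr_diff Ev_DD)

lemma ev_sc: "v \<in> V n \<Longrightarrow> chr x \<Longrightarrow> a \<in> BB \<Longrightarrow> ev v x (sc c a) = c * ev v x a"
  unfolding ev_def by (simp add: E_sc stV_mult_BB chr_sc Ev_DD)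

lemma ev_0: "chr x \<Longrightarrow> ev v x 0 = 0"
  unfolding ev_def by (simp add: chr_0)

lemma norm_ev_le: assumes v: "v \<in> V n" and x: "chr x" and b: "b \<in> BB" shows "cmod (ev v x b) \<le> norm b"
proof -
  have "cmod (ev v x b) \<le> norm (st v * b)"
    unfolding ev_def using chr_norm_le[OF x Ev_DD[OF v b]] norm_E_le[OF stV_mult_BB[OF v b]] by linarith
  also have "\<dots> \<le> norm (st v) * norm b" by (rule norm_mult_ineq)
  also have "\<dots> \<le> 1 * norm b" using norm_V_le[OF v] by (intro mult_right_mono) auto
  finally show ?thesis by simp
qed

lemma continuous_on_ev: "v \<in> V n \<Longrightarrow> chr x \<Longrightarrow> continuous_on BB (ev v x)"
  by (rule continuous_on_BB_if) (metis ev_diff norm_ev_le BB_diff)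

lemma csubspace_ev_0: "v \<in> V n \<Longrightarrow> chr x \<Longrightarrow> csubspace ii {b \<in> BB. ev v x b = 0}"
  unfolding csubspace_def by (auto simp: BB_0 BB_add BB_sc ev_0 ev_add ev_sc)

lemma closed_ev_0: "v \<in> V n \<Longrightarrow> chr x \<Longrightarrow> closed {b \<in> BB. ev v x b = 0}"
  by (intro continuous_closed_preimage_constant closed_BB continuous_on_ev)

text \<open>\<open>E\<close> is a \<open>DD\<close>-bimodule map and \<open>x q = 1\<close>, so a
  coefficient at \<open>x\<close> only sees what is cut out by \<open>q\<close>.\<close>

lemma ev_restrict2:
  assumes v: "v \<in> V n" and w: "w \<in> BB" and q: "q \<in> Q N" and x: "chr x" "x q = 1"
  shows "ev v x w = x (E (st (v * q) * (w * q)))"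
proof -
  have e: "st (v * q) * (w * q) = q * (st v * w) * q" by (simp only: st_mult Q_st[OF q] mult.assoc)
  have "E (q * (st v * w) * q) = q * E (st v * w) * q"
    using E_mult_right[OF BB_mult[OF _ stV_mult_BB[OF v w]] Q_DD[OF q], of q]
      E_mult_left[OF stV_mult_BB[OF v w] Q_DD[OF q]] V_BB[OF Q_V[OF q]] by simp
  then show ?thesis unfolding ev_def e
    using x by (simp add: chr_mult DD_mult Q_DD[OF q] Ev_DD[OF v w])
qed

lemma ev_V:
  assumes v: "v \<in> V n" and w: "w \<in> V m" and x: "x \<in> dom v"
  shows "ev v x w = (if (x, mp v x) \<in> gr w then 1 else 0)"
proof -
  define N where "N = max n m"
  have N: "n \<le> N" "m \<le> N" unfolding N_def by auto
  note c = dom_chr[OF x]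
  have xv: "(x, mp v x) \<in> gr v" using x gr_iff by blast
  then obtain q where q: "q \<in> Q N" "x q = 1" and vq: "v * q \<in> V N" "(x, mp v x) \<in> gr (v * q)"
    using gr_restrict[OF v N(1)] by blast
  have e: "ev v x w = x (E (st (v * q) * (w * q)))" by (rule ev_restrict2[OF v V_BB[OF w] q(1) c q(2)])
  show ?thesis
  proof (cases rule: V_restrict_cases[OF w N(2) q(1)])
    case 1
    have "x (st w * w) = 0" using 1(2) chr_mult[OF c source_DD[OF w] Q_DD[OF q(1)]] q(2) chr_0[OF c] by simp
    then have "(x, mp v x) \<notin> gr w" unfolding gr_iff dom_def by auto
    then show ?thesis unfolding e using 1 by (simp add: chr_0[OF c])
  next
    case 2
    have "(v * q = w * q) \<longleftrightarrow> (x, mp v x) \<in> gr w"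
      using gr_common(1)[OF v w N q xv] vq(2) gr_restrict_subset[OF w N(2) q(1)] by auto
    moreover have "st (v * q) * (v * q) = q" if "v * q = w * q" using 2(3) that by simp
    ultimately show ?thesis unfolding e E_st_mult[OF vq(1) 2(1)] using q(2) chr_0[OF c] by auto
  qed
qed

text \<open>A coefficient belongs to the point \<open>(x, y)\<close> and not to the chosen matrix
  unit, because the two have a common cut at \<open>x\<close>.\<close>

lemma ev_cong:
  assumes v: "v \<in> V n" and w: "w \<in> V m" and b: "b \<in> BB" and "(x, y) \<in> gr v" "(x, y) \<in> gr w"
  shows "ev v x b = ev w x b"
proof -
  define N where "N = max n m"
  have N: "n \<le> N" "m \<le> N" unfolding N_def by auto
  obtain q where q: "q \<in> Q N" "x q = 1" using gr_restrict[OF v N(1) assms(4)] by blast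
  have c: "chr x" using gr_chr assms by blast
  show ?thesis unfolding ev_restrict2[OF v b q(1) c q(2)] ev_restrict2[OF w b q(1) c q(2)]
    using gr_common(1)[OF v w N q assms(4,5)] by simp
qed

text \<open>It suffices to treat one piece \<open>v * E (st v * b)\<close>. Its diagonal factor is
  approximated by a combination of projections of a fine level, from which the small coefficients
  are dropped. Over each remaining \<open>q\<close> the factor vanishes nowhere, so by hypothesis
  the graph of \<open>v * q\<close> lies in \<open>W\<close>.\<close>

lemma support_imp_closure:
  assumes b: "b \<in> BB"
    and supp: "\<And>n v x. v \<in> V n \<Longrightarrow> x \<in> dom v \<Longrightarrow> (x, mp v x) \<notin> W \<Longrightarrow> ev v x b = 0"
  shows "b \<in> closure (cspan ii {v \<in> VV. gr v \<subseteq> W})" (is "_ \<in> closure ?M")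
proof -
  have cl: "csubspace ii (closure ?M)" by (intro csubspace_closure csubspace_cspan)
  have piece: "v * E (st v * b) \<in> closure ?M" if v: "v \<in> V n" for v n
    unfolding closure_approachable
  proof (intro allI impI)
    fix e :: real assume "0 < e"
    \<comment> \<open>One \<delta> is spent on the approximation and one on the discarded
      coefficients, together less than \<open>e\<close>. A coefficient larger than \<delta> survives
      the approximation error, so the true factor is nonzero there.\<close>
    define \<delta> where "\<delta> = e / 3"
    have \<delta>: "\<delta> > 0" using \<open>0 < e\<close> unfolding \<delta>_def by simp
    define d where "d = E (st v * b)"
    have d: "d \<in> DD" unfolding d_def by (rule Ev_DD[OF v b])
    obtain N c where N: "n \<le> N" and near: "norm (d - (\<Sum>q\<in>Q N. sc (c q) q)) < \<delta>"
      using DD_approx[OF d \<delta>] by metis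
    define G where "G = {q \<in> Q N. cmod (c q) > \<delta>}"
    define y where "y = (\<Sum>q\<in>G. sc (c q) q)"
    have "norm (\<Sum>q\<in>Q N - G. sc (c q) q) \<le> \<delta>"
    proof (rule norm_orthogonal_sum_le[where p="\<lambda>q. q"])
      fix q assume "q \<in> Q N - G"
      then have q: "q \<in> Q N" "cmod (c q) \<le> \<delta>" unfolding G_def by auto
      show "q * sc (c q) q * q = sc (c q) q" "norm (sc (c q) q) \<le> \<delta>"
        using q by (simp_all add: Q_idem norm_sc norm_Q)
    qed (use finite_Q Q_st Q_orth \<delta> in auto)
    moreover have "(\<Sum>q\<in>Q N. sc (c q) q) = (\<Sum>q\<in>Q N - G. sc (c q) q) + y"
      unfolding y_def using finite_Q by (intro sum.subset_diff) (auto simp: G_def)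
    ultimately have "norm (d - y) \<le> norm (d - (\<Sum>q\<in>Q N. sc (c q) q)) + \<delta>"
      using norm_triangle_ineq[of "d - (\<Sum>q\<in>Q N. sc (c q) q)" "\<Sum>q\<in>Q N - G. sc (c q) q"] by simp
    then have "norm (d - y) < e" using near \<delta> unfolding \<delta>_def by simp
    then have "norm (v * y - v * d) < e"
      using norm_mult_ineq[of v "y - d"] mult_right_mono[OF norm_V_le[OF v] norm_ge_zero[of "y - d"]]
      by (simp add: right_diff_distrib norm_minus_commute)
    moreover have "v * y \<in> ?M" unfolding y_def sum_distrib_left
    proof (rule csubspace_sum[OF csubspace_cspan])
      fix q assume "q \<in> G"
      then have q: "q \<in> Q N" "cmod (c q) > \<delta>" unfolding G_def by auto
      have good: "x \<in> dom v \<and> (x, mp v x) \<in> W" if x: "chr x" "x q = 1" for x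
      proof -
        define S where "S = (\<Sum>p\<in>Q N. sc (c p) p)"
        have S: "S \<in> DD" unfolding S_def by (intro csubspace_sum[OF csubspace_DD] DD_sc Q_DD)
        have "x S = (\<Sum>p\<in>Q N. x (sc (c p) p))" unfolding S_def
          by (rule chr_sum[OF x(1)]) (intro DD_sc Q_DD)
        moreover have "x (sc (c p) p) = (if p = q then c q else 0)" if p: "p \<in> Q N" for p
        proof (cases "p = q")
          case False
          then have "x p = 0" using chr_Q[OF x(1) p] chr_Q_unique[OF x(1) p q(1) _ x(2)] by blast
          then show ?thesis using False chr_sc[OF x(1) Q_DD[OF p]] by simp
        qed (use chr_sc[OF x(1) Q_DD[OF q(1)]] x(2) in simp)
        ultimately have "x S = c q" using q(1) finite_Q by simp
        then have "cmod (x d - c q) < \<delta>"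
          using near chr_norm_le[OF x(1) DD_diff[OF d S]] chr_diff[OF x(1) d S] unfolding S_def[symmetric] by simp
        then have xd: "x d \<noteq> 0" using q(2) by (metis diff_0 norm_minus_cancel not_less_iff_gr_or_eq)
        \<comment> \<open>The factor is supported on the source of \<open>v\<close>, so being
          nonzero at \<open>x\<close> already places \<open>x\<close> in
          \<open>dom v\<close>.\<close>
        have "st v * v * d = E (st v * v * (st v * b))"
          unfolding d_def using E_mult_left[OF stV_mult_BB[OF v b] source_DD[OF v]] by simp
        also have "st v * v * (st v * b) = st v * b"
          using V_partial_isometry[OF V_st[OF v]] by (simp add: mult.assoc[symmetric])
        finally have "x (st v * v) * x d = x d"
          unfolding d_def[symmetric] using chr_mult[OF x(1) source_DD[OF v] d] by simp
        then have "x \<in> dom v" using xd x unfolding dom_def by simp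
        then show ?thesis using supp[OF v] xd unfolding ev_def d_def by blast
      qed
      obtain x where x: "chr x" "x q = 1" using chr_exists[OF q(1)] .
      have "v * q \<in> V N" using mp_restrict(1)[OF v N q(1)] good[OF x] x by blast
      moreover have "gr (v * q) \<subseteq> W"
      proof
        fix z assume z: "z \<in> gr (v * q)"
        then obtain x' where x': "z = (x', mp (v * q) x')" "x' \<in> dom (v * q)" using gr_iff by (cases z) auto
        have "x' q = 1" using dom_restrictD[OF v N q(1) x'(2)] by blast
        then show "z \<in> W" using good[of x'] dom_chr[OF x'(2)] mp_restrict(3)[OF v N q(1)] x' by simp
      qed
      ultimately have "v * q \<in> ?M" by (intro cspan_base) (auto simp: VV_def)
      then show "v * sc (c q) q \<in> ?M" using csubspace_cspan unfolding csubspace_def sc_mult_right by blast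
    qed
    ultimately show "\<exists>y\<in>?M. dist y (v * E (st v * b)) < e" unfolding d_def dist_norm by blast
  qed
  have Phi: "Phi n b \<in> closure ?M" for n
    unfolding Phi_def by (rule csubspace_sum[OF cl piece])
  have "\<exists>y\<in>closure ?M. dist y b < e" if e: "e > 0" for e
  proof -
    obtain n where "norm (b - Phi n b) < e" using Phi_approx[OF b e] .
    then have "dist (Phi n b) b < e" by (simp add: dist_norm norm_minus_commute)
    then show ?thesis using Phi by blast
  qed
  then have "b \<in> closure (closure ?M)" unfolding closure_approachable[of b "closure ?M"] by blast
  then show ?thesis by simp
qed

text \<open>A matrix unit with graph inside \<open>W\<close> has coefficient 0 at a point outside,
  and vanishing of one coefficient is a closed linear condition.\<close>

lemma closure_imp_support:
  assumes b: "b \<in> closure (cspan ii {v \<in> VV. gr v \<subseteq> W})"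
    and v: "v \<in> V n" and x: "x \<in> dom v" "(x, mp v x) \<notin> W"
  shows "ev v x b = 0"
proof -
  have "closure (cspan ii {v \<in> VV. gr v \<subseteq> W}) \<subseteq> {b \<in> BB. ev v x b = 0}"
  proof (intro closed_cspan_minimal csubspace_ev_0 closed_ev_0)
    show "{v \<in> VV. gr v \<subseteq> W} \<subseteq> {b \<in> BB. ev v x b = 0}"
      using x ev_V[OF v _ x(1)] V_BB unfolding VV_def by auto
  qed (use v dom_chr[OF x(1)] in auto)
  then show ?thesis using b by blast
qed

text \<open>The case \<open>W = {}\<close> of synthesis: every matrix unit has a nonempty graph, so
  the span is zero. Identities between elements can therefore be checked on coefficients.\<close>

lemma ev_eq_0_imp_0:
  assumes b: "b \<in> BB" and "\<And>n v x. v \<in> V n \<Longrightarrow> x \<in> dom v \<Longrightarrow> ev v x b = 0" shows "b = 0"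
proof -
  have "gr v \<noteq> {}" if "v \<in> VV" for v
  proof -
    from that obtain n where "v \<in> V n" unfolding VV_def by blast
    then obtain x where "x \<in> dom v" using dom_nonempty by blast
    then have "(x, mp v x) \<in> gr v" unfolding gr_iff by simp
    then show ?thesis by blast
  qed
  then have e: "{v \<in> VV. gr v \<subseteq> {}} = {}" by blast
  have "b \<in> closure (cspan ii {v \<in> VV. gr v \<subseteq> {}})" by (rule support_imp_closure[OF b assms(2)])
  then have "b \<in> closure (cspan ii {})" unfolding e .
  moreover have "closure (cspan ii {}) \<subseteq> {0}" by (intro closed_cspan_minimal csubspace_zero) auto
  ultimately show ?thesis by blast
qed

text \<open>Compactness of the spectrum of a diagonal matrix unit, in the form of Koenig's lemma.\<close>
lemma compactness:
  assumes p: "p \<in> Q n"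
    and her: "\<And>N M q q'. N \<le> M \<Longrightarrow> q \<in> Q N \<Longrightarrow> q' \<in> Q M \<Longrightarrow> q * q' = q' \<Longrightarrow> R q \<Longrightarrow> R q'"
    and loc: "\<And>x. chr x \<Longrightarrow> x p = 1 \<Longrightarrow> \<exists>N\<ge>n. \<exists>q\<in>Q N. x q = 1 \<and> R q"
  obtains M where "M \<ge> n" "\<And>N q. N \<ge> M \<Longrightarrow> q \<in> Q N \<Longrightarrow> p * q = q \<Longrightarrow> R q"
proof -
  \<comment> \<open>Good means that the property holds uniformly deep below \<open>q\<close>. A bad
    projection has a bad child, so a bad \<open>p\<close> starts an infinite chain of bad
    projections, and the character of that chain contradicts \<open>loc\<close>.\<close>
  define good where "good q \<longleftrightarrow> (\<exists>M. \<forall>N\<ge>M. \<forall>q'\<in>Q N. q * q' = q' \<longrightarrow> R q')" for q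
  have step: "\<exists>q'\<in>Q (Suc k). q * q' = q' \<and> \<not> good q'" if q: "q \<in> Q k" "\<not> good q" for q k
  proof (rule ccontr)
    assume "\<not> ?thesis"
    then have "\<forall>q'\<in>{q'\<in>Q (Suc k). q * q' = q'}. \<exists>M. \<forall>N\<ge>M. \<forall>s\<in>Q N. q' * s = s \<longrightarrow> R s"
      unfolding good_def by blast
    then obtain f where f: "\<And>q' N s. q' \<in> Q (Suc k) \<Longrightarrow> q * q' = q' \<Longrightarrow> N \<ge> f q' \<Longrightarrow> s \<in> Q N \<Longrightarrow> q' * s = s \<Longrightarrow> R s"
      by (metis (mono_tags, lifting) mem_Collect_eq)
    \<comment> \<open>The sum of the finitely many bounds serves as their common upper
      bound.\<close>
    have "R s" if N: "N \<ge> Suc k + sum f (Q (Suc k))" and s: "s \<in> Q N" "q * s = s" for N s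
    proof -
      obtain x where x: "chr x" "x s = 1" using chr_exists[OF s(1)] .
      have "x q = 1" using chr_mult[OF x(1) Q_DD[OF q(1)] Q_DD[OF s(1)]] s(2) x(2) by simp
      then obtain q' where q': "q' \<in> Q (Suc k)" "x q' = 1" "q * q' = q'"
        using chr_child[OF x(1) q(1), of "Suc k"] by auto
      have "q' * s = s"
        using Q_le[OF q'(1) _ s(1)] N chr_mult[OF x(1) Q_DD[OF q'(1)] Q_DD[OF s(1)]] q'(2) x chr_0[OF x(1)] by force
      moreover have "f q' \<le> sum f (Q (Suc k))" using q'(1) finite_Q by (intro member_le_sum) auto
      ultimately show ?thesis using f[OF q'(1,3), of N s] N s by simp
    qed
    then show False using q(2) unfolding good_def by blast
  qed
  have "good p"
  proof (rule ccontr)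
    assume np: "\<not> good p"
    have "\<exists>qs. \<forall>k. (qs k \<in> Q (n + k) \<and> \<not> good (qs k) \<and> (k = 0 \<longrightarrow> qs k = p)) \<and> qs k * qs (Suc k) = qs (Suc k)"
      by (rule dependent_nat_choice) (use p np step[of _ "n + _"] in auto)
    then obtain qs where qs: "\<And>k. qs k \<in> Q (n + k)" "\<And>k. \<not> good (qs k)" "qs 0 = p"
      "\<And>k. qs k * qs (Suc k) = qs (Suc k)" by blast
    obtain x where x: "chr x" "\<And>k. x (qs k) = 1" using chain_character[OF qs(1,4)] by blast
    then obtain N q where N: "N \<ge> n" "q \<in> Q N" "x q = 1" "R q" using loc[of x] qs(3) by metis
    have "q = qs (N - n)" using chr_Q_unique[OF x(1) N(2) _ N(3) x(2)] qs(1)[of "N - n"] N(1) by simp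
    moreover have "good q" unfolding good_def using her[OF _ N(2) _ _ N(4)] by blast
    ultimately show False using qs(2) by blast
  qed
  then obtain M where "\<forall>N\<ge>M. \<forall>q'\<in>Q N. p * q' = q' \<longrightarrow> R q'" unfolding good_def by blast
  then show thesis by (intro that[of "max n M"]) auto
qed

end

section \<open>The spectral triple\<close>

text \<open>\<open>V_or\<close> and \<open>V_and\<close> carry triangularity: each matrix unit or
  its adjoint lies in \<open>A\<close>, and both do only on the diagonal.\<close>

locale taf = matrix_units st ii V Q
  for st :: "'a::{real_normed_algebra_1,banach} \<Rightarrow> 'a" and ii :: 'a and V Q :: "nat \<Rightarrow> 'a set" +
  fixes A :: "'a set"
  assumes csubspace_A: "csubspace ii A" and closed_A: "closed A" and mult_A: "mult_closed A"
    and V_or: "v \<in> V n \<Longrightarrow> v \<in> A \<or> st v \<in> A"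
    and V_and: "v \<in> V n \<Longrightarrow> v \<in> A \<Longrightarrow> st v \<in> A \<Longrightarrow> v \<in> Q n"
    and Q_A: "q \<in> Q n \<Longrightarrow> q \<in> A"
    and A_gen: "A = closure (cspan ii (VV \<inter> A))"
begin

definition R :: "(('a \<Rightarrow> complex) \<times> ('a \<Rightarrow> complex)) set" where "R = (\<Union>v\<in>VV. gr v)"
definition P :: "(('a \<Rightarrow> complex) \<times> ('a \<Rightarrow> complex)) set" where "P = (\<Union>v\<in>VV \<inter> A. gr v)"
definition RT :: "(('a \<Rightarrow> complex) \<times> ('a \<Rightarrow> complex)) topology" where "RT = topology_generated_by (gr ` VV)"
abbreviation GT :: "('a \<Rightarrow> complex) topology" where "GT \<equiv> gelfand_top ii DD"

lemma A_mult: "a \<in> A \<Longrightarrow> b \<in> A \<Longrightarrow> a * b \<in> A"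
  using mult_A unfolding mult_closed_def by blast

lemma RE: assumes "p \<in> R" obtains n v where "v \<in> V n" "p \<in> gr v"
  using assms unfolding R_def VV_def by blast

lemma PE: assumes "p \<in> P" obtains n v where "v \<in> V n" "v \<in> A" "p \<in> gr v"
  using assms unfolding P_def VV_def by blast

lemma gr_R: "v \<in> V n \<Longrightarrow> p \<in> gr v \<Longrightarrow> p \<in> R" unfolding R_def VV_def by blast

lemma P_R: "P \<subseteq> R" unfolding P_def R_def by blast

text \<open>If \<open>v\<close> were outside \<open>A\<close>, its adjoint would be inside. Near a
  point of P some cut of \<open>v\<close> would then lie in \<open>A\<close> together with its
  adjoint, hence be diagonal; and a matrix unit whose graph meets the diagonal is itself
  diagonal.\<close>

lemma P_iff: assumes v: "v \<in> V n" and xy: "(x, y) \<in> gr v" shows "(x, y) \<in> P \<longleftrightarrow> v \<in> A"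
proof
  assume "v \<in> A" then show "(x, y) \<in> P" using v xy unfolding P_def VV_def by blast
next
  assume "(x, y) \<in> P"
  then obtain m w where w: "w \<in> V m" "w \<in> A" "(x, y) \<in> gr w" by (rule PE)
  define N where "N = max n m"
  have N: "n \<le> N" "m \<le> N" unfolding N_def by auto
  obtain q where q: "q \<in> Q N" "x q = 1" using gr_restrict[OF v N(1) xy] by blast
  note c = gr_common[OF v w(1) N q xy w(3)]
  show "v \<in> A"
  proof (rule ccontr)
    assume "v \<notin> A"
    then have "st v \<in> A" using V_or[OF v] by blast
    then have "st (v * q) \<in> A" unfolding st_mult Q_st[OF q(1)] using Q_A[OF q(1)] A_mult by blast
    moreover have "v * q \<in> A" unfolding c(1) using w(2) Q_A[OF q(1)] A_mult by blast
    ultimately have "v * q \<in> Q N" using V_and[OF c(2)] by blast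
    then have "y = x" using c(3) gr_Q by blast
    then have "v \<in> Q n" using gr_diag[OF v] xy by blast
    then show False using Q_A \<open>v \<notin> A\<close> by blast
  qed
qed

lemma R_sym: "(x, y) \<in> R \<Longrightarrow> (y, x) \<in> R"
  by (elim RE) (metis gr_st V_st gr_R)

lemma R_level:
  assumes "(x, y) \<in> R" "(y, z) \<in> R"
  obtains n v w where "v \<in> V n" "w \<in> V n" "(x, y) \<in> gr v" "(y, z) \<in> gr w"
proof -
  from assms obtain n m v w where v: "v \<in> V n" "(x, y) \<in> gr v" and w: "w \<in> V m" "(y, z) \<in> gr w"
    by (metis RE)
  define N where "N = max n m"
  have N: "n \<le> N" "m \<le> N" unfolding N_def by auto
  show thesis using gr_restrict[OF v(1) N(1) v(2)] gr_restrict[OF w(1) N(2) w(2)] that by metis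
qed

lemma R_trans: assumes "(x, y) \<in> R" "(y, z) \<in> R" shows "(x, z) \<in> R"
proof -
  obtain n v w where "v \<in> V n" "w \<in> V n" "(x, y) \<in> gr v" "(y, z) \<in> gr w" using R_level[OF assms] .
  from gr_mult[OF this] show ?thesis by (rule gr_R)
qed

lemma R_P: "(x, y) \<in> R \<Longrightarrow> (x, y) \<in> P \<or> (y, x) \<in> P"
proof (elim RE)
  fix n v assume v: "v \<in> V n" "(x, y) \<in> gr v"
  then show ?thesis using V_or[OF v(1)] P_iff[OF v] P_iff[OF V_st[OF v(1)] gr_st[OF v]] by blast
qed

lemma P_antisym: assumes "(x, y) \<in> P" "(y, x) \<in> P" shows "y = x"
proof -
  obtain n v where v: "v \<in> V n" "v \<in> A" "(x, y) \<in> gr v" using PE[OF assms(1)] .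
  have "st v \<in> A" using P_iff[OF V_st[OF v(1)] gr_st[OF v(1,3)]] assms(2) by blast
  then have "v \<in> Q n" using V_and v by blast
  then show ?thesis using gr_Q v(3) by blast
qed

lemma P_refl: assumes "chr x" shows "(x, x) \<in> P"
proof -
  obtain n q where q: "q \<in> Q n" "x q = 1" using chr_Q_exists[OF assms] .
  then have "(x, x) \<in> gr q" using gr_Q assms by blast
  then show ?thesis using P_iff[OF Q_V[OF q(1)]] Q_A q(1) by blast
qed

lemma R_chr: "(x, y) \<in> R \<Longrightarrow> chr x \<and> chr y"
  by (elim RE) (metis gr_chr)

lemma VV_nonempty_graph: assumes "v \<in> V n" obtains x where "(x, mp v x) \<in> gr v"
  using dom_nonempty[OF assms] gr_iff by metis

text \<open>Brings \<open>A\<close> into the form required by synthesis, so that membership becomes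
  vanishing of coefficients off \<open>P\<close>.\<close>

lemma A_support: "A = closure (cspan ii {v \<in> VV. gr v \<subseteq> P})"
proof -
  have e: "{v \<in> VV. gr v \<subseteq> P} = VV \<inter> A"
  proof (intro equalityI subsetI)
    fix v assume "v \<in> {v \<in> VV. gr v \<subseteq> P}"
    then obtain n where v: "v \<in> V n" "gr v \<subseteq> P" unfolding VV_def by blast
    obtain x where "(x, mp v x) \<in> gr v" using VV_nonempty_graph[OF v(1)] .
    then show "v \<in> VV \<inter> A" using P_iff[OF v(1)] v unfolding VV_def by blast
  qed (auto simp: P_def)
  show ?thesis unfolding e by (rule A_gen)
qed

lemma DD_support: "DD = closure (cspan ii {v \<in> VV. gr v \<subseteq> Id})"
proof -
  have "{v \<in> VV. gr v \<subseteq> Id} = QQ"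
  proof (intro equalityI subsetI)
    fix v assume "v \<in> {v \<in> VV. gr v \<subseteq> Id}"
    then obtain n where v: "v \<in> V n" "gr v \<subseteq> Id" unfolding VV_def by blast
    obtain x where x: "(x, mp v x) \<in> gr v" using VV_nonempty_graph[OF v(1)] .
    from subsetD[OF v(2) x] have "mp v x = x" by simp
    from x[unfolded this] have "v \<in> Q n" by (rule gr_diag[OF v(1)])
    then show "v \<in> QQ" unfolding QQ_def by blast
  next
    fix q assume "q \<in> QQ"
    then obtain n where q: "q \<in> Q n" unfolding QQ_def by blast
    then have "q \<in> VV" using Q_V unfolding VV_def by blast
    moreover have "gr q \<subseteq> Id" using gr_Q[OF q] by auto
    ultimately show "q \<in> {v \<in> VV. gr v \<subseteq> Id}" by blast
  qed
  then show ?thesis unfolding DD_def by simp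
qed

lemma A_BB: "A \<subseteq> BB"
  by (subst A_gen, intro closed_cspan_minimal csubspace_BB closed_BB) (auto simp: VV_def V_BB)

lemma ev_A: "b \<in> A \<Longrightarrow> v \<in> V n \<Longrightarrow> x \<in> dom v \<Longrightarrow> (x, mp v x) \<notin> P \<Longrightarrow> ev v x b = 0"
  using closure_imp_support A_support by blast

lemma A_iff_support:
  assumes "b \<in> BB"
  shows "b \<in> A \<longleftrightarrow> (\<forall>n. \<forall>v\<in>V n. \<forall>x\<in>dom v. (x, mp v x) \<notin> P \<longrightarrow> ev v x b = 0)"
  using ev_A support_imp_closure[OF assms, of P] A_support by blast

lemma DD_iff_support:
  assumes "b \<in> BB"
  shows "b \<in> DD \<longleftrightarrow> (\<forall>n. \<forall>v\<in>V n. \<forall>x\<in>dom v. (x, mp v x) \<notin> Id \<longrightarrow> ev v x b = 0)"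
  using closure_imp_support[of b Id] support_imp_closure[OF assms, of Id] DD_support by blast

text \<open>Both sides are continuous and conjugate linear in \<open>b\<close>, so they are compared
  on matrix units, where the adjoint reverses the graph.\<close>

lemma ev_st:
  assumes v: "v \<in> V n" and x: "x \<in> dom v" and b: "b \<in> BB"
  shows "ev (st v) (mp v x) (st b) = cnj (ev v x b)"
proof -
  note v' = V_st[OF v] and c = dom_chr[OF x] and c' = mp_chr[OF v x]
  let ?f = "\<lambda>b. ev (st v) (mp v x) (st b) - cnj (ev v x b)"
  have "BB \<subseteq> {b \<in> BB. ?f b = 0}"
  proof (rule BB_minimal)
    show "csubspace ii {b \<in> BB. ?f b = 0}" unfolding csubspace_def
      by (auto simp: BB_0 BB_add BB_sc BB_st st_add st_sc ev_0[OF c] ev_0[OF c'] ev_add[OF v c]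
            ev_add[OF v' c'] ev_sc[OF v c] ev_sc[OF v' c'])
    have "continuous_on BB (\<lambda>b. ev (st v) (mp v x) (st b))"
      by (rule continuous_on_compose2[OF continuous_on_ev[OF v' c']])
         (auto intro: BB_st bounded_linear.continuous_on[OF bounded_linear_st])
    then show "closed {b \<in> BB. ?f b = 0}"
      by (intro continuous_closed_preimage_constant closed_BB continuous_on_diff continuous_on_cnj
            continuous_on_ev[OF v c])
    fix m w assume w: "w \<in> V m"
    have "(mp v x, x) \<in> gr (st w) \<longleftrightarrow> (x, mp v x) \<in> gr w"
      using gr_st[OF w] gr_st[OF V_st[OF w]] by auto
    then show "w \<in> {b \<in> BB. ?f b = 0}"
      using ev_V[OF v' V_st[OF w] mp_dom_st[OF v x]] ev_V[OF v w x] mp_st[OF v x] V_BB[OF w] by simp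
  qed
  then show ?thesis using b by auto
qed

text \<open>If \<open>a\<close> and its adjoint lie in \<open>A\<close>, the coefficients of
  \<open>a\<close> are supported on P and on its reverse; by antisymmetry only diagonal points
  remain.\<close>

lemma diag_eq_DD: "diag st A = DD"
proof
  show "DD \<subseteq> diag st A"
  proof -
    have "DD \<subseteq> A" by (rule DD_minimal[OF csubspace_A closed_A Q_A])
    then show ?thesis unfolding diag_def using DD_st by blast
  qed
  show "diag st A \<subseteq> DD"
  proof
    fix a assume "a \<in> diag st A"
    then have a: "a \<in> A" "st a \<in> A" unfolding diag_def by auto
    have aB: "a \<in> BB" using a A_BB by blast
    have "ev v x a = 0" if v: "v \<in> V n" and x: "x \<in> dom v" and ne: "(x, mp v x) \<notin> Id" for n v x
    proof (cases "(x, mp v x) \<in> P")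
      case True
      then have "(mp v x, x) \<notin> P" using P_antisym ne by (metis pair_in_Id_conv)
      then have "ev (st v) (mp v x) (st a) = 0"
        using ev_A[OF a(2) V_st[OF v] mp_dom_st[OF v x]] mp_st[OF v x] by simp
      then show ?thesis using ev_st[OF v x aB] by simp
    qed (use ev_A a v x in blast)
    then show "a \<in> DD" using DD_iff_support[OF aB] by blast
  qed
qed

text \<open>The generating graphs form a base: through a common point of two of them runs the graph
  of a common cut.\<close>

lemma openin_RT: "openin RT S \<longleftrightarrow> S \<subseteq> R \<and> (\<forall>p\<in>S. \<exists>v\<in>VV. p \<in> gr v \<and> gr v \<subseteq> S)"
proof
  assume "openin RT S"
  then have "generate_topology_on (gr ` VV) S" unfolding RT_def openin_topology_generated_by_iff .
  then show "S \<subseteq> R \<and> (\<forall>p\<in>S. \<exists>v\<in>VV. p \<in> gr v \<and> gr v \<subseteq> S)"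
  proof induction
    case (Int a b)
    have "\<exists>v\<in>VV. p \<in> gr v \<and> gr v \<subseteq> a \<inter> b" if p: "p \<in> a \<inter> b" for p
    proof -
      obtain x y where xy: "p = (x, y)" by fastforce
      from Int p obtain v w where "v \<in> VV" "(x, y) \<in> gr v" "gr v \<subseteq> a" "w \<in> VV" "(x, y) \<in> gr w" "gr w \<subseteq> b"
        unfolding xy by blast
      then obtain n m where v: "v \<in> V n" "(x, y) \<in> gr v" "gr v \<subseteq> a" and w: "w \<in> V m" "(x, y) \<in> gr w" "gr w \<subseteq> b"
        unfolding VV_def by blast
      define N where "N = max n m"
      have N: "n \<le> N" "m \<le> N" unfolding N_def by auto
      obtain q where q: "q \<in> Q N" "x q = 1" using gr_restrict[OF v(1) N(1) v(2)] by blast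
      note c = gr_common[OF v(1) w(1) N q v(2) w(2)]
      have "gr (v * q) \<subseteq> a \<inter> b"
        using gr_restrict_subset[OF v(1) N(1) q(1)] gr_restrict_subset[OF w(1) N(2) q(1)] c(1) v w by auto
      moreover have "v * q \<in> VV" using c(2) unfolding VV_def by blast
      ultimately show ?thesis using c(3) xy by blast
    qed
    then show ?case using Int by blast
  next
    case (UN K)
    show ?case
    proof (intro conjI ballI)
      show "\<Union>K \<subseteq> R" using UN by blast
      fix p assume "p \<in> \<Union>K"
      then obtain k where k: "k \<in> K" "p \<in> k" by blast
      from UN.IH[OF k(1)] k(2) obtain v where "v \<in> VV" "p \<in> gr v" "gr v \<subseteq> k" by blast
      then show "\<exists>v\<in>VV. p \<in> gr v \<and> gr v \<subseteq> \<Union>K" using k(1) by blast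
    qed
  next
    case (Basis s)
    then show ?case unfolding R_def by blast
  qed simp
next
  assume S: "S \<subseteq> R \<and> (\<forall>p\<in>S. \<exists>v\<in>VV. p \<in> gr v \<and> gr v \<subseteq> S)"
  have "openin RT (gr v)" if "v \<in> VV" for v
    unfolding RT_def openin_topology_generated_by_iff using that by (intro generate_topology_on.Basis) blast
  then show "openin RT S" using S openin_subopen by metis
qed

lemma topspace_RT: "topspace RT = R"
  unfolding RT_def R_def by (simp add: topology_generated_by_topspace)

lemma openin_P: "openin RT P"
  unfolding openin_RT using P_R unfolding P_def by blast

lemma continuous_RT_if_locally_constant:
  assumes "\<And>p. p \<in> R \<Longrightarrow> \<exists>v\<in>VV. p \<in> gr v \<and> (\<forall>p'\<in>gr v. d p' = d p)"
  shows "continuous_map RT euclideanreal d"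
  unfolding continuous_map topspace_RT openin_RT
proof (intro conjI allI impI)
  fix U assume "openin euclideanreal U"
  show "\<forall>p\<in>{p \<in> R. d p \<in> U}. \<exists>v\<in>VV. p \<in> gr v \<and> gr v \<subseteq> {p \<in> R. d p \<in> U}"
  proof
    fix p assume p: "p \<in> {p \<in> R. d p \<in> U}"
    then obtain v where v: "v \<in> VV" "p \<in> gr v" "\<forall>p'\<in>gr v. d p' = d p" using assms by blast
    have "gr v \<subseteq> {p \<in> R. d p \<in> U}"
    proof
      fix p' assume p': "p' \<in> gr v"
      have "d p' = d p" using v(3) p' by (rule bspec)
      then show "p' \<in> {p \<in> R. d p \<in> U}" using p p' v(1) unfolding R_def by auto
    qed
    then show "\<exists>v\<in>VV. p \<in> gr v \<and> gr v \<subseteq> {p \<in> R. d p \<in> U}" using v by blast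
  qed
qed auto

text \<open>An integer-valued function that varies by less than 1 on a basic neighbourhood is
  constant there.\<close>

lemma locally_constant_if_continuous:
  assumes cont: "continuous_map RT euclideanreal d" and int: "\<forall>p\<in>R. d p \<in> \<int>" and p: "p \<in> R"
  obtains n v where "v \<in> V n" "p \<in> gr v" "\<And>p'. p' \<in> gr v \<Longrightarrow> d p' = d p"
proof -
  have "openin RT {p' \<in> topspace RT. d p' \<in> ball (d p) 1}"
    using cont by (rule openin_continuous_map_preimage) auto
  moreover have "p \<in> {p' \<in> R. d p' \<in> ball (d p) 1}" using p by simp
  ultimately obtain v where v: "v \<in> VV" "p \<in> gr v" "gr v \<subseteq> {p' \<in> R. d p' \<in> ball (d p) 1}"
    unfolding openin_RT topspace_RT by blast
  have "d p' = d p" if "p' \<in> gr v" for p'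
  proof -
    have "p' \<in> R" "\<bar>d p - d p'\<bar> < 1" using v(3) that by (auto simp: dist_real_def)
    then show ?thesis using int p by (metis Ints_diff Ints_nonzero_abs_less1 eq_iff_diff_eq_0)
  qed
  then show thesis using that v unfolding VV_def by blast
qed

text \<open>After approximating \<open>d\<close> at level n: characters taking the value 1 on a
  common finer projection agree on all projections of level n.\<close>

lemma chr_near:
  assumes x: "chr x" and d: "d \<in> DD" and e: "0 < e"
  shows "\<exists>n. \<forall>N q x'. N \<ge> n \<longrightarrow> q \<in> Q N \<longrightarrow> x q = 1 \<longrightarrow> chr x' \<longrightarrow> x' q = 1 \<longrightarrow> cmod (x' d - x d) < e"
proof -
  obtain n c where n: "norm (d - (\<Sum>q\<in>Q n. sc (c q) q)) < e / 2" using DD_approx[OF d half_gt_zero[OF e]] by metis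
  define S where "S = (\<Sum>q\<in>Q n. sc (c q) q)"
  have S: "S \<in> DD" unfolding S_def by (intro csubspace_sum[OF csubspace_DD] DD_sc Q_DD)
  have xS: "y S = (\<Sum>q\<in>Q n. c q * y q)" if y: "chr y" for y
  proof -
    have "y S = (\<Sum>q\<in>Q n. y (sc (c q) q))" unfolding S_def by (rule chr_sum[OF y]) (intro DD_sc Q_DD)
    then show ?thesis using chr_sc[OF y Q_DD] by (simp cong: sum.cong)
  qed
  have "cmod (x' d - x d) < e" if N: "N \<ge> n" and q: "q \<in> Q N" "x q = 1" and x': "chr x'" "x' q = 1" for N q x'
  proof -
    have "x p = x' p" if p: "p \<in> Q n" for p
      using Q_le[OF p N q(1)] chr_mult[OF x Q_DD[OF p] Q_DD[OF q(1)]] chr_mult[OF x'(1) Q_DD[OF p] Q_DD[OF q(1)]]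
        q x' chr_0[OF x] chr_0[OF x'(1)] by auto
    then have "x S = x' S" unfolding xS[OF x] xS[OF x'(1)] by simp
    moreover have "cmod (x d - x S) < e / 2" "cmod (x' d - x' S) < e / 2"
      using n chr_norm_le[OF x DD_diff[OF d S]] chr_norm_le[OF x'(1) DD_diff[OF d S]]
        chr_diff[OF x d S] chr_diff[OF x'(1) d S] unfolding S_def[symmetric] by simp_all
    ultimately show ?thesis by (smt (verit) field_sum_of_halves norm_diff_triangle_less norm_minus_commute)
  qed
  then show ?thesis by blast
qed

lemma topspace_GT: "topspace GT = {x. chr x}"
  unfolding gelfand_top_def using chr_extensional by (auto simp: PiE_def)

lemma continuous_GT_apply: "d \<in> DD \<Longrightarrow> continuous_map GT euclidean (\<lambda>x. x d)"
  unfolding gelfand_top_def by (intro continuous_map_from_subtopology continuous_map_product_projection)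

lemma openin_GT_apply: "d \<in> DD \<Longrightarrow> open U \<Longrightarrow> openin GT {x. chr x \<and> x d \<in> U}"
  using openin_continuous_map_preimage[OF continuous_GT_apply, of d U] unfolding topspace_GT by simp

lemma openin_GT_Q: assumes q: "q \<in> Q n" shows "openin GT {x. chr x \<and> x q = 1}"
proof -
  have "{x. chr x \<and> x q = 1} = {x. chr x \<and> x q \<in> - {0}}" using chr_Q[OF _ q] by auto
  then show ?thesis using openin_GT_apply[OF Q_DD[OF q], of "- {0}"] by (simp add: open_Compl)
qed

text \<open>A basic neighbourhood constrains finitely many elements of the diagonal, and each
  constraint is implied by a deep enough projection at \<open>x\<close>.\<close>

lemma GT_base:
  assumes "openin GT S" "x \<in> S"
  obtains n q where "q \<in> Q n" "x q = 1" "\<And>x'. chr x' \<Longrightarrow> x' q = 1 \<Longrightarrow> x' \<in> S"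
proof -
  from assms obtain T where T: "openin (product_topology (\<lambda>_. euclidean) DD) T" "S = T \<inter> {x. chr x}"
    unfolding gelfand_top_def openin_subtopology by blast
  have x: "chr x" "x \<in> T" using assms T by auto
  from T(1) x(2) obtain U where U: "finite {i \<in> DD. U i \<noteq> UNIV}" "\<And>i. i \<in> DD \<Longrightarrow> open (U i)"
    "x \<in> Pi\<^sub>E DD U" "Pi\<^sub>E DD U \<subseteq> T"
    unfolding openin_product_topology_alt by (auto simp: topspace_euclidean)
  have "\<exists>n. \<forall>N q x'. N \<ge> n \<longrightarrow> q \<in> Q N \<longrightarrow> x q = 1 \<longrightarrow> chr x' \<longrightarrow> x' q = 1 \<longrightarrow> x' d \<in> U d"
    if d: "d \<in> {i \<in> DD. U i \<noteq> UNIV}" for d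
  proof -
    have "open (U d)" "x d \<in> U d" using U d by auto
    then obtain e where e: "e > 0" "\<And>z. dist z (x d) < e \<Longrightarrow> z \<in> U d" unfolding open_dist by blast
    have dD: "d \<in> DD" using d by blast
    show ?thesis using chr_near[OF x(1) dD e(1)] e(2) unfolding dist_norm by meson
  qed
  then have "\<forall>d\<in>{i \<in> DD. U i \<noteq> UNIV}. \<exists>n. \<forall>N q x'. N \<ge> n \<longrightarrow> q \<in> Q N \<longrightarrow> x q = 1 \<longrightarrow> chr x' \<longrightarrow> x' q = 1 \<longrightarrow> x' d \<in> U d"
    by blast
  from bchoice[OF this] obtain f where f: "\<And>d N q x'. d \<in> DD \<Longrightarrow> U d \<noteq> UNIV \<Longrightarrow> N \<ge> f d \<Longrightarrow> q \<in> Q N \<Longrightarrow> x q = 1 \<Longrightarrow> chr x' \<Longrightarrow> x' q = 1 \<Longrightarrow> x' d \<in> U d"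
    by blast
  obtain n0 where n0: "\<And>N. n0 \<le> N \<Longrightarrow> \<exists>q\<in>Q N. x q = 1" using chr_level[OF x(1)] by metis
  \<comment> \<open>\<open>n0\<close> ensures that some projection of level N has value 1 at
    \<open>x\<close>; the sum dominates the levels required by the finitely many
    constraints.\<close>
  define N where "N = n0 + sum f {i \<in> DD. U i \<noteq> UNIV}"
  obtain q where q: "q \<in> Q N" "x q = 1" using n0[of N] unfolding N_def by auto
  have "x' \<in> S" if x': "chr x'" "x' q = 1" for x'
  proof -
    have "x' d \<in> U d" if d: "d \<in> DD" for d
    proof (cases "U d = UNIV")
      case False
      then have "f d \<le> sum f {i \<in> DD. U i \<noteq> UNIV}" using d U(1) by (intro member_le_sum) auto
      then show ?thesis using f[OF d False _ q x', of] unfolding N_def by simp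
    qed simp
    then have "x' \<in> Pi\<^sub>E DD U" using chr_extensional[OF x'(1)] by (auto simp: PiE_iff)
    then show ?thesis using U(4) T(2) x'(1) by blast
  qed
  then show thesis using that q by blast
qed

text \<open>Openness of the domain and continuity of the induced map at once: a cut of
  \<open>v\<close> at \<open>x\<close> has its range below a projection whose spectrum is contained
  in \<open>S\<close>.\<close>

lemma mp_local:
  assumes v: "v \<in> V n" and x: "x \<in> dom v" and S: "openin GT S" "mp v x \<in> S"
  obtains N q where "q \<in> Q N" "x q = 1" "\<And>x'. chr x' \<Longrightarrow> x' q = 1 \<Longrightarrow> x' \<in> dom v \<and> mp v x' \<in> S"
proof -
  obtain m p where p: "p \<in> Q m" "mp v x p = 1" "\<And>y. chr y \<Longrightarrow> y p = 1 \<Longrightarrow> y \<in> S" using GT_base[OF S] by metis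
  define N where "N = max n m"
  have N: "n \<le> N" "m \<le> N" unfolding N_def by auto
  have "(x, mp v x) \<in> gr v" using x gr_iff by blast
  then obtain q where q: "q \<in> Q N" "x q = 1" "v * q \<in> V N" using gr_restrict[OF v N(1)] by metis
  note rq = mp_restrict[OF v N(1) q(1) x q(2)]
  define s where "s = v * q * st (v * q)"
  have s: "s \<in> Q N" unfolding s_def using V_range[OF q(3)] .
  have "mp v x s = 1" using mp_range[OF q(3) rq(2)] rq(3) unfolding s_def by simp
  then have ps: "p * s = s"
    using Q_le[OF p(1) N(2) s] chr_mult[OF mp_chr[OF v x] Q_DD[OF p(1)] Q_DD[OF s]] p(2) chr_0[OF mp_chr[OF v x]] by auto
  have "x' \<in> dom v \<and> mp v x' \<in> S" if x': "chr x'" "x' q = 1" for x'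
  proof -
    have "st (v * q) * (v * q) = q"
      using V_nonzero[OF q(3)] by (cases rule: V_restrict_cases[OF v N(1) q(1)]) auto
    then have dv: "x' \<in> dom (v * q)" unfolding dom_def using x' by simp
    then have dv': "x' \<in> dom v" using dom_restrictD[OF v N(1) q(1)] by blast
    have "mp v x' s = 1" using mp_range[OF q(3) dv] mp_restrict(3)[OF v N(1) q(1) dv' x'(2)] unfolding s_def by simp
    then have "mp v x' p = 1"
      using chr_mult[OF mp_chr[OF v dv'] Q_DD[OF p(1)] Q_DD[OF s]] ps by simp
    then show ?thesis using dv' p(3) mp_chr[OF v dv'] by blast
  qed
  then show thesis using that q by blast
qed

end

section \<open>Cocycles and nested sequences of partial homeomorphisms\<close>

context taf begin

text \<open>The intermediate condition through which (2) and (4) reach a cocycle. Degrees start at 0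
  because P is the nonnegative part.\<close>

definition graded :: "(nat \<Rightarrow> (('a \<Rightarrow> complex) \<times> ('a \<Rightarrow> complex)) set) \<Rightarrow> bool" where
  "graded S \<longleftrightarrow> (\<forall>n. openin RT (S n)) \<and> (\<Union>n. S n) = P \<and> (\<forall>n m. n \<noteq> m \<longrightarrow> S n \<inter> S m = {}) \<and>
     S 0 = {(x, x) |x. chr x} \<and> (\<forall>n m x y z. (x, y) \<in> S n \<longrightarrow> (y, z) \<in> S m \<longrightarrow> (x, z) \<in> S (n + m))"

definition Z_cocycle :: "(('a \<Rightarrow> complex) \<times> ('a \<Rightarrow> complex) \<Rightarrow> real) \<Rightarrow> bool" where
  "Z_cocycle d \<longleftrightarrow> cocycle RT R d \<and> (\<forall>p\<in>R. d p \<in> \<int>) \<and> P = {p \<in> R. d p \<ge> 0}"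

lemma graded_imp_Z_cocycle: assumes "graded S" shows "\<exists>d. Z_cocycle d"
proof -
  have op: "\<And>n. openin RT (S n)" and un: "(\<Union>n. S n) = P" and dj: "\<And>n m. n \<noteq> m \<Longrightarrow> S n \<inter> S m = {}"
    and S0: "S 0 = {(x, x) |x. chr x}"
    and comp: "\<And>n m x y z. (x, y) \<in> S n \<Longrightarrow> (y, z) \<in> S m \<Longrightarrow> (x, z) \<in> S (n + m)"
  proof -
    note g = assms[unfolded graded_def]
    show "\<And>n. openin RT (S n)" using g by (rule conjE) (erule allE)
    note g2 = conjunct2[OF g]
    show "(\<Union>n. S n) = P" by (rule conjunct1[OF g2])
    note g3 = conjunct2[OF g2]
    show "\<And>n m. n \<noteq> m \<Longrightarrow> S n \<inter> S m = {}" using conjunct1[OF g3] by (elim allE impE)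
    note g4 = conjunct2[OF g3]
    show "S 0 = {(x, x) |x. chr x}" by (rule conjunct1[OF g4])
    show "\<And>n m x y z. (x, y) \<in> S n \<Longrightarrow> (y, z) \<in> S m \<Longrightarrow> (x, z) \<in> S (n + m)"
      using conjunct2[OF g4] by (elim allE impE)
  qed
  define deg where "deg p = (THE n. p \<in> S n)" for p
  have deg: "deg p = n" if "p \<in> S n" for p n
    unfolding deg_def using that dj by (intro the_equality) blast+
  define d where "d = (\<lambda>(x, y). if (x, y) \<in> P then real (deg (x, y)) else - real (deg (y, x)))"
  have SP: "p \<in> P" if "p \<in> S n" for p n using that un by blast
  have dS: "d (x, y) = real n" if "(x, y) \<in> S n" for x y n
    unfolding d_def using SP[OF that] deg[OF that] by simp
  \<comment> \<open>A reversed arrow lies in P itself only on the diagonal, where the degree is 0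
    and the two formulas for \<open>d\<close> agree.\<close>
  have dS': "d (x, y) = - real n" if "(y, x) \<in> S n" for x y n
  proof (cases "(x, y) \<in> P")
    case True
    then have "x = y" using P_antisym SP[OF that] by blast
    then have "(y, x) \<in> S 0" using R_chr True P_R unfolding S0 by blast
    then have "n = 0" using dj[of n 0] that by blast
    moreover have "d (x, y) = 0" using dS[of y x 0] \<open>(y, x) \<in> S 0\<close> \<open>x = y\<close> by simp
    ultimately show ?thesis by simp
  next
    case False
    then show ?thesis unfolding d_def using deg[OF that] by simp
  qed
  have cases: "\<exists>n. (x, y) \<in> S n \<or> (y, x) \<in> S n" if "(x, y) \<in> R" for x y
    using R_P[OF that] un by blast
  have anti: "d (y, x) = - d (x, y)" if "(x, y) \<in> R" for x y
    using cases[OF that] dS dS' by (metis minus_minus)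
  have nonneg: "\<exists>n. (x, y) \<in> S n" if r: "(x, y) \<in> R" "d (x, y) \<ge> 0" for x y
  proof -
    obtain n where n: "(x, y) \<in> S n \<or> (y, x) \<in> S n" using cases[OF r(1)] by blast
    show ?thesis
    proof (cases "(x, y) \<in> S n")
      case False
      then have yx: "(y, x) \<in> S n" using n by blast
      then have "n = 0" using dS'[OF yx] r(2) by simp
      then have "(y, x) \<in> S 0" using yx by simp
      then have "y = x" unfolding S0 by blast
      then show ?thesis using yx by blast
    qed blast
  qed
  have pos: "d (x, z) = d (x, y) + d (y, z)"
    if xy: "(x, y) \<in> R" "(y, z) \<in> R" "d (x, y) \<ge> 0" "d (y, z) \<ge> 0" for x y z
  proof -
    obtain n m where nm: "(x, y) \<in> S n" "(y, z) \<in> S m" using nonneg xy by blast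
    show ?thesis using dS[OF nm(1)] dS[OF nm(2)] dS[OF comp[OF nm]] by simp
  qed
  have add: "d (x, y) + d (y, z) = d (x, z)" if xy: "(x, y) \<in> R" and yz: "(y, z) \<in> R" for x y z
  proof -
    note r = xy yz R_trans[OF xy yz]
    note r' = R_sym[OF r(1)] R_sym[OF r(2)] R_sym[OF r(3)]
    note an = anti[OF r(1)] anti[OF r(2)] anti[OF r(3)]
    \<comment> \<open>Each sign pattern reduces to \<open>pos\<close> for the same triangle,
      traversed so that both steps have nonnegative degree.\<close>
    consider "d (x, y) \<ge> 0" "d (y, z) \<ge> 0" | "d (x, y) < 0" "d (y, z) < 0"
      | "d (x, y) \<ge> 0" "d (y, z) < 0" "d (x, z) \<ge> 0" | "d (x, y) \<ge> 0" "d (y, z) < 0" "d (x, z) < 0"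
      | "d (x, y) < 0" "d (y, z) \<ge> 0" "d (x, z) \<ge> 0" | "d (x, y) < 0" "d (y, z) \<ge> 0" "d (x, z) < 0"
      by linarith
    then show ?thesis
    proof cases
      case 1 then show ?thesis using pos[OF r(1,2)] by simp
    next
      case 2 then show ?thesis using pos[OF r'(2,1)] an by simp
    next
      case 3 then show ?thesis using pos[OF r(3) r'(2)] an by simp
    next
      case 4 then show ?thesis using pos[OF r'(3) r(1)] an by simp
    next
      case 5 then show ?thesis using pos[OF r'(1) r(3)] an by simp
    next
      case 6 then show ?thesis using pos[OF r(2) r'(3)] an by simp
    qed
  qed
  have loc: "\<exists>v\<in>VV. p \<in> gr v \<and> (\<forall>p'\<in>gr v. d p' = d p)" if p: "p \<in> R" for p
  proof -
    obtain x y where xy: "p = (x, y)" by fastforce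
    obtain n where n: "(x, y) \<in> S n \<or> (y, x) \<in> S n" using cases p xy by blast
    have ex: "\<exists>m v. v \<in> V m \<and> s \<in> gr v \<and> gr v \<subseteq> S n" if "s \<in> S n" for s
      using op[of n] that unfolding openin_RT VV_def by blast
    from n show ?thesis
    proof
      assume s: "(x, y) \<in> S n"
      then obtain m v where v: "v \<in> V m" "(x, y) \<in> gr v" "gr v \<subseteq> S n" using ex by blast
      have "d p' = d (x, y)" if "p' \<in> gr v" for p'
        using dS[of "fst p'" "snd p'" n] dS[OF s] subsetD[OF v(3) that] by simp
      then show ?thesis using v xy unfolding VV_def by blast
    next
      assume s: "(y, x) \<in> S n"
      then obtain m v where v: "v \<in> V m" "(y, x) \<in> gr v" "gr v \<subseteq> S n" using ex by blast
      have "d p' = d (x, y)" if p': "p' \<in> gr (st v)" for p'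
      proof -
        obtain a b where ab: "p' = (a, b)" by fastforce
        have "(b, a) \<in> gr v" using gr_st[OF V_st[OF v(1)], of a b] p' ab by simp
        then show ?thesis using dS'[of b a n] dS'[OF s] v(3) ab by auto
      qed
      then show ?thesis using V_st[OF v(1)] gr_st[OF v(1,2)] xy unfolding VV_def by blast
    qed
  qed
  have "Z_cocycle d" unfolding Z_cocycle_def cocycle_def
  proof (intro conjI ballI)
    show "continuous_map RT euclideanreal d" by (rule continuous_RT_if_locally_constant[OF loc])
    show "\<forall>x y z. (x, y) \<in> R \<and> (y, z) \<in> R \<longrightarrow> d (x, y) + d (y, z) = d (x, z)" using add by blast
    show "d p \<in> \<int>" for p unfolding d_def by (cases p) auto
    show "P = {p \<in> R. d p \<ge> 0}"
    proof (intro equalityI subsetI)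
      fix p assume p: "p \<in> P"
      then show "p \<in> {p \<in> R. d p \<ge> 0}" using P_R unfolding d_def by (cases p) auto
    next
      fix p assume p: "p \<in> {p \<in> R. d p \<ge> 0}"
      then obtain n where "p \<in> S n" using nonneg[of "fst p" "snd p"] by auto
      then show "p \<in> P" by (rule SP)
    qed
  qed
  then show ?thesis by blast
qed

text \<open>The nesting condition on graphs is the multiplicativity of the grading, with the indices
  exchanged by the order of composition.\<close>

lemma nested_imp_graded:
  fixes dm :: "int \<Rightarrow> ('a \<Rightarrow> complex) set"
  assumes nest: "nested_seq GT dm f"
    and op: "\<forall>n\<ge>0. openin (subtopology RT P) (graph_on (dm n) (f n))"
    and un: "P = (\<Union>n\<in>{0..}. graph_on (dm n) (f n))"
    and dj: "disjoint_family_on (\<lambda>n. graph_on (dm n) (f n)) {0..}"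
  shows "graded (\<lambda>n. graph_on (dm (int n)) (f (int n)))" (is "graded ?S")
  unfolding graded_def
proof (intro conjI allI impI)
  show "openin RT (?S n)" for n
    using op openin_open_subtopology[OF openin_P] by auto
  show "(\<Union>n. ?S n) = P"
  proof
    show "P \<subseteq> (\<Union>n. ?S n)"
    proof
      fix p assume "p \<in> P"
      then obtain k where "k \<ge> 0" "p \<in> graph_on (dm k) (f k)" using un by auto
      then have "p \<in> ?S (nat k)" by simp
      then show "p \<in> (\<Union>n. ?S n)" by blast
    qed
    show "(\<Union>n. ?S n) \<subseteq> P" using un by auto
  qed
  show "?S n \<inter> ?S m = {}" if "n \<noteq> m" for n m
    using dj that unfolding disjoint_family_on_def by simp
  show "?S 0 = {(x, x) |x. chr x}"
    using nest unfolding nested_seq_def graph_on_def topspace_GT by auto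
  show "(x, z) \<in> ?S (n + m)" if "(x, y) \<in> ?S n" "(y, z) \<in> ?S m" for n m x y z
  proof -
    have "(x, z) \<in> graph_on {x \<in> dm (int n). f (int n) x \<in> dm (int m)} (\<lambda>x. f (int m) (f (int n) x))"
      using that unfolding graph_on_def by auto
    moreover have "graph_on {x \<in> dm (int n). f (int n) x \<in> dm (int m)} (\<lambda>x. f (int m) (f (int n) x))
        \<subseteq> graph_on (dm (int m + int n)) (f (int m + int n))"
      using nest unfolding nested_seq_def by blast
    ultimately show ?thesis by (auto simp: add.commute)
  qed
qed

end

section \<open>Integer cocycles and their level sets\<close>

locale taf_cocycle = taf st ii V Q A
  for st :: "'a::{real_normed_algebra_1,banach} \<Rightarrow> 'a" and ii :: 'a and V Q :: "nat \<Rightarrow> 'a set" and A +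
  fixes d :: "('a \<Rightarrow> complex) \<times> ('a \<Rightarrow> complex) \<Rightarrow> real"
  assumes d: "Z_cocycle d"
begin

lemma zc_continuous: "continuous_map RT euclideanreal d"
  and zc_Ints: "\<forall>p\<in>R. d p \<in> \<int>" and zc_P_eq: "P = {p \<in> R. d p \<ge> 0}"
  and zc_add': "\<forall>x y z. (x, y) \<in> R \<and> (y, z) \<in> R \<longrightarrow> d (x, y) + d (y, z) = d (x, z)"
  using d unfolding Z_cocycle_def cocycle_def by simp_all

lemma zc_add: "(x, y) \<in> R \<Longrightarrow> (y, z) \<in> R \<Longrightarrow> d (x, z) = d (x, y) + d (y, z)"
  using zc_add' by simp

lemma zc_refl: "chr x \<Longrightarrow> d (x, x) = 0"
  using zc_add[of x x x] P_refl P_R by auto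

lemma zc_sym: "(x, y) \<in> R \<Longrightarrow> d (y, x) = - d (x, y)"
  using zc_add[of x y x] R_sym zc_refl R_chr by force

lemma zc_P: "(x, y) \<in> R \<Longrightarrow> (x, y) \<in> P \<longleftrightarrow> d (x, y) \<ge> 0"
  unfolding zc_P_eq by simp

lemma zc_0: "(x, y) \<in> R \<Longrightarrow> d (x, y) = 0 \<Longrightarrow> y = x"
  using P_antisym[of x y] zc_P[of x y] zc_P[of y x] zc_sym[of x y] R_sym[of x y] by simp

text \<open>By additivity \<open>(z, y)\<close> has degree 0, and antisymmetry of P confines degree
  0 to the diagonal. This makes each level set the graph of a map.\<close>

lemma zc_unique: "(x, y) \<in> R \<Longrightarrow> (x, z) \<in> R \<Longrightarrow> d (x, y) = d (x, z) \<Longrightarrow> y = z"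
  using zc_0[of z y] zc_add[of z x y] zc_sym[of x z] R_sym[of x z] R_trans[of z x y] by simp

lemma zc_locally_constant:
  assumes "p \<in> R" obtains n v where "v \<in> V n" "p \<in> gr v" "\<And>p'. p' \<in> gr v \<Longrightarrow> d p' = d p"
  using locally_constant_if_continuous[OF zc_continuous zc_Ints assms] by metis

lemma zc_int: "p \<in> R \<Longrightarrow> \<exists>k::int. d p = of_int k"
  using zc_Ints by (meson Ints_cases)

text \<open>\<open>f k\<close> sends \<open>x\<close> to the unique point at degree k. Locally it is
  the map of a matrix unit on whose graph the cocycle is constant, which gives open domains and
  continuity; its inverse is \<open>f (- k)\<close>.\<close>

lemma Z_cocycle_imp_nested:
  "\<exists>(dm :: int \<Rightarrow> ('a \<Rightarrow> complex) set) f.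
        nested_seq GT dm f \<and>
        (\<forall>n\<ge>0. openin (subtopology RT P) (graph_on (dm n) (f n))) \<and>
        P = (\<Union>n\<in>{0..}. graph_on (dm n) (f n)) \<and>
        disjoint_family_on (\<lambda>n. graph_on (dm n) (f n)) {0..}"
proof -
  define dm where "dm k = {x. \<exists>y. (x, y) \<in> R \<and> d (x, y) = of_int k}" for k :: int
  define f where "f k x = (THE y. (x, y) \<in> R \<and> d (x, y) = of_int k)" for k :: int and x
  have f_eq: "x \<in> dm k \<and> f k x = y" if "(x, y) \<in> R" "d (x, y) = of_int k" for x y k
    unfolding dm_def f_def using that zc_unique by (auto intro!: the_equality)
  have fR: "(x, f k x) \<in> R" "d (x, f k x) = of_int k" if "x \<in> dm k" for x k
    using that f_eq unfolding dm_def by auto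
  have graph: "graph_on (dm k) (f k) = {p \<in> R. d p = of_int k}" for k
  proof (intro equalityI subsetI)
    fix p assume "p \<in> graph_on (dm k) (f k)"
    then show "p \<in> {p \<in> R. d p = of_int k}" using fR unfolding graph_on_def by auto
  next
    fix p assume p: "p \<in> {p \<in> R. d p = of_int k}"
    then show "p \<in> graph_on (dm k) (f k)" using f_eq[of "fst p" "snd p" k] unfolding graph_on_def by force
  qed
  have inv: "f k x \<in> dm (- k) \<and> f (- k) (f k x) = x" if "x \<in> dm k" for x k
    using f_eq[of "f k x" x "- k"] fR[OF that] R_sym zc_sym[of x "f k x"] by simp
  have img: "f k ` dm k = dm (- k)" for k
    using inv[of _ k] inv[of _ "- k"] by force
  have chr_dm: "chr x" if "x \<in> dm k" for x k using that R_chr unfolding dm_def by blast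
  have pre: "openin GT {x \<in> dm k. f k x \<in> S}" if S: "openin GT S" for k S
  proof (subst openin_subopen, intro ballI)
    fix x assume "x \<in> {x \<in> dm k. f k x \<in> S}"
    then have x: "x \<in> dm k" "f k x \<in> S" by auto
    obtain n v where v: "v \<in> V n" "(x, f k x) \<in> gr v" "\<And>p'. p' \<in> gr v \<Longrightarrow> d p' = d (x, f k x)"
      using zc_locally_constant[OF fR(1)[OF x(1)]] by metis
    have xv: "x \<in> dom v" "f k x = mp v x" using v(2) gr_iff by auto
    obtain N q where q: "q \<in> Q N" "x q = 1" "\<And>x'. chr x' \<Longrightarrow> x' q = 1 \<Longrightarrow> x' \<in> dom v \<and> mp v x' \<in> S"
      using mp_local[OF v(1) xv(1) S] x(2) unfolding xv(2) by metis
    have "{x'. chr x' \<and> x' q = 1} \<subseteq> {x \<in> dm k. f k x \<in> S}"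
    proof clarify
      fix x' assume x': "chr x'" "x' q = 1"
      have g: "(x', mp v x') \<in> gr v" using q(3)[OF x'] gr_iff by blast
      then have "d (x', mp v x') = of_int k" using v(3) fR(2)[OF x(1)] by metis
      then have "x' \<in> dm k \<and> f k x' = mp v x'" using f_eq gr_R[OF v(1) g] by blast
      then show "x' \<in> dm k \<and> f k x' \<in> S" using q(3)[OF x'] by simp
    qed
    then show "\<exists>T. openin GT T \<and> x \<in> T \<and> T \<subseteq> {x \<in> dm k. f k x \<in> S}"
      using openin_GT_Q[OF q(1)] chr_dm[OF x(1)] q(2) by blast
  qed
  have open_dm: "openin GT (dm k)" for k
  proof -
    have "{x \<in> dm k. f k x \<in> topspace GT} = dm k" unfolding topspace_GT using fR R_chr by blast
    then show ?thesis using pre[OF openin_topspace, of k] by simp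
  qed
  have cont: "continuous_map (subtopology GT (dm k)) (subtopology GT (dm (- k))) (f k)" for k
    unfolding continuous_map_in_subtopology unfolding continuous_map
  proof (intro conjI allI impI)
    fix U assume U: "openin GT U"
    have e: "{x \<in> topspace (subtopology GT (dm k)). f k x \<in> U} = {x \<in> dm k. f k x \<in> U}"
      using chr_dm unfolding topspace_subtopology topspace_GT by auto
    show "openin (subtopology GT (dm k)) {x \<in> topspace (subtopology GT (dm k)). f k x \<in> U}"
      unfolding e openin_subtopology using pre[OF U, of k]
      by (intro exI[of _ "{x \<in> dm k. f k x \<in> U}"]) auto
  qed (use inv[of _ k] chr_dm in \<open>auto simp: topspace_GT\<close>)
  have ph: "partial_homeo GT (dm k) (f k)" for k
    unfolding partial_homeo_def img homeomorphic_map_maps homeomorphic_maps_def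
    using open_dm cont[of k] cont[of "- k"] inv[of _ k] inv[of _ "- k"]
    by (intro conjI exI[of _ "f (- k)"]) auto
  have nest: "nested_seq GT dm f" unfolding nested_seq_def
  proof (intro conjI allI ballI)
    show "partial_homeo GT (dm n) (f n)" for n by (rule ph)
    have 0: "x \<in> dm 0 \<and> f 0 x = x" if "chr x" for x
      using f_eq[of x x 0] zc_refl[OF that] P_refl[OF that] P_R by auto
    then show "dm 0 = topspace GT" "\<And>x. x \<in> topspace GT \<Longrightarrow> f 0 x = x"
      using chr_dm unfolding topspace_GT by auto
    show "dm (- n) = f n ` dm n" for n using img by simp
    show "\<And>n x. x \<in> dm n \<Longrightarrow> f (- n) (f n x) = x" using inv by blast
    show "graph_on {x \<in> dm m. f m x \<in> dm n} (\<lambda>x. f n (f m x)) \<subseteq> graph_on (dm (n + m)) (f (n + m))" for n m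
    proof
      fix p assume "p \<in> graph_on {x \<in> dm m. f m x \<in> dm n} (\<lambda>x. f n (f m x))"
      then obtain x where x: "p = (x, f n (f m x))" "x \<in> dm m" "f m x \<in> dm n" unfolding graph_on_def by blast
      note r = fR(1)[OF x(2)] fR(1)[OF x(3)]
      have "d p = of_int (n + m)" unfolding x(1) using zc_add[OF r] fR(2)[OF x(2)] fR(2)[OF x(3)] by simp
      then show "p \<in> graph_on (dm (n + m)) (f (n + m))" unfolding graph x(1) using R_trans[OF r] by blast
    qed
  qed
  have gP: "graph_on (dm n) (f n) \<subseteq> P" if "n \<ge> 0" for n
    unfolding graph zc_P_eq using that by auto
  have "openin RT {p \<in> R. d p = of_int n}" for n :: int
    unfolding openin_RT
  proof (intro conjI ballI)
    fix p assume "p \<in> {p \<in> R. d p = of_int n}"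
    then have p: "p \<in> R" "d p = of_int n" by auto
    obtain k v where v: "v \<in> V k" "p \<in> gr v" "\<And>p'. p' \<in> gr v \<Longrightarrow> d p' = d p"
      using zc_locally_constant[OF p(1)] by metis
    have "gr v \<subseteq> {p \<in> R. d p = of_int n}"
    proof
      fix p' assume p': "p' \<in> gr v"
      show "p' \<in> {p \<in> R. d p = of_int n}" using v(3)[OF p'] p(2) gr_R[OF v(1) p'] by simp
    qed
    then show "\<exists>v\<in>VV. p \<in> gr v \<and> gr v \<subseteq> {p \<in> R. d p = of_int n}" using v unfolding VV_def by blast
  qed blast
  then have op: "openin (subtopology RT P) (graph_on (dm n) (f n))" if "n \<ge> 0" for n
    using openin_open_subtopology[OF openin_P] gP[OF that] unfolding graph by blast
  have un: "P = (\<Union>n\<in>{0..}. graph_on (dm n) (f n))"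
  proof
    show "P \<subseteq> (\<Union>n\<in>{0..}. graph_on (dm n) (f n))"
    proof
      fix p assume p: "p \<in> P"
      then have p': "p \<in> R" "d p \<ge> 0" unfolding zc_P_eq by auto
      obtain k :: int where k: "d p = of_int k" using zc_int[OF p'(1)] by blast
      then have "k \<in> {0..}" "p \<in> graph_on (dm k) (f k)" unfolding graph using p' by auto
      then show "p \<in> (\<Union>n\<in>{0..}. graph_on (dm n) (f n))" by blast
    qed
  qed (use gP in auto)
  have "disjoint_family_on (\<lambda>n. graph_on (dm n) (f n)) {0..}"
    unfolding disjoint_family_on_def graph by auto
  then show ?thesis using nest op un by blast
qed

end

section \<open>Gradings by closed subspaces\<close>

context taf begin

lemma ev_mult_V_DD: assumes v: "v \<in> V n" and x: "x \<in> dom v" and a: "a \<in> DD" shows "ev v x (v * a) = x a"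
proof -
  have "st v * (v * a) = st v * v * a" by (simp only: mult.assoc)
  then show ?thesis
    unfolding ev_def using E_id[OF DD_mult[OF source_DD[OF v] a]] chr_mult[OF dom_chr[OF x] source_DD[OF v] a]
      dom_source[OF x] by simp
qed

text \<open>The value at \<open>e\<close> stays nonzero near \<open>x\<close>, so every sufficiently
  fine cut of \<open>v\<close> at \<open>x\<close> works.\<close>

lemma gr_local:
  assumes v: "v \<in> V m" and g: "(x, y) \<in> gr v" and e: "e \<in> DD" "x e \<noteq> 0"
  obtains N s where "s \<in> Q N" "v * s \<in> V N" "(x, y) \<in> gr (v * s)"
    "\<And>x' y'. (x', y') \<in> gr (v * s) \<Longrightarrow> (x', y') \<in> gr v \<and> x' e \<noteq> 0"
proof -
  have x: "chr x" using gr_chr v g by blast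
  define W where "W = {x. chr x \<and> x e \<in> - {0}}"
  have W: "openin GT W" unfolding W_def by (rule openin_GT_apply[OF e(1)]) (simp add: open_Compl)
  have xW: "x \<in> W" unfolding W_def using x e by simp
  obtain k q where q: "q \<in> Q k" "x q = 1" "\<And>x'. chr x' \<Longrightarrow> x' q = 1 \<Longrightarrow> x' \<in> W"
    using GT_base[OF W xW] by metis
  define N where "N = max m k"
  have N: "m \<le> N" "k \<le> N" unfolding N_def by auto
  obtain s where s: "s \<in> Q N" "x s = 1" "v * s \<in> V N" "(x, y) \<in> gr (v * s)" using gr_restrict[OF v N(1) g] .
  have qs: "q * s = s"
    using Q_le[OF q(1) N(2) s(1)] chr_mult[OF x Q_DD[OF q(1)] Q_DD[OF s(1)]] q(2) s(2) chr_0[OF x] by auto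
  have "(x', y') \<in> gr v \<and> x' e \<noteq> 0" if g': "(x', y') \<in> gr (v * s)" for x' y'
  proof -
    have d': "x' \<in> dom (v * s)" using g' gr_iff by auto
    have "x' s = 1" by (rule dom_restrictD(1)[OF v N(1) s(1) d'])
    then have "x' q = 1" using chr_mult[OF dom_chr[OF d'] Q_DD[OF q(1)] Q_DD[OF s(1)]] qs by simp
    then have "x' e \<noteq> 0" using q(3)[OF dom_chr[OF d']] unfolding W_def by simp
    then show ?thesis using gr_restrict_subset[OF v N(1) s(1)] g' by blast
  qed
  then show thesis using that s by blast
qed

lemma subspaces_imp_graded:
  fixes An :: "nat \<Rightarrow> 'a set"
  assumes sub: "\<And>n. csubspace ii (An n)" and cl: "\<And>n. closed (An n)" and AnA: "\<And>n. An n \<subseteq> A"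
    and An0: "An 0 = DD" and dj: "\<And>n k. n \<noteq> k \<Longrightarrow> An n \<inter> An k = {0}"
    and prod: "\<And>n k. prod_span ii (An n) (An k) \<subseteq> An (n + k)"
    and dense: "closure (cspan ii (\<Union>n. An n)) = A"
  shows "graded (\<lambda>n. {(x, y). \<exists>m. \<exists>v\<in>V m. \<exists>a\<in>An n. (x, y) \<in> gr v \<and> ev v x a \<noteq> 0})" (is "graded ?S")
proof -
  have mult: "s * t \<in> An (n + k)" if "s \<in> An n" "t \<in> An k" for s t n k
  proof -
    have "s * t \<in> prod_span ii (An n) (An k)" unfolding prod_span_def
      by (rule subsetD[OF closure_subset], rule cspan_base) (use that in blast)
    then show ?thesis using prod by blast
  qed
  have AnB: "a \<in> BB" if "a \<in> An n" for a n using that AnA A_BB by blast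
  \<comment> \<open>\<open>An n\<close> is a bimodule over \<open>An 0\<close>, the diagonal. Since
    \<open>v * q * st v\<close> and \<open>q\<close> are diagonal, each term of the pinched sum
    stays in \<open>An n\<close>, although \<open>v\<close> itself need not lie in any of the
    subspaces.\<close>
  have piece: "v * E (st v * a) \<in> An n" if v: "v \<in> V m" and a: "a \<in> An n" for v a m n
  proof (rule closed_sequentially[OF cl])
    show "(\<lambda>N. v * EN N (st v * a)) \<longlonglongrightarrow> v * E (st v * a)"
      by (intro tendsto_mult tendsto_const EN_tendsto stV_mult_BB[OF v] AnB[OF a])
    show "v * EN N (st v * a) \<in> An n" for N
      unfolding EN_def sum_distrib_left
    proof (rule csubspace_sum[OF sub])
      fix q assume q: "q \<in> Q N"
      have "v * q * st v \<in> An 0" unfolding An0 using DD_conj[OF Q_DD[OF q] V_st[OF v]] by simp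
      then have "v * q * st v * a \<in> An n" using mult[of _ 0 a n] a by simp
      then have "v * q * st v * a * q \<in> An n" using mult[of _ n q 0] Q_DD[OF q] An0 by simp
      then show "v * (q * (st v * a) * q) \<in> An n" by (simp only: mult.assoc)
    qed
  qed
  have inS: "(x, y) \<in> ?S n \<longleftrightarrow> (\<exists>m. \<exists>v\<in>V m. \<exists>a\<in>An n. (x, y) \<in> gr v \<and> ev v x a \<noteq> 0)" for x y n by simp
  show ?thesis unfolding graded_def
  proof (intro conjI allI impI)
    fix n
    show "openin RT (?S n)" unfolding openin_RT
    proof (intro conjI ballI)
      show "?S n \<subseteq> R" using gr_R by blast
      fix p assume p: "p \<in> ?S n"
      obtain x y where xy: "p = (x, y)" by fastforce
      from p obtain m v a where v: "v \<in> V m" and a: "a \<in> An n" and g: "(x, y) \<in> gr v" and nz: "ev v x a \<noteq> 0"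
        unfolding xy inS by blast
      have "x (E (st v * a)) \<noteq> 0" using nz unfolding ev_def .
      from gr_local[OF v g Ev_DD[OF v AnB[OF a]] this]
      obtain N s where s: "v * s \<in> V N" "(x, y) \<in> gr (v * s)"
        "\<And>x' y'. (x', y') \<in> gr (v * s) \<Longrightarrow> (x', y') \<in> gr v \<and> x' (E (st v * a)) \<noteq> 0" by metis
      have "gr (v * s) \<subseteq> ?S n"
      proof
        fix p' assume p': "p' \<in> gr (v * s)"
        obtain x' y' where xy': "p' = (x', y')" by fastforce
        have "(x', y') \<in> gr v" "ev v x' a \<noteq> 0" using s(3) p' unfolding xy' ev_def by blast+
        then show "p' \<in> ?S n" unfolding xy' inS using v a by blast
      qed
      moreover have "v * s \<in> VV" using s(1) unfolding VV_def by blast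
      ultimately show "\<exists>v\<in>VV. p \<in> gr v \<and> gr v \<subseteq> ?S n" using s(2) xy by blast
    qed
  next
    show "(\<Union>n. ?S n) = P"
    proof (intro equalityI subsetI)
      fix p assume "p \<in> (\<Union>n. ?S n)"
      then obtain n where p: "p \<in> ?S n" by blast
      obtain x y where xy: "p = (x, y)" by fastforce
      from p obtain m v a where v: "v \<in> V m" and a: "a \<in> An n" and g: "(x, y) \<in> gr v" and nz: "ev v x a \<noteq> 0"
        unfolding xy inS by blast
      have "x \<in> dom v" "y = mp v x" using g gr_iff by auto
      then show "p \<in> P" using ev_A[of a v m x] a AnA v nz xy by blast
    next
      fix p assume p: "p \<in> P"
      obtain x y where xy: "p = (x, y)" by fastforce
      obtain m v where v: "v \<in> V m" "v \<in> A" "(x, y) \<in> gr v" using PE[OF p] xy by metis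
      have x: "x \<in> dom v" "y = mp v x" using v(3) gr_iff by auto
      show "p \<in> (\<Union>n. ?S n)"
      proof (rule ccontr)
        \<comment> \<open>If no \<open>An n\<close> has a coefficient at this point, neither has the
          closed span of all of them; but that span contains \<open>v\<close>, whose coefficient
          there is 1.\<close>
        assume "p \<notin> (\<Union>n. ?S n)"
        then have 0: "ev v x a = 0" if "a \<in> An n" for a n using that v xy by blast
        have "closure (cspan ii (\<Union>n. An n)) \<subseteq> {b \<in> BB. ev v x b = 0}"
          by (intro closed_cspan_minimal csubspace_ev_0[OF v(1)] closed_ev_0[OF v(1)] dom_chr[OF x(1)])
             (use 0 AnB in blast)
        then have "ev v x v = 0" using v(2) dense by blast
        moreover have "ev v x v = 1" using ev_V[OF v(1) v(1) x(1)] v(3) x(2) by simp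
        ultimately show False by simp
      qed
    qed
  next
    fix n k :: nat assume nk: "n \<noteq> k"
    show "?S n \<inter> ?S k = {}"
    proof (rule ccontr)
      assume "?S n \<inter> ?S k \<noteq> {}"
      then obtain p where p: "p \<in> ?S n" "p \<in> ?S k" by blast
      obtain x y where "p = (x, y)" by fastforce
      with p obtain m v a m' w b where v: "v \<in> V m" "a \<in> An n" "(x, y) \<in> gr v" "ev v x a \<noteq> 0"
        and w: "w \<in> V m'" "b \<in> An k" "(x, y) \<in> gr w" "ev w x b \<noteq> 0" unfolding inS by blast
      have x: "x \<in> dom v" using v(3) gr_iff by auto
      have nzb: "ev v x b \<noteq> 0" using ev_cong[OF v(1) w(1) AnB[OF w(2)] v(3) w(3)] w(4) by simp
      let ?a = "E (st v * a)" and ?b = "E (st v * b)"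
      have D: "?a \<in> DD" "?b \<in> DD" using Ev_DD[OF v(1)] AnB v(2) w(2) by blast+
      \<comment> \<open>Multiplied by the diagonal factor of the other, the two pieces become one
        element lying in both \<open>An n\<close> and \<open>An k\<close>. Its coefficient at
        \<open>x\<close> is the product of the two nonzero values.\<close>
      have "v * ?a * ?b \<in> An n" using mult[OF piece[OF v(1,2)], of ?b 0] D An0 by simp
      moreover have "v * ?b * ?a \<in> An k" using mult[OF piece[OF v(1) w(2)], of ?a 0] D An0 by simp
      moreover have "v * ?b * ?a = v * ?a * ?b" using DD_comm[OF D] by (simp only: mult.assoc)
      ultimately have "v * ?a * ?b = 0" using dj[OF nk] by auto
      then have "ev v x (v * (?a * ?b)) = 0" using ev_0[OF dom_chr[OF x]] by (simp add: mult.assoc)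
      then have "x ?a * x ?b = 0"
        using ev_mult_V_DD[OF v(1) x DD_mult[OF D]] chr_mult[OF dom_chr[OF x] D] by simp
      then show False using v(4) nzb unfolding ev_def by simp
    qed
  next
    show "?S 0 = {(x, x) |x. chr x}"
    proof (intro equalityI subsetI)
      fix p assume p: "p \<in> ?S 0"
      obtain x y where xy: "p = (x, y)" by fastforce
      from p obtain m v a where v: "v \<in> V m" and a: "a \<in> DD" and g: "(x, y) \<in> gr v" and nz: "ev v x a \<noteq> 0"
        unfolding xy inS An0 by blast
      have "x \<in> dom v" "y = mp v x" using g gr_iff by auto
      moreover have "a \<in> BB" using a DD_BB by blast
      ultimately have "(x, y) \<in> Id" using DD_iff_support[of a] a v nz by blast
      then show "p \<in> {(x, x) |x. chr x}" using xy gr_chr(1)[OF v g] by simp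
    next
      fix p assume "p \<in> {(x, x) |x. chr x}"
      then obtain x where x: "p = (x, x)" "chr x" by blast
      obtain n q where q: "q \<in> Q n" "x q = 1" using chr_Q_exists[OF x(2)] .
      have g: "(x, x) \<in> gr q" using gr_Q[OF q(1)] x q by blast
      moreover have "ev q x q = 1" using ev_V[OF Q_V[OF q(1)] Q_V[OF q(1)]] g gr_iff by metis
      ultimately show "p \<in> ?S 0" unfolding x(1) inS An0 using Q_V[OF q(1)] Q_DD[OF q(1)] by force
    qed
  next
    fix n k x y z assume "(x, y) \<in> ?S n" "(y, z) \<in> ?S k"
    then obtain m v' a m' w' b where v': "v' \<in> V m" "a \<in> An n" "(x, y) \<in> gr v'" "ev v' x a \<noteq> 0"
      and w': "w' \<in> V m'" "b \<in> An k" "(y, z) \<in> gr w'" "ev w' y b \<noteq> 0" unfolding inS by blast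
    obtain N v w where vw: "v \<in> V N" "w \<in> V N" "(x, y) \<in> gr v" "(y, z) \<in> gr w"
      using R_level[OF gr_R[OF v'(1,3)] gr_R[OF w'(1,3)]] .
    let ?a = "E (st v * a)" and ?b = "E (st w * b)"
    have nz: "x ?a \<noteq> 0" "y ?b \<noteq> 0"
      using ev_cong[OF v'(1) vw(1) AnB[OF v'(2)] v'(3) vw(3)] v'(4)
        ev_cong[OF w'(1) vw(2) AnB[OF w'(2)] w'(3) vw(4)] w'(4) unfolding ev_def by auto
    have D: "?a \<in> DD" "?b \<in> DD" using Ev_DD vw AnB v'(2) w'(2) by blast+
    have x: "x \<in> dom v" "y = mp v x" "y \<in> dom w" using vw gr_iff by auto
    have D': "st w * w * ?b \<in> DD" using DD_mult source_DD[OF vw(2)] D by blast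
    have D'': "st v * (st w * w * ?b) * v \<in> DD" by (rule DD_conj[OF D' vw(1)])
    \<comment> \<open>The first arrow acts on the right, so the factors come in the order k, n; the
      coefficient of the product at \<open>(x, z)\<close> is the product of those of the two
      arrows.\<close>
    have "(w * ?b) * (v * ?a) \<in> An (k + n)" using mult piece vw(1,2) v'(2) w'(2) by blast
    moreover have "ev (w * v) x ((w * ?b) * (v * ?a)) = y ?b * x ?a"
    proof -
      have e: "st (w * v) * ((w * ?b) * (v * ?a)) = st v * (st w * w * ?b) * v * ?a"
        by (simp only: st_mult mult.assoc)
      have "x (st v * (st w * w * ?b) * v) = y ?b"
        using mp_apply[OF D', of v x] x(2) chr_mult[OF dom_chr[OF x(3)] source_DD[OF vw(2)] D(2)] dom_source[OF x(3)] by simp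
      then show ?thesis unfolding ev_def e E_id[OF DD_mult[OF D'' D(1)]]
        using chr_mult[OF dom_chr[OF x(1)] D'' D(1)] by simp
    qed
    ultimately show "(x, z) \<in> ?S (n + k)" unfolding inS
      using gr_mult[OF vw] nz by (metis add.commute mult_eq_0_iff)
  qed
qed

end

section \<open>The spectral subspaces of a cocycle\<close>

context taf_cocycle begin

text \<open>The cocycle is locally constant and the source of \<open>v\<close> is compact, so one
  sufficiently deep level makes it constant on the graph of every cut.\<close>

lemma zc_refine:
  assumes v: "v \<in> V n"
  obtains M where "M \<ge> n" "\<And>N q. N \<ge> M \<Longrightarrow> q \<in> Q N \<Longrightarrow> v * q = 0 \<or> v * q \<in> V N \<and> (\<exists>c. \<forall>p\<in>gr (v * q). d p = c)"
proof -
  define C where "C q \<longleftrightarrow> (\<exists>c. \<forall>p\<in>gr (v * q). d p = c)" for q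
  have her: "C q'" if "n \<le> N" "N \<le> M" "q \<in> Q N" "q' \<in> Q M" "q * q' = q'" "C q" for N M q q'
  proof -
    have e: "v * q' = v * q * q'" using that(5) by (simp add: mult.assoc)
    from V_restrict[OF v that(1,3)] have "gr (v * q') \<subseteq> gr (v * q)"
    proof
      assume "v * q = 0" then show ?thesis unfolding e by simp
    next
      assume "v * q \<in> V N" then show ?thesis unfolding e by (rule gr_restrict_subset[OF _ that(2,4)])
    qed
    then show ?thesis using that(6) unfolding C_def by blast
  qed
  obtain M where M: "M \<ge> n" "\<And>N q. N \<ge> M \<Longrightarrow> q \<in> Q N \<Longrightarrow> st v * v * q = q \<Longrightarrow> C q"
  \<comment> \<open>Constancy \<open>C\<close> passes to finer projections only from level n on. The
    property handed to \<open>compactness\<close> therefore asks for an ancestor of level at least n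
    with \<open>C\<close>, which is inherited between any two levels.\<close>
  proof (rule compactness[OF V_source[OF v], of "\<lambda>q. \<exists>N\<ge>n. \<exists>p\<in>Q N. p * q = q \<and> C p"])
    fix x assume x: "chr x" "x (st v * v) = 1"
    then have xv: "x \<in> dom v" "(x, mp v x) \<in> gr v" unfolding gr_iff dom_def by auto
    obtain m w where w: "w \<in> V m" "(x, mp v x) \<in> gr w" "\<And>p'. p' \<in> gr w \<Longrightarrow> d p' = d (x, mp v x)"
      using zc_locally_constant[OF gr_R[OF v xv(2)]] by metis
    define N where "N = max n m"
    have N: "n \<le> N" "m \<le> N" unfolding N_def by auto
    obtain q where q: "q \<in> Q N" "x q = 1" using gr_restrict[OF v N(1) xv(2)] by metis
    have "gr (v * q) \<subseteq> gr w"
      using gr_common(1)[OF v w(1) N q xv(2) w(2)] gr_restrict_subset[OF w(1) N(2) q(1)] by simp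
    then have "C q" unfolding C_def using w(3) by blast
    then have "x q = 1 \<and> (\<exists>N\<ge>n. \<exists>p\<in>Q N. p * q = q \<and> C p)" using q N(1) Q_idem[OF q(1)] by blast
    then show "\<exists>N\<ge>n. \<exists>q\<in>Q N. x q = 1 \<and> (\<exists>N\<ge>n. \<exists>p\<in>Q N. p * q = q \<and> C p)" using q(1) N(1) by blast
  next
    fix N M q q' assume "N \<le> M" "q \<in> Q N" "q' \<in> Q M" "q * q' = q'" "\<exists>N\<ge>n. \<exists>p\<in>Q N. p * q = q \<and> C p"
    then obtain K p where "K \<ge> n" "p \<in> Q K" "p * q = q" "C p" by blast
    moreover have "p * q' = q'" using \<open>q * q' = q'\<close> \<open>p * q = q\<close> by (metis mult.assoc)
    ultimately show "\<exists>N\<ge>n. \<exists>p\<in>Q N. p * q' = q' \<and> C p" by blast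
  next
    fix M assume th: "\<And>M. n \<le> M \<Longrightarrow> (\<And>N q. M \<le> N \<Longrightarrow> q \<in> Q N \<Longrightarrow> st v * v * q = q \<Longrightarrow> C q) \<Longrightarrow> thesis"
      and nM: "n \<le> M" and M: "\<And>N q. M \<le> N \<Longrightarrow> q \<in> Q N \<Longrightarrow> st v * v * q = q \<Longrightarrow> \<exists>N\<ge>n. \<exists>p\<in>Q N. p * q = q \<and> C p"
    show thesis
    proof (rule th[OF nM])
      fix N q assume N: "M \<le> N" and q: "q \<in> Q N" "st v * v * q = q"
      obtain K p where K: "K \<ge> n" "p \<in> Q K" "p * q = q" "C p" using M[OF N q] by blast
      show "C q"
      proof (cases "K \<le> N")
        case True
        then show ?thesis using her[OF K(1) True K(2) q(1) K(3,4)] by blast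
      next
        case False
        \<comment> \<open>Here \<open>p\<close> has a deeper level than \<open>q\<close> and yet
          lies above it, so the two coincide.\<close>
        have "q * p = p"
          using Q_le[OF q(1) _ K(2)] False Q_comm[OF K(2) q(1)] K(3) Q_nonzero[OF q(1)] by fastforce
        then have "p = q" using K(3) Q_comm[OF K(2) q(1)] by simp
        then show ?thesis using K(4) by simp
      qed
    qed
  qed
  show thesis
  proof (rule that[OF M(1)])
    fix N q assume N: "M \<le> N" and q: "q \<in> Q N"
    have nN: "n \<le> N" using M(1) N by simp
    show "v * q = 0 \<or> v * q \<in> V N \<and> (\<exists>c. \<forall>p\<in>gr (v * q). d p = c)"
    proof (cases rule: V_restrict_cases[OF v nN q])
      case 2
      then show ?thesis using M(2)[OF N q] unfolding C_def by blast
    qed simp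
  qed
qed

text \<open>Elements supported on the level set of degree n, written as a span in the form used by
  synthesis.\<close>

definition An :: "nat \<Rightarrow> 'a set" where "An n = closure (cspan ii {v \<in> VV. gr v \<subseteq> {p. d p = real n}})"

lemma csubspace_An: "csubspace ii (An n)" and closed_An: "closed (An n)"
  unfolding An_def by (auto intro: csubspace_closure csubspace_cspan)

lemma An_A: "An n \<subseteq> A"
proof -
  have "{v \<in> VV. gr v \<subseteq> {p. d p = real n}} \<subseteq> {v \<in> VV. gr v \<subseteq> P}"
    unfolding zc_P_eq R_def by auto
  then show ?thesis unfolding An_def A_support[symmetric]
    by (subst A_support) (intro closure_mono cspan_mono)
qed

lemma An_0: "An 0 = DD"
proof -
  have "gr v \<subseteq> {p. d p = 0} \<longleftrightarrow> gr v \<subseteq> Id" if "v \<in> VV" for v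
  proof -
    have "d p = 0 \<longleftrightarrow> p \<in> Id" if "p \<in> gr v" for p
    proof -
      obtain x y where xy: "p = (x, y)" by fastforce
      have "(x, y) \<in> R" using that \<open>v \<in> VV\<close> xy unfolding R_def by blast
      then show ?thesis using zc_0 zc_refl R_chr xy by auto
    qed
    then show ?thesis by blast
  qed
  then have e: "{v \<in> VV. gr v \<subseteq> {p. d p = real 0}} = {v \<in> VV. gr v \<subseteq> Id}" by auto
  show ?thesis unfolding An_def e by (rule DD_support[symmetric])
qed

text \<open>Two level sets are disjoint, so every coefficient of a common element vanishes.\<close>

lemma An_disjoint: assumes "n \<noteq> k" shows "An n \<inter> An k = {0}"
proof
  show "{0} \<subseteq> An n \<inter> An k" using csubspace_An unfolding csubspace_def by blast
  show "An n \<inter> An k \<subseteq> {0}"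
  proof
    fix b assume b: "b \<in> An n \<inter> An k"
    then have "b \<in> BB" using An_A A_BB by blast
    then have "b = 0"
    proof (rule ev_eq_0_imp_0)
      fix m v x assume v: "v \<in> V m" "x \<in> dom v"
      have "(x, mp v x) \<notin> {p. d p = real n} \<or> (x, mp v x) \<notin> {p. d p = real k}" using assms by auto
      then show "ev v x b = 0" using b closure_imp_support v unfolding An_def by blast
    qed
    then show "b \<in> {0}" by simp
  qed
qed

text \<open>Both factors are cut at a common level, where a nonzero product of matrix units is a
  matrix unit whose graph composes the two graphs; degrees then add.\<close>

lemma An_prod: "prod_span ii (An n) (An k) \<subseteq> An (n + k)"
  unfolding prod_span_def
proof (rule closed_cspan_minimal[OF csubspace_An closed_An], clarify)
  fix s t assume "s \<in> An n" "t \<in> An k"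
  then show "s * t \<in> An (n + k)"
    unfolding An_def[of n] An_def[of k]
  proof (rule closed_cspan_mult[OF csubspace_An closed_An, rotated])
    fix v w assume "v \<in> {v \<in> VV. gr v \<subseteq> {p. d p = real n}}" "w \<in> {v \<in> VV. gr v \<subseteq> {p. d p = real k}}"
    then obtain i j where v: "v \<in> V i" "gr v \<subseteq> {p. d p = real n}" and w: "w \<in> V j" "gr w \<subseteq> {p. d p = real k}"
      unfolding VV_def by blast
    define N where "N = max i j"
    have N: "i \<le> N" "j \<le> N" unfolding N_def by auto
    have "v * w = (\<Sum>q\<in>Q N. v * q) * (\<Sum>q\<in>Q N. w * q)" using V_sum v(1) w(1) N by simp
    also have "\<dots> = (\<Sum>q\<in>Q N. \<Sum>q'\<in>Q N. v * q * (w * q'))" by (rule sum_product)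
    also have "\<dots> \<in> An (n + k)"
    proof (intro csubspace_sum[OF csubspace_An])
      fix q q' assume q: "q \<in> Q N" "q' \<in> Q N"
      let ?v = "v * q" and ?w = "w * q'"
      have 0: "0 \<in> An (n + k)" using csubspace_An unfolding csubspace_def by blast
      show "?v * ?w \<in> An (n + k)"
      proof (cases "?v * ?w = 0")
        case False
        then have vw: "?v \<in> V N" "?w \<in> V N"
          using V_restrict[OF v(1) N(1) q(1)] V_restrict[OF w(1) N(2) q(2)] by auto
        note nz = V_mult_nonzero[OF vw False]
        have "gr (?v * ?w) \<subseteq> {p. d p = real (n + k)}"
        proof
          fix p assume p: "p \<in> gr (?v * ?w)"
          obtain x z where xz: "p = (x, z)" by fastforce
          have x: "x \<in> dom (?v * ?w)" "z = mp (?v * ?w) x" using p xz gr_iff by auto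
          have xw: "x \<in> dom ?w" using x(1) nz(3) unfolding dom_def by simp
          define y where "y = mp ?w x"
          have "y \<in> dom ?v" using mp_dom_st[OF vw(2) xw] nz(2) unfolding dom_def y_def by simp
          then have g: "(x, y) \<in> gr ?w" "(y, mp ?v y) \<in> gr ?v" unfolding gr_iff using xw y_def by auto
          have "mp ?v y = z" using gr_mult(2)[OF vw(2,1) g] x(2) gr_iff by metis
          then have "d (x, z) = d (x, y) + d (y, z)"
            using zc_add gr_R[OF vw(2) g(1)] gr_R[OF vw(1) g(2)] by simp
          moreover have "d (x, y) = real k" using g(1) gr_restrict_subset[OF w(1) N(2) q(2)] w(2) by blast
          moreover have "d (y, z) = real n" using g(2) gr_restrict_subset[OF v(1) N(1) q(1)] v(2) \<open>mp ?v y = z\<close> by blast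
          ultimately show "p \<in> {p. d p = real (n + k)}" unfolding xz by simp
        qed
        then have "?v * ?w \<in> {v \<in> VV. gr v \<subseteq> {p. d p = real (n + k)}}" using nz(1) unfolding VV_def by blast
        then show ?thesis unfolding An_def by (rule subsetD[OF closure_subset, OF cspan_base])
      qed (use 0 in simp)
    qed
    finally show "v * w \<in> An (n + k)" .
  qed
qed

text \<open>By \<open>zc_refine\<close> a matrix unit of \<open>A\<close> is a finite sum of cuts of
  constant degree, and the degrees are nonnegative because the graphs lie in P.\<close>

lemma An_dense: "closure (cspan ii (\<Union>n. An n)) = A"
proof
  show "closure (cspan ii (\<Union>n. An n)) \<subseteq> A"
    by (intro closed_cspan_minimal csubspace_A closed_A) (use An_A in blast)
  have "VV \<inter> A \<subseteq> closure (cspan ii (\<Union>n. An n))"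
  proof
    fix v assume "v \<in> VV \<inter> A"
    then obtain n where v: "v \<in> V n" "v \<in> A" unfolding VV_def by blast
    obtain M where M: "M \<ge> n" "\<And>N q. N \<ge> M \<Longrightarrow> q \<in> Q N \<Longrightarrow> v * q = 0 \<or> v * q \<in> V N \<and> (\<exists>c. \<forall>p\<in>gr (v * q). d p = c)"
      using zc_refine[OF v(1)] by metis
    have "(\<Sum>q\<in>Q M. v * q) \<in> cspan ii (\<Union>n. An n)"
    proof (rule csubspace_sum[OF csubspace_cspan])
      fix q assume q: "q \<in> Q M"
      have 0: "0 \<in> cspan ii (\<Union>n. An n)" using csubspace_cspan unfolding csubspace_def by blast
      show "v * q \<in> cspan ii (\<Union>n. An n)"
      proof (cases "v * q = 0")
        case False
        then obtain c where vq: "v * q \<in> V M" and c: "\<forall>p\<in>gr (v * q). d p = c" using M(2)[OF order_refl q] by blast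
        obtain x where x: "(x, mp (v * q) x) \<in> gr (v * q)" using VV_nonempty_graph[OF vq] .
        have "(x, mp (v * q) x) \<in> gr v" using x gr_restrict_subset[OF v(1) M(1) q] by blast
        then have "(x, mp (v * q) x) \<in> P" using P_iff[OF v(1)] v(2) by blast
        then have "d (x, mp (v * q) x) \<ge> 0" unfolding zc_P_eq by simp
        then have c0: "c \<ge> 0" using bspec[OF c x] by simp
        obtain k :: int where "d (x, mp (v * q) x) = of_int k" using zc_int[OF gr_R[OF vq x]] by blast
        then have "c = real (nat k)" using bspec[OF c x] c0 by simp
        then have "v * q \<in> {v \<in> VV. gr v \<subseteq> {p. d p = real (nat k)}}" using c vq unfolding VV_def by blast
        then have "v * q \<in> An (nat k)" unfolding An_def by (rule subsetD[OF closure_subset, OF cspan_base])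
        then show ?thesis by (intro cspan_base) blast
      qed (use 0 in simp)
    qed
    then show "v \<in> closure (cspan ii (\<Union>n. An n))"
      using V_sum[OF v(1) M(1)] by (metis closure_subset subsetD)
  qed
  then have "closure (cspan ii (VV \<inter> A)) \<subseteq> closure (cspan ii (\<Union>n. An n))"
    by (intro closed_cspan_minimal csubspace_closure csubspace_cspan) auto
  then show "A \<subseteq> closure (cspan ii (\<Union>n. An n))" using A_gen by blast
qed

end

section \<open>From a cocycle to a circle action\<close>

lemma integral_cis:
  fixes k :: int
  shows "((\<lambda>t. cis (2 * pi * of_int k * t)) has_integral (if k = 0 then 1 else 0)) {0..1::real}"
proof (cases "k = 0")
  case True
  then show ?thesis using has_integral_const_real[of "1::complex" 0 1] by simp
next
  case False
  define c where "c = 2 * pi * of_int k"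
  have c: "c \<noteq> 0" using False unfolding c_def by simp
  have "((\<lambda>t. cis (c * t)) has_integral (cis (c * 1) / (\<i> * c) - cis (c * 0) / (\<i> * c))) {0..1::real}"
  proof (rule fundamental_theorem_of_calculus)
    fix t :: real
    have "((\<lambda>z. exp (\<i> * c * z) / (\<i> * c)) has_field_derivative exp (\<i> * c * of_real t)) (at (of_real t))"
      using c by (auto intro!: derivative_eq_intros)
    then have "((\<lambda>z. exp (\<i> * c * of_real z) / (\<i> * c)) has_vector_derivative exp (\<i> * c * of_real t)) (at t within {0..1})"
      using field_vector_diff_chain_within[OF has_vector_derivative_of_real[OF DERIV_ident], of "\<lambda>z. exp (\<i> * c * z) / (\<i> * c)"]
      by (auto intro: has_vector_derivative_at_within dest: has_vector_derivative_real_field)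
    then show "((\<lambda>t. cis (c * t) / (\<i> * c)) has_vector_derivative cis (c * t)) (at t within {0..1})"
      by (simp add: cis_conv_exp mult.assoc)
  qed simp
  moreover have "cis (c * 1) = 1" unfolding c_def using cis_multiple_2pi[of "of_int k"] by (simp add: mult.assoc)
  ultimately show ?thesis using False unfolding c_def by simp
qed

lemma cis_int_eq: assumes "\<And>t. cis (2 * pi * of_int k * t) = cis (2 * pi * of_int l * t)" shows "k = (l::int)"
proof (rule ccontr)
  assume "k \<noteq> l"
  then have "real_of_int (k - l) \<noteq> 0" by simp
  \<comment> \<open>Chosen so that the quotient of the two sides is \<open>cis pi\<close>, that is
    -1.\<close>
  define t where "t = 1 / (2 * real_of_int (k - l))"
  have "cis (2 * pi * of_int k * t) / cis (2 * pi * of_int l * t) = cis (2 * pi * of_int k * t - 2 * pi * of_int l * t)"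
    by (rule cis_divide)
  also have "2 * pi * of_int k * t - 2 * pi * of_int l * t = pi * (2 * real_of_int (k - l) * t)"
    by (simp add: algebra_simps)
  also have "2 * real_of_int (k - l) * t = 1" unfolding t_def using \<open>real_of_int (k - l) \<noteq> 0\<close> by (simp del: of_int_diff)
  finally have "cis (2 * pi * of_int k * t) / cis (2 * pi * of_int l * t) = -1" by simp
  then show False using assms[of t] by simp
qed

text \<open>A functional on a closed subspace need not extend to the whole space here, so integration is
  compared through common tagged divisions.\<close>
lemma integral_functional:
  fixes f :: "real \<Rightarrow> 'a::{real_normed_algebra_1,banach}" and \<phi> :: "'a \<Rightarrow> complex"
  assumes f: "continuous_on {0..1} f" and fS: "\<And>t. t \<in> {0..1} \<Longrightarrow> f t \<in> S"
    and S: "csubspace ii S" "closed S"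
    and add: "\<And>a b. a \<in> S \<Longrightarrow> b \<in> S \<Longrightarrow> \<phi> (a + b) = \<phi> a + \<phi> b"
    and scl: "\<And>r a. a \<in> S \<Longrightarrow> \<phi> (r *\<^sub>R a) = r *\<^sub>R \<phi> a"
    and bd: "\<And>a. a \<in> S \<Longrightarrow> cmod (\<phi> a) \<le> norm a"
  shows "integral {0..1} f \<in> S" "\<phi> (integral {0..1} f) = integral {0..1} (\<lambda>t. \<phi> (f t))"
proof -
  have diff: "\<phi> (a - b) = \<phi> a - \<phi> b" if "a \<in> S" "b \<in> S" for a b
    using add[OF csubspace_diff[OF S(1) that] that(2)] by simp
  have cphi: "continuous_on {0..1} (\<lambda>t. \<phi> (f t))"
    unfolding continuous_on_iff
  proof (intro ballI allI impI)
    fix t e :: real assume t: "t \<in> {0..1}" and e: "0 < e"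
    then obtain s where s: "s > 0" "\<And>t'. t' \<in> {0..1} \<Longrightarrow> dist t' t < s \<Longrightarrow> dist (f t') (f t) < e"
      using f unfolding continuous_on_iff by metis
    have "dist (\<phi> (f t')) (\<phi> (f t)) \<le> dist (f t') (f t)" if "t' \<in> {0..1}" for t'
      using bd[OF csubspace_diff[OF S(1) fS[OF that] fS[OF t]]] diff[OF fS[OF that] fS[OF t]] by (simp add: dist_norm)
    then show "\<exists>s>0. \<forall>t'\<in>{0..1}. dist t' t < s \<longrightarrow> dist (\<phi> (f t')) (\<phi> (f t)) < e"
      using s by (meson order_le_less_trans)
  qed
  let ?y = "integral {0..1} f" and ?z = "integral {0..1} (\<lambda>t. \<phi> (f t))"
  have hf: "(f has_integral ?y) (cbox 0 1)" and hz: "((\<lambda>t. \<phi> (f t)) has_integral ?z) (cbox 0 1)"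
    using integrable_continuous_real[OF f] integrable_continuous_real[OF cphi] by (auto simp: integrable_integral)
  have S0: "0 \<in> S" using S(1) unfolding csubspace_def by blast
  have phi_sum: "sum g I \<in> S \<and> \<phi> (sum g I) = (\<Sum>i\<in>I. \<phi> (g i))" if "\<And>i. i \<in> I \<Longrightarrow> g i \<in> S"
    for g :: "(real \<times> real set) \<Rightarrow> 'a" and I
    using that
  proof (induction I rule: infinite_finite_induct)
    case (insert i I)
    then show ?case using add[of "g i" "sum g I"] S(1) unfolding csubspace_def by auto
  qed (use S0 scl[OF S0, of 0] in auto)
  have approx: "\<exists>s\<in>S. norm (s - ?y) < e \<and> cmod (\<phi> s - ?z) < e" if e: "e > 0" for e
  proof -
    obtain g1 where g1: "gauge g1" "\<And>p. p tagged_division_of (cbox 0 1) \<Longrightarrow> g1 fine p \<Longrightarrow>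
        norm ((\<Sum>(x, k)\<in>p. measure lborel k *\<^sub>R f x) - ?y) < e" using hf e unfolding has_integral by metis
    obtain g2 where g2: "gauge g2" "\<And>p. p tagged_division_of (cbox 0 1) \<Longrightarrow> g2 fine p \<Longrightarrow>
        norm ((\<Sum>(x, k)\<in>p. measure lborel k *\<^sub>R \<phi> (f x)) - ?z) < e" using hz e unfolding has_integral by metis
    obtain p where p: "p tagged_division_of cbox (0::real) 1" "(\<lambda>x. g1 x \<inter> g2 x) fine p"
      using fine_division_exists[OF gauge_Int[OF g1(1) g2(1)]] .
    let ?s = "\<Sum>(x, k)\<in>p. measure lborel k *\<^sub>R f x"
    have fp: "f x \<in> S" if "(x, k) \<in> p" for x k
      using tag_in_interval[OF p(1) that] fS by simp
    have "?s \<in> S \<and> \<phi> ?s = (\<Sum>i\<in>p. \<phi> (case i of (x, k) \<Rightarrow> measure lborel k *\<^sub>R f x))"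
      by (rule phi_sum) (use fp csubspace_scaleR[OF S(1)] in auto)
    moreover have "(\<Sum>i\<in>p. \<phi> (case i of (x, k) \<Rightarrow> measure lborel k *\<^sub>R f x)) = (\<Sum>(x, k)\<in>p. measure lborel k *\<^sub>R \<phi> (f x))"
      by (intro sum.cong refl) (use fp scl in auto)
    ultimately show ?thesis using g1(2)[OF p(1)] g2(2)[OF p(1)] p(2) unfolding fine_Int by auto
  qed
  have "?y \<in> closure S" unfolding closure_approachable dist_norm using approx by blast
  then show y: "?y \<in> S" using S(2) by simp
  show "\<phi> ?y = ?z"
  proof (rule ccontr)
    assume "\<phi> ?y \<noteq> ?z"
    then obtain s where s: "s \<in> S" "norm (s - ?y) < cmod (\<phi> ?y - ?z) / 2" "cmod (\<phi> s - ?z) < cmod (\<phi> ?y - ?z) / 2"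
      using approx[of "cmod (\<phi> ?y - ?z) / 2"] by auto
    have "cmod (\<phi> s - \<phi> ?y) < cmod (\<phi> ?y - ?z) / 2"
      using bd[OF csubspace_diff[OF S(1) s(1) y]] diff[OF s(1) y] s(2) by simp
    then have "cmod (\<phi> ?y - ?z) < cmod (\<phi> ?y - ?z)"
      using s(3) norm_triangle_sub[of "\<phi> ?y - ?z" "\<phi> s - ?z"] norm_minus_commute[of "\<phi> s" "\<phi> ?y"] by simp
    then show False by simp
  qed
qed

context taf begin

lemma ev_eqI:
  assumes "a \<in> BB" "b \<in> BB" "\<And>n v x. v \<in> V n \<Longrightarrow> x \<in> dom v \<Longrightarrow> ev v x a = ev v x b" shows "a = b"
proof -
  have "a - b = 0" by (rule ev_eq_0_imp_0[OF BB_diff[OF assms(1,2)]]) (simp add: ev_diff dom_chr assms)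
  then show ?thesis by simp
qed

lemma ev_integral:
  fixes f :: "real \<Rightarrow> 'a"
  assumes v: "v \<in> V n" and x: "chr x" and f: "continuous_on {0..1} f" and fB: "\<And>t. f t \<in> BB"
  shows "integral {0..1} f \<in> BB" "ev v x (integral {0..1} f) = integral {0..1} (\<lambda>t. ev v x (f t))"
proof -
  have s: "ev v x (r *\<^sub>R a) = r *\<^sub>R ev v x a" if "a \<in> BB" for r a
    using ev_sc[OF v x that, of "of_real r"] by (simp add: sc_of_real scaleR_conv_of_real)
  have fB': "\<And>t. t \<in> {0..1} \<Longrightarrow> f t \<in> BB" using fB by simp
  show "integral {0..1} f \<in> BB" "ev v x (integral {0..1} f) = integral {0..1} (\<lambda>t. ev v x (f t))"
    using integral_functional[where \<phi>="ev v x", OF f fB' csubspace_BB closed_BB ev_add[OF v x] s norm_ev_le[OF v x]]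
    by simp_all
qed

end

section \<open>Diagonal unitaries implementing a cocycle, and the limit of their
  conjugations\<close>

context taf_cocycle begin

text \<open>The matrix units that will be eigenvectors of the action. By refinement they still span
  \<open>BB\<close>, so closed linear conditions need checking only on them.\<close>

definition CV :: "'a set" where "CV = {v \<in> VV. \<exists>c. \<forall>p\<in>gr v. d p = c}"

lemma BB_minimal_CV:
  assumes T: "csubspace ii T" "closed T" "CV \<subseteq> T" shows "BB \<subseteq> T"
proof (rule BB_minimal[OF T(1,2)])
  fix n v assume v: "v \<in> V n"
  obtain M where M: "M \<ge> n" "\<And>N q. N \<ge> M \<Longrightarrow> q \<in> Q N \<Longrightarrow> v * q = 0 \<or> v * q \<in> V N \<and> (\<exists>c. \<forall>p\<in>gr (v * q). d p = c)"
    using zc_refine[OF v] by metis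
  have "(\<Sum>q\<in>Q M. v * q) \<in> T"
  proof (rule csubspace_sum[OF T(1)])
    fix q assume "q \<in> Q M"
    from M(2)[OF order_refl this] show "v * q \<in> T"
      using T(1,3) unfolding csubspace_def CV_def VV_def by auto
  qed
  then show "v \<in> T" using V_sum[OF v M(1)] by simp
qed

text \<open>A base projection for the block of \<open>q\<close>. The choice depends only on the set
  of projections reachable from \<open>q\<close>, so equivalent projections receive literally the
  same target.\<close>

definition target :: "nat \<Rightarrow> 'a \<Rightarrow> 'a" where
  "target n q = (SOME p. \<exists>v\<in>V n. st v * v = q \<and> v * st v = p)"

definition to_target :: "nat \<Rightarrow> 'a \<Rightarrow> 'a" where
  "to_target n q = (SOME v. v \<in> V n \<and> st v * v = q \<and> v * st v = target n q)"

lemma to_target: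
  assumes q: "q \<in> Q n"
  shows "to_target n q \<in> V n" "st (to_target n q) * to_target n q = q"
    "to_target n q * st (to_target n q) = target n q"
proof -
  have "\<exists>v\<in>V n. st v * v = q \<and> v * st v = q" 
    using Q_V[OF q] Q_st[OF q] Q_idem[OF q] by (intro bexI[of _ q]) simp_all
  then have "\<exists>v\<in>V n. st v * v = q \<and> v * st v = target n q" unfolding target_def by (rule someI)
  then have "\<exists>v. v \<in> V n \<and> st v * v = q \<and> v * st v = target n q" by blast
  from someI_ex[OF this] show "to_target n q \<in> V n" "st (to_target n q) * to_target n q = q"
    "to_target n q * st (to_target n q) = target n q" unfolding to_target_def by blast+
qed

text \<open>The same projections are reachable from the source and from the range of
  \<open>v\<close>, so the choice operator is applied to equal predicates.\<close>

lemma target_eq: assumes v: "v \<in> V n" shows "target n (st v * v) = target n (v * st v)"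
proof -
  have *: "\<exists>w'\<in>V n. st w' * w' = u * st u \<and> w' * st w' = p"
    if u: "u \<in> V n" and w: "w \<in> V n" "st w * w = st u * u" "w * st w = p" for u w p
  proof -
    have "w * st u \<noteq> 0"
    proof
      assume "w * st u = 0"
      then have "st w * (w * st u) * u = 0" by simp
      then have "(st w * w) * (st u * u) = 0" by (simp only: mult.assoc)
      then show False using w(2) Q_idem[OF V_source[OF u]] Q_nonzero[OF V_source[OF u]] by simp
    qed
    note nz = V_mult_nonzero[OF w(1) V_st[OF u] this]
    show ?thesis using nz(1) nz(3) nz(4) w(3) by (intro bexI[of _ "w * st u"]) auto
  qed
  have "(\<exists>w\<in>V n. st w * w = st v * v \<and> w * st w = p) \<longleftrightarrow> (\<exists>w\<in>V n. st w * w = v * st v \<and> w * st w = p)" for p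
    using *[OF v, of _ p] *[OF V_st[OF v], of _ p] by auto
  then show ?thesis unfolding target_def by simp
qed

text \<open>Moving along \<open>v\<close> and then to the base is moving to the base directly: both
  sides are matrix units with the same source and range.\<close>

lemma to_target_mult: assumes v: "v \<in> V n" shows "to_target n (v * st v) * v = to_target n (st v * v)"
proof -
  note a = to_target[OF V_range[OF v]] and b = to_target[OF V_source[OF v]]
  have "to_target n (v * st v) * v \<noteq> 0"
  proof
    assume "to_target n (v * st v) * v = 0"
    then have "st (to_target n (v * st v)) * (to_target n (v * st v) * v) = 0" by simp
    then have "st (to_target n (v * st v)) * to_target n (v * st v) * v = 0" by (simp only: mult.assoc)
    then have "v * st v * v = 0" unfolding a(2) .
    then show False using V_partial_isometry[OF v] V_nonzero[OF v] by (simp add: mult.assoc)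
  qed
  note nz = V_mult_nonzero[OF a(1) v this]
  show ?thesis
    by (rule V_eqI[OF nz(1) b(1)]) (simp_all only: nz(3,4) a(3) b(2,3) target_eq[OF v])
qed

lemma refine_level:
  "\<exists>M\<ge>n. \<forall>v\<in>V n. \<forall>N\<ge>M. \<forall>q\<in>Q N. v * q = 0 \<or> v * q \<in> V N \<and> (\<exists>c. \<forall>p\<in>gr (v * q). d p = c)"
proof -
  have "\<forall>v\<in>V n. \<exists>M. \<forall>N\<ge>M. \<forall>q\<in>Q N. v * q = 0 \<or> v * q \<in> V N \<and> (\<exists>c. \<forall>p\<in>gr (v * q). d p = c)"
  proof
    fix v assume v: "v \<in> V n"
    show "\<exists>M. \<forall>N\<ge>M. \<forall>q\<in>Q N. v * q = 0 \<or> v * q \<in> V N \<and> (\<exists>c. \<forall>p\<in>gr (v * q). d p = c)"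
      by (rule zc_refine[OF v]) blast
  qed
  from bchoice[OF this] obtain f where f: "\<And>v N q. v \<in> V n \<Longrightarrow> N \<ge> f v \<Longrightarrow> q \<in> Q N \<Longrightarrow> v * q = 0 \<or> v * q \<in> V N \<and> (\<exists>c. \<forall>p\<in>gr (v * q). d p = c)"
    by blast
  have "f v \<le> n + sum f (V n)" if "v \<in> V n" for v
    using member_le_sum[of v "V n" f] that finite_V by simp
  then show ?thesis using f by (intro exI[of _ "n + sum f (V n)"]) (meson le_add1 order_trans)
qed

text \<open>A level deep enough to cut every matrix unit of level n into pieces of constant degree;
  the potential is defined on projections of this level.\<close>

definition lev :: "nat \<Rightarrow> nat" where
  "lev n = (SOME M. M \<ge> n \<and> (\<forall>v\<in>V n. \<forall>N\<ge>M. \<forall>q\<in>Q N. v * q = 0 \<or> v * q \<in> V N \<and> (\<exists>c. \<forall>p\<in>gr (v * q). d p = c)))"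

lemma lev_ge: "n \<le> lev n"
  and lev: "v \<in> V n \<Longrightarrow> q \<in> Q (lev n) \<Longrightarrow> v * q \<noteq> 0 \<Longrightarrow> v * q \<in> V (lev n) \<and> (\<exists>c. \<forall>p\<in>gr (v * q). d p = c)"
  using someI_ex[OF refine_level[of n]] unfolding lev_def[symmetric] by auto

text \<open>A potential of the cocycle on the level-n equivalence relation: the value of the cocycle
  along the matrix unit that moves q to the chosen base projection of its block.\<close>
definition pot :: "nat \<Rightarrow> 'a \<Rightarrow> real" where
  "pot n q = (let p = (SOME p. p \<in> Q n \<and> p * q = q); x = (SOME x. chr x \<and> x q = 1)
     in d (x, mp (to_target n p) x))"

text \<open>The parent of \<open>q\<close> is unique and the cocycle is constant on the cut at
  \<open>q\<close>, so the choices made in \<open>pot\<close> do not matter.\<close>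

lemma pot_eq:
  assumes q: "q \<in> Q (lev n)" and p: "p \<in> Q n" "p * q = q" and x: "chr x" "x q = 1"
  shows "pot n q = d (x, mp (to_target n p) x)"
proof -
  let ?p = "SOME p. p \<in> Q n \<and> p * q = q"
  have "?p \<in> Q n \<and> ?p * q = q" by (rule someI[of _ p]) (use p in blast)
  then have pp: "?p = p" using Q_parent_unique[of ?p n p q] p Q_nonzero[OF q] by blast
  let ?x = "SOME x. chr x \<and> x q = 1"
  have x': "chr ?x \<and> ?x q = 1" by (rule someI[of _ x]) (use x in blast)
  let ?b = "to_target n p"
  note b = to_target[OF p(1)]
  have dm: "y \<in> dom ?b" if "chr y" "y q = 1" for y
    using that chr_mult[OF that(1) Q_DD[OF p(1)] Q_DD[OF q]] p(2) unfolding dom_def b(2) by simp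
  note r = mp_restrict[OF b(1) lev_ge q dm[OF x] x(2)]
  have "?b * q \<noteq> 0" using r(1) V_nonzero by blast
  then obtain c where c: "\<forall>p\<in>gr (?b * q). d p = c" using lev[OF b(1) q] by blast
  have g: "(y, mp ?b y) \<in> gr (?b * q)" if "chr y" "y q = 1" for y
    using mp_restrict[OF b(1) lev_ge q dm[OF that] that(2)] gr_iff by simp
  have "d (?x, mp ?b ?x) = c" by (rule bspec[OF c g[OF conjunct1[OF x'] conjunct2[OF x']]])
  moreover have "d (x, mp ?b x) = c" by (rule bspec[OF c g[OF x]])
  ultimately have "d (?x, mp ?b ?x) = d (x, mp ?b x)" by (rule trans[OF _ sym])
  then show ?thesis unfolding pot_def Let_def pp .
qed

text \<open>The coboundary formula: by \<open>to_target_mult\<close> the way to the base along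
  \<open>v\<close> ends where the direct way ends, and the cocycle is additive.\<close>

lemma pot_diff:
  assumes v: "v \<in> V n" and q: "q \<in> Q (lev n)" and nz: "v * q \<noteq> 0" and x: "x \<in> dom (v * q)"
  shows "pot n q = d (x, mp v x) + pot n (v * q * st (v * q))"
proof -
  have vq: "v * q \<in> V (lev n)" using lev[OF v q nz] by blast
  let ?r = "v * q * st (v * q)" and ?y = "mp v x"
  have r: "?r \<in> Q (lev n)" by (rule V_range[OF vq])
  have xq: "x q = 1" and xv: "x \<in> dom v" using dom_restrictD[OF v lev_ge q x] by auto
  have y1: "mp v x = mp (v * q) x" using mp_restrict(3)[OF v lev_ge q xv xq] by simp
  have yr: "?y ?r = 1" unfolding y1 by (rule mp_range[OF vq x])
  have src: "st v * v * q = q" using nz by (cases rule: V_restrict_cases[OF v lev_ge q]) auto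
  have "v * st v * v = v" using V_partial_isometry[OF v] by (simp add: mult.assoc)
  then have rng: "v * st v * ?r = ?r" by (metis mult.assoc)
  have p1: "pot n q = d (x, mp (to_target n (st v * v)) x)"
    by (rule pot_eq[OF q V_source[OF v] src dom_chr[OF x] xq])
  have p2: "pot n ?r = d (?y, mp (to_target n (v * st v)) ?y)"
    by (rule pot_eq[OF r V_range[OF v] rng mp_chr[OF v xv] yr])
  note b = to_target[OF V_range[OF v]]
  have g1: "(x, ?y) \<in> gr v" using xv gr_iff by blast
  have "?y \<in> dom (to_target n (v * st v))" unfolding dom_def b(2) using mp_chr[OF v xv] mp_range[OF v xv] by simp
  then have g2: "(?y, mp (to_target n (v * st v)) ?y) \<in> gr (to_target n (v * st v))" using gr_iff by blast
  have "mp (to_target n (v * st v)) ?y = mp (to_target n (st v * v)) x"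
    using gr_mult(2)[OF v b(1) g1 g2] unfolding to_target_mult[OF v] gr_iff by blast
  then show ?thesis using zc_add[OF gr_R[OF v g1] gr_R[OF b(1) g2]] p1 p2 by simp
qed

text \<open>Unitary only relative to \<open>unit (lev n)\<close>. With the minus sign, conjugation
  multiplies a cut \<open>v * q\<close> with range projection \<open>p\<close> by
  \<open>cis (2 * pi * t * (pot n q - pot n p))\<close>, whose exponent contains the value of the
  cocycle along \<open>v\<close>.\<close>

definition U :: "nat \<Rightarrow> real \<Rightarrow> 'a" where
  "U n t = (\<Sum>q\<in>Q (lev n). sc (cis (- (2 * pi * t * pot n q))) q)"

lemma norm_U_le: "norm (U n t) \<le> 1"
  unfolding U_def
  by (rule norm_orthogonal_sum_le[where p="\<lambda>q. q", OF finite_Q Q_st Q_orth]) (auto simp: Q_idem norm_sc norm_Q)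

lemma U_Q: "q \<in> Q (lev n) \<Longrightarrow> U n t * q = sc (cis (- (2 * pi * t * pot n q))) q"
proof -
  assume q: "q \<in> Q (lev n)"
  have "U n t * q = (\<Sum>p\<in>Q (lev n). if p = q then sc (cis (- (2 * pi * t * pot n q))) q else 0)"
    unfolding U_def sum_distrib_right using Q_orth[OF _ q] by (intro sum.cong refl) auto
  then show ?thesis using q finite_Q by simp
qed

lemma Q_st_U: "q \<in> Q (lev n) \<Longrightarrow> q * st (U n t) = sc (cis (2 * pi * t * pot n q)) q"
  using arg_cong[OF U_Q, of q n st t] by (simp add: st_mult st_sc Q_st cis_cnj)

lemma Q_U: "q \<in> Q (lev n) \<Longrightarrow> q * U n t = sc (cis (- (2 * pi * t * pot n q))) q"
proof -
  assume q: "q \<in> Q (lev n)"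
  have "q * U n t = (\<Sum>p\<in>Q (lev n). if p = q then sc (cis (- (2 * pi * t * pot n q))) q else 0)"
    unfolding U_def sum_distrib_left using Q_orth[OF q] by (intro sum.cong refl) auto
  then show ?thesis using q finite_Q by simp
qed

lemma st_U_U: "st (U n t) * U n t = unit (lev n)"
proof -
  have "st (U n t) = (\<Sum>q\<in>Q (lev n). sc (cis (2 * pi * t * pot n q)) q)"
    unfolding U_def st_sum by (intro sum.cong refl) (simp add: st_sc Q_st cis_cnj)
  then have "st (U n t) * U n t = (\<Sum>q\<in>Q (lev n). sc (cis (2 * pi * t * pot n q)) (q * U n t))"
    by (simp add: sum_distrib_right)
  also have "\<dots> = (\<Sum>q\<in>Q (lev n). q)"
    by (intro sum.cong refl) (simp add: Q_U cis_mult)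
  finally show ?thesis unfolding unit_def .
qed

lemma U_BB: "U n t \<in> BB"
  unfolding U_def by (intro csubspace_sum[OF csubspace_BB] BB_sc V_BB Q_V)

definition T :: "nat \<Rightarrow> real \<Rightarrow> 'a \<Rightarrow> 'a" where "T n t b = U n t * b * st (U n t)"

lemma T_add: "T n t (a + b) = T n t a + T n t b"
  and T_diff: "T n t (a - b) = T n t a - T n t b"
  and T_sc: "T n t (sc c a) = sc c (T n t a)"
  by (simp_all add: T_def algebra_simps)

lemma T_st: "T n t (st b) = st (T n t b)"
  unfolding T_def by (simp add: st_mult mult.assoc)

text \<open>Conjugation by a partial unitary is multiplicative once its initial projection
  \<open>st (U n t) * U n t\<close> stands between the factors.\<close>

lemma T_mult: "T n t (a * unit (lev n) * b) = T n t a * T n t b"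
  unfolding T_def st_U_U[symmetric, of n t] by (simp only: mult.assoc)

lemma T_BB: "b \<in> BB \<Longrightarrow> T n t b \<in> BB"
  unfolding T_def by (intro BB_mult U_BB BB_st)

lemma norm_T_le: "norm (T n t b) \<le> norm b"
proof -
  have "norm (T n t b) \<le> norm (U n t) * norm b * norm (st (U n t))" unfolding T_def
    by (meson norm_ge_zero norm_mult_ineq mult_right_mono order_trans)
  also have "\<dots> \<le> 1 * norm b * 1" using norm_U_le[of n t] by (intro mult_mono) auto
  finally show ?thesis by simp
qed

text \<open>From level k on the eigenvector equation is exact, so the sequence defining the action
  is eventually constant on a spanning set.\<close>

lemma T_V:
  assumes v: "v \<in> V k" and c: "\<forall>p\<in>gr v. d p = c" and k: "k \<le> n"
  shows "T n t v = sc (cis (2 * pi * t * c)) v"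
proof -
  have kl: "k \<le> lev n" using k lev_ge[of n] by simp
  have piece: "U n t * (v * q) * st (U n t) = sc (cis (2 * pi * t * c)) (v * q)" if q: "q \<in> Q (lev n)" for q
  proof (cases "v * q = 0")
    case False
    \<comment> \<open>\<open>pot_diff\<close> speaks of matrix units of level n, so \<open>v\<close>
      is first cut by the projection of level n above \<open>q\<close>.\<close>
    have "\<exists>p\<in>Q n. v * p * q \<noteq> 0"
    proof (rule ccontr)
      assume "\<not> ?thesis"
      then have "(\<Sum>p\<in>Q n. v * p * q) = 0" by simp
      then show False using V_sum[OF v k] False by (simp add: sum_distrib_right[symmetric])
    qed
    then obtain p where p: "p \<in> Q n" "v * p * q \<noteq> 0" by blast
    define w where "w = v * p"
    have w: "w \<in> V n" using V_restrict[OF v k p(1)] p(2) unfolding w_def by force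
    have "p * q \<noteq> 0" using p(2) by (auto simp: mult.assoc)
    then have "p * q = q" using Q_le[OF p(1) lev_ge q] by blast
    then have wq: "w * q = v * q" unfolding w_def by (simp add: mult.assoc)
    have nz: "w * q \<noteq> 0" using False wq by simp
    have vq: "w * q \<in> V (lev n)" using lev[OF w q nz] by blast
    obtain x where x: "x \<in> dom (w * q)" using dom_nonempty[OF vq] .
    have xw: "x \<in> dom w" using dom_restrictD[OF w lev_ge q x] by blast
    have "(x, mp w x) \<in> gr w" using xw gr_iff by blast
    then have "(x, mp w x) \<in> gr v" using gr_restrict_subset[OF v k p(1)] unfolding w_def by blast
    then have dc: "d (x, mp w x) = c" using c by blast
    let ?r = "w * q * st (w * q)"
    have pd: "pot n q = c + pot n ?r" using pot_diff[OF w q nz x] dc by simp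
    have "?r * (w * q) = w * q" using V_partial_isometry[OF vq] by (simp add: mult.assoc)
    then have "U n t * (w * q) = U n t * ?r * (w * q)" by (simp only: mult.assoc)
    also have "\<dots> = sc (cis (- (2 * pi * t * pot n ?r))) (w * q)"
      unfolding U_Q[OF V_range[OF vq]] using \<open>?r * (w * q) = w * q\<close> by simp
    finally have 1: "U n t * (w * q) = sc (cis (- (2 * pi * t * pot n ?r))) (w * q)" .
    have "w * q * st (U n t) = w * (q * st (U n t))" by (simp only: mult.assoc)
    also have "\<dots> = sc (cis (2 * pi * t * pot n q)) (w * q)" unfolding Q_st_U[OF q] by simp
    finally have 2: "w * q * st (U n t) = sc (cis (2 * pi * t * pot n q)) (w * q)" .
    have "U n t * (w * q) * st (U n t) = sc (cis (- (2 * pi * t * pot n ?r)) * cis (2 * pi * t * pot n q)) (w * q)"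
      unfolding 1 using 2 by simp
    also have "cis (- (2 * pi * t * pot n ?r)) * cis (2 * pi * t * pot n q) = cis (2 * pi * t * c)"
      unfolding cis_mult pd by (simp add: algebra_simps)
    finally show ?thesis unfolding wq .
  qed simp
  have "T n t v = (\<Sum>q\<in>Q (lev n). U n t * (v * q) * st (U n t))"
    unfolding T_def sum_distrib_right[symmetric] sum_distrib_left[symmetric] using V_sum[OF v kl]
    by (simp add: sum_distrib_left[symmetric])
  also have "\<dots> = (\<Sum>q\<in>Q (lev n). sc (cis (2 * pi * t * c)) (v * q))" by (intro sum.cong refl piece)
  also have "\<dots> = sc (cis (2 * pi * t * c)) v" using V_sum[OF v kl] by (simp add: sc_sum[symmetric])
  finally show ?thesis .
qed

definition \<alpha> :: "real \<Rightarrow> 'a \<Rightarrow> 'a" where "\<alpha> t b = lim (\<lambda>n. T n t b)"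

lemma T_CV:
  assumes v: "v \<in> CV" and c: "\<forall>p\<in>gr v. d p = c"
  shows "(\<lambda>n. T n t v) \<longlonglongrightarrow> sc (cis (2 * pi * t * c)) v"
proof -
  obtain k where k: "v \<in> V k" using v unfolding CV_def VV_def by blast
  show ?thesis by (intro tendsto_eventually eventually_sequentiallyI[of k] T_V[OF k c])
qed

lemma convergent_T: assumes "b \<in> BB" shows "convergent (\<lambda>n. T n t b)"
proof -
  have "BB \<subseteq> {b. convergent (\<lambda>n. T n t b)}"
  proof (rule BB_minimal_CV)
    show "csubspace ii {b. convergent (\<lambda>n. T n t b)}"
      unfolding csubspace_def convergent_def mem_Collect_eq
    proof (intro conjI ballI allI; (elim CollectE exE)?)
      show "\<exists>L. (\<lambda>n. T n t 0) \<longlonglongrightarrow> L" by (intro exI[of _ 0]) (simp add: T_def)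
      fix x y L L' assume "(\<lambda>n. T n t x) \<longlonglongrightarrow> L" "(\<lambda>n. T n t y) \<longlonglongrightarrow> L'"
      from tendsto_add[OF this] show "\<exists>L. (\<lambda>n. T n t (x + y)) \<longlonglongrightarrow> L" unfolding T_add by blast
    next
      fix c x L assume "(\<lambda>n. T n t x) \<longlonglongrightarrow> L"
      from tendsto_sc[OF tendsto_const this] show "\<exists>L. (\<lambda>n. T n t (sc c x)) \<longlonglongrightarrow> L" unfolding T_sc by blast
    qed
    show "closed {b. convergent (\<lambda>n. T n t b)}"
      by (rule closed_convergent_contractions[OF T_diff norm_T_le])
    show "CV \<subseteq> {b. convergent (\<lambda>n. T n t b)}"
    proof
      fix v assume v: "v \<in> CV"
      then obtain c where "\<forall>p\<in>gr v. d p = c" unfolding CV_def by blast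
      from T_CV[OF v this] show "v \<in> {b. convergent (\<lambda>n. T n t b)}" unfolding convergent_def by blast
    qed
  qed
  then show ?thesis using assms by blast
qed

lemma T_tendsto: "b \<in> BB \<Longrightarrow> (\<lambda>n. T n t b) \<longlonglongrightarrow> \<alpha> t b"
  using convergent_T by (simp add: \<alpha>_def convergent_LIMSEQ_iff)

lemma \<alpha>_eqI: "b \<in> BB \<Longrightarrow> (\<lambda>n. T n t b) \<longlonglongrightarrow> y \<Longrightarrow> \<alpha> t b = y"
  using T_tendsto LIMSEQ_unique by blast

lemma \<alpha>_add: "a \<in> BB \<Longrightarrow> b \<in> BB \<Longrightarrow> \<alpha> t (a + b) = \<alpha> t a + \<alpha> t b"
  by (rule \<alpha>_eqI[OF BB_add]) (auto simp: T_add intro: tendsto_add T_tendsto)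

lemma \<alpha>_diff: "a \<in> BB \<Longrightarrow> b \<in> BB \<Longrightarrow> \<alpha> t (a - b) = \<alpha> t a - \<alpha> t b"
  by (rule \<alpha>_eqI[OF BB_diff]) (auto simp: T_diff intro: tendsto_diff T_tendsto)

lemma \<alpha>_sc: "a \<in> BB \<Longrightarrow> \<alpha> t (sc c a) = sc c (\<alpha> t a)"
  by (rule \<alpha>_eqI[OF BB_sc]) (auto simp: T_sc intro: tendsto_sc T_tendsto)

lemma \<alpha>_st: "a \<in> BB \<Longrightarrow> \<alpha> t (st a) = st (\<alpha> t a)"
  by (rule \<alpha>_eqI[OF BB_st]) (auto simp: T_st intro: tendsto_st T_tendsto)

lemma \<alpha>_BB: "b \<in> BB \<Longrightarrow> \<alpha> t b \<in> BB"
  using closed_sequentially[OF closed_BB _ T_tendsto] T_BB by blast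

lemma norm_\<alpha>_le: "b \<in> BB \<Longrightarrow> norm (\<alpha> t b) \<le> norm b"
  by (rule LIMSEQ_le_const2[OF tendsto_norm[OF T_tendsto]]) (auto intro: norm_T_le)

lemma \<alpha>_CV: "v \<in> CV \<Longrightarrow> \<forall>p\<in>gr v. d p = c \<Longrightarrow> \<alpha> t v = sc (cis (2 * pi * t * c)) v"
  by (rule \<alpha>_eqI[OF _ T_CV]) (auto simp: CV_def VV_def V_BB)

text \<open>\<open>T n t\<close> respects the product \<open>a * unit (lev n) * b\<close>, which
  tends to \<open>a * b\<close>; since all \<open>T n t\<close> are contractions the error
  disappears in the limit.\<close>

lemma \<alpha>_mult: assumes a: "a \<in> BB" and b: "b \<in> BB" shows "\<alpha> t (a * b) = \<alpha> t a * \<alpha> t b"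
proof (rule \<alpha>_eqI[OF BB_mult[OF a b]])
  have lev: "filterlim lev at_top sequentially"
    by (rule filterlim_at_top_mono[OF filterlim_ident always_eventually]) (simp add: lev_ge)
  have "(\<lambda>n. a * unit (lev n) * b) \<longlonglongrightarrow> a * b"
    using filterlim_compose[OF BB_unit_tendsto[OF a] lev] by (intro tendsto_mult tendsto_const)
  from tendsto_norm_zero[of "\<lambda>n. a * b - a * unit (lev n) * b", OF tendsto_diff[OF tendsto_const this, of "a * b", simplified]]
  have "(\<lambda>n. norm (a * b - a * unit (lev n) * b)) \<longlonglongrightarrow> 0" .
  then have "(\<lambda>n. T n t (a * b - a * unit (lev n) * b)) \<longlonglongrightarrow> 0"
    by (rule Lim_null_comparison[rotated]) (auto intro: always_eventually norm_T_le)
  moreover have "(\<lambda>n. T n t (a * unit (lev n) * b)) \<longlonglongrightarrow> \<alpha> t a * \<alpha> t b"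
    unfolding T_mult by (intro tendsto_mult T_tendsto a b)
  ultimately have "(\<lambda>n. T n t (a * b - a * unit (lev n) * b) + T n t (a * unit (lev n) * b)) \<longlonglongrightarrow> 0 + \<alpha> t a * \<alpha> t b"
    by (rule tendsto_add)
  then show "(\<lambda>n. T n t (a * b)) \<longlonglongrightarrow> \<alpha> t a * \<alpha> t b" by (simp add: T_diff)
qed

lemma continuous_on_\<alpha>: "continuous_on BB (\<alpha> t)"
  by (rule continuous_on_BB_if) (metis \<alpha>_diff norm_\<alpha>_le BB_diff)

text \<open>A closed linear condition on \<open>b\<close>, checked on eigenvectors. The group law,
  periodicity, fixed points and Fourier coefficients of the action are read off from this formula,
  as coefficients separate elements.\<close>

lemma ev_\<alpha>:
  assumes v: "v \<in> V n" and x: "x \<in> dom v" and b: "b \<in> BB"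
  shows "ev v x (\<alpha> t b) = cis (2 * pi * t * d (x, mp v x)) * ev v x b"
proof -
  note c = dom_chr[OF x]
  let ?z = "cis (2 * pi * t * d (x, mp v x))"
  have "BB \<subseteq> {b \<in> BB. ev v x (\<alpha> t b) - ?z * ev v x b = 0}"
  proof (rule BB_minimal_CV)
    have "\<alpha> t 0 = 0" using norm_\<alpha>_le[OF BB_0, of t] by simp
    then show "csubspace ii {b \<in> BB. ev v x (\<alpha> t b) - ?z * ev v x b = 0}" unfolding csubspace_def
      by (auto simp: BB_0 BB_add BB_sc \<alpha>_BB \<alpha>_add \<alpha>_sc ev_0[OF c] ev_add[OF v c] ev_sc[OF v c] algebra_simps)
    have "continuous_on BB (\<lambda>b. ev v x (\<alpha> t b))"
      by (rule continuous_on_compose2[OF continuous_on_ev[OF v c] continuous_on_\<alpha>]) (auto intro: \<alpha>_BB)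
    then show "closed {b \<in> BB. ev v x (\<alpha> t b) - ?z * ev v x b = 0}"
      by (intro continuous_closed_preimage_constant closed_BB continuous_on_diff continuous_on_mult
            continuous_on_const continuous_on_ev[OF v c])
    show "CV \<subseteq> {b \<in> BB. ev v x (\<alpha> t b) - ?z * ev v x b = 0}"
    proof
      fix w assume w: "w \<in> CV"
      then obtain c' m where c': "\<forall>p\<in>gr w. d p = c'" and m: "w \<in> V m" unfolding CV_def VV_def by blast
      have "ev v x (\<alpha> t w) = cis (2 * pi * t * c') * ev v x w"
        unfolding \<alpha>_CV[OF w c'] by (rule ev_sc[OF v c V_BB[OF m]])
      then show "w \<in> {b \<in> BB. ev v x (\<alpha> t b) - ?z * ev v x b = 0}"
        using ev_V[OF v m x] c' V_BB[OF m] by auto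
    qed
  qed
  then show ?thesis using b by auto
qed

end

text \<open>A continuous solution of the exponential equation is differentiable, being a constant
  multiple of a difference of translates of its antiderivative. So its derivative is
  \<open>a\<close> times itself, it is an exponential, and \<open>f 1 = 1\<close> makes
  \<open>a\<close> an integer multiple of 2 pi i.\<close>

lemma continuous_character_of_circle:
  fixes f :: "real \<Rightarrow> complex"
  assumes cont: "continuous_on UNIV f" and add: "\<And>s t. f (s + t) = f s * f t" and f0: "f 0 = 1" and f1: "f 1 = 1"
  shows "\<exists>k::int. \<forall>t. f t = cis (2 * pi * of_int k * t)"
proof -
  \<comment> \<open>The antiderivative with base point 0 on the whole line: one of the two integrals
    vanishes, according to the sign of \<open>s\<close>.\<close>
  define F where "F s = integral {0..s} f - integral {s..0} f" for s
  have F: "(F has_vector_derivative f s) (at s)" for s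
  proof -
    \<comment> \<open>A base point to the left of both 0 and \<open>s\<close>: near
      \<open>s\<close>, \<open>F\<close> differs from the integral from \<open>a\<close> by a
      constant.\<close>
    define a where "a = - \<bar>s\<bar> - 1"
    have int: "f integrable_on {u..v}" for u v
      by (intro integrable_continuous_real continuous_on_subset[OF cont]) auto
    have eq: "F u = integral {a..u} f - integral {a..0} f" if "a \<le> u" for u
    proof (cases "0 \<le> u")
      case True
      have "integral {a..0} f + integral {0..u} f = integral {a..u} f"
        using True by (intro Henstock_Kurzweil_Integration.integral_combine int) (auto simp: a_def)
      moreover have "integral {u..0} f = 0" using True by (cases "u = 0") auto
      ultimately show ?thesis unfolding F_def by (simp add: algebra_simps)
    next
      case False
      have "integral {a..u} f + integral {u..0} f = integral {a..0} f"
        using False that by (intro Henstock_Kurzweil_Integration.integral_combine int) auto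
      moreover have "integral {0..u} f = 0" using False by auto
      ultimately show ?thesis unfolding F_def by (simp add: algebra_simps)
    qed
    have "((\<lambda>u. integral {a..u} f) has_vector_derivative f s) (at s within {a..\<bar>s\<bar> + 1})"
      by (rule integral_has_vector_derivative[OF continuous_on_subset[OF cont]]) (auto simp: a_def)
    then have "((\<lambda>u. integral {a..u} f - integral {a..0} f) has_vector_derivative f s) (at s within {a..\<bar>s\<bar> + 1})"
      by (auto intro!: derivative_eq_intros)
    moreover have "at s within {a..\<bar>s\<bar> + 1} = at s" by (rule at_within_Icc_at) (auto simp: a_def)
    ultimately have "((\<lambda>u. integral {a..u} f - integral {a..0} f) has_vector_derivative f s) (at s)" by simp
    then show ?thesis
      by (rule has_vector_derivative_transform_within_open[of _ _ _ "{a<..}"]) (auto simp: eq a_def)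
  qed
  \<comment> \<open>A constant \<open>F\<close> would have derivative 0, contradicting
    \<open>f 0 = 1\<close>. This difference is what gets divided by to express \<open>f\<close>
    through \<open>F\<close>.\<close>
  have "\<exists>c. F c - F 0 \<noteq> 0"
  proof (rule ccontr)
    assume "\<not> ?thesis"
    then have "F = (\<lambda>_. F 0)" by auto
    then have "(F has_vector_derivative 0) (at 0)" by (metis has_vector_derivative_const)
    then have "f 0 = 0" using F[of 0] vector_derivative_unique_at by blast
    then show False using f0 by simp
  qed
  then obtain c where c: "F c - F 0 \<noteq> 0" by blast
  have sh: "((\<lambda>u. F (u + r)) has_vector_derivative f (s + r)) (at s)" for s r
  proof -
    have "((\<lambda>u. u + r) has_vector_derivative 1) (at s)" by (auto intro!: derivative_eq_intros)
    from vector_diff_chain_at[OF this F] show ?thesis by (simp add: o_def)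
  qed
  have const: "g s = g t" if "\<And>u. (g has_vector_derivative 0) (at u)" for g :: "real \<Rightarrow> complex" and s t
  proof -
    have "\<exists>k. \<forall>u\<in>UNIV. g u = k"
      using that by (intro has_derivative_zero_constant) (auto simp: has_vector_derivative_def)
    then show ?thesis by auto
  qed
  have shift: "F (s + c) - F s = f s * (F c - F 0)" for s
  proof -
    have "((\<lambda>u. F (u + s) - f s * F u) has_vector_derivative f (u + s) - f s * f u) (at u)" for u
      by (intro has_vector_derivative_diff has_vector_derivative_mult_right F sh)
    then have "F (c + s) - f s * F c = F (0 + s) - f s * F 0"
      by (intro const) (simp add: add mult.commute)
    then show ?thesis by (simp add: algebra_simps)
  qed
  define a where "a = (f c - 1) / (F c - F 0)"
  have fd: "(f has_vector_derivative a * f s) (at s)" for s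
  proof -
    have "((\<lambda>u. (F (u + c) - F u) / (F c - F 0)) has_vector_derivative (f (s + c) - f s) / (F c - F 0)) (at s)"
      by (intro has_vector_derivative_divide has_vector_derivative_diff F sh)
    moreover have "(\<lambda>u. (F (u + c) - F u) / (F c - F 0)) = f" using shift c by auto
    moreover have "(f (s + c) - f s) / (F c - F 0) = a * f s" unfolding a_def add by (simp add: field_simps)
    ultimately show ?thesis by simp
  qed
  have fe: "f t = exp (a * of_real t)" for t
  proof -
    have "((\<lambda>u. exp (- a * of_real u)) has_vector_derivative (- a * exp (- a * of_real u))) (at u)" for u
    proof -
      have "((\<lambda>z. exp (- a * z)) has_field_derivative - a * exp (- a * of_real u)) (at (of_real u))"
        by (auto intro!: derivative_eq_intros)
      then show ?thesis by (rule has_vector_derivative_real_field)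
    qed
    from has_vector_derivative_mult[OF fd this]
    have "f t * exp (- a * of_real t) = f 0 * exp (- a * of_real 0)"
      by (intro const) (simp add: algebra_simps)
    then have "f t * exp (- (a * of_real t)) = 1" using f0 by simp
    then show ?thesis by (simp add: exp_minus field_simps)
  qed
  have "exp a = 1" using fe[of 1] f1 by simp
  then obtain k :: int where k: "Re a = 0" "Im a = of_int (2 * k) * pi" unfolding exp_eq_1 by blast
  then have k: "a = of_int (2 * k) * pi * \<i>" by (simp add: complex_eq_iff)
  have "f t = cis (2 * pi * of_int k * t)" for t unfolding fe k cis_conv_exp by (simp add: algebra_simps)
  then show ?thesis by blast
qed


context taf begin

text \<open>Condition (1), written with \<open>BB\<close> and \<open>DD\<close> for the generated
  C*-algebra and the diagonal.\<close>

definition circle_action :: "(real \<Rightarrow> 'a \<Rightarrow> 'a) \<Rightarrow> bool" where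
  "circle_action \<alpha> \<longleftrightarrow>
        (\<forall>t. bij_betw (\<alpha> t) BB BB) \<and>
        (\<forall>t. \<forall>x\<in>BB. \<forall>y\<in>BB. \<alpha> t (x + y) = \<alpha> t x + \<alpha> t y \<and> \<alpha> t (x * y) = \<alpha> t x * \<alpha> t y) \<and>
        (\<forall>t c. \<forall>x\<in>BB. \<alpha> t (csc ii c x) = csc ii c (\<alpha> t x)) \<and>
        (\<forall>t. \<forall>x\<in>BB. \<alpha> t (st x) = st (\<alpha> t x)) \<and>
        (\<forall>x\<in>BB. \<alpha> 0 x = x) \<and>
        (\<forall>s t. \<forall>x\<in>BB. \<alpha> (s + t) x = \<alpha> s (\<alpha> t x)) \<and>
        (\<forall>t. \<forall>x\<in>BB. \<alpha> (t + 1) x = \<alpha> t x) \<and>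
        (\<forall>x\<in>BB. continuous_on UNIV (\<lambda>t. \<alpha> t x)) \<and>
        {b \<in> BB. \<forall>t. \<alpha> t b = b} = DD \<and>
        A = {b \<in> BB. \<forall>n::nat. n \<ge> 1 \<longrightarrow>
               integral {0..1} (\<lambda>t. csc ii (cis (2 * pi * real n * t)) (\<alpha> t b)) = 0}"

end

section \<open>Condition (1) for the limit action\<close>

context taf_cocycle begin

lemma cis_d_period: assumes "p \<in> R" shows "cis (2 * pi * (t + 1) * d p) = cis (2 * pi * t * d p)"
proof -
  obtain k :: int where k: "d p = of_int k" using zc_int[OF assms] by blast
  have "cis (2 * pi * (t + 1) * d p) = cis (2 * pi * t * d p) * cis (2 * pi * of_int k)"
    unfolding cis_mult k by (simp add: algebra_simps)
  also have "cis (2 * pi * of_int k) = 1" by (rule cis_multiple_2pi) simp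
  finally show ?thesis by simp
qed

lemma \<alpha>_0: "b \<in> BB \<Longrightarrow> \<alpha> 0 b = b"
  by (rule ev_eqI) (auto simp: \<alpha>_BB ev_\<alpha>)

lemma \<alpha>_plus: "b \<in> BB \<Longrightarrow> \<alpha> (s + t) b = \<alpha> s (\<alpha> t b)"
  by (rule ev_eqI) (auto simp: \<alpha>_BB ev_\<alpha> cis_mult[symmetric] ring_distribs)

lemma dom_R: "v \<in> V n \<Longrightarrow> x \<in> dom v \<Longrightarrow> (x, mp v x) \<in> R"
  using gr_R gr_iff by blast

lemma \<alpha>_period: "b \<in> BB \<Longrightarrow> \<alpha> (t + 1) b = \<alpha> t b"
  by (rule ev_eqI) (simp_all add: \<alpha>_BB ev_\<alpha> cis_d_period dom_R)

text \<open>The orbit of an eigenvector is a scalar character; contractivity makes the orbits of a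
  convergent sequence converge uniformly in the parameter.\<close>

lemma continuous_\<alpha>: assumes "b \<in> BB" shows "continuous_on UNIV (\<lambda>t. \<alpha> t b)"
proof -
  have "BB \<subseteq> {b \<in> BB. continuous_on UNIV (\<lambda>t. \<alpha> t b)}"
  proof (rule BB_minimal_CV)
    show "csubspace ii {b \<in> BB. continuous_on UNIV (\<lambda>t. \<alpha> t b)}" unfolding csubspace_def
    proof (intro conjI ballI allI; (elim CollectE conjE)?)
      have "\<alpha> t 0 = 0" for t using norm_\<alpha>_le[OF BB_0, of t] by simp
      then show "0 \<in> {b \<in> BB. continuous_on UNIV (\<lambda>t. \<alpha> t b)}" using BB_0 by simp
    qed (auto simp: BB_add BB_sc \<alpha>_add \<alpha>_sc intro!: continuous_on_add continuous_on_sc)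
    show "closed {b \<in> BB. continuous_on UNIV (\<lambda>t. \<alpha> t b)}" unfolding closed_sequential_limits
    proof (intro allI impI, elim conjE)
      fix f b assume f: "\<forall>k. f k \<in> {b \<in> BB. continuous_on UNIV (\<lambda>t. \<alpha> t b)}" and lim: "f \<longlonglongrightarrow> b"
      have b: "b \<in> BB" using closed_sequentially[OF closed_BB _ lim] f by blast
      have "uniform_limit UNIV (\<lambda>k t. \<alpha> t (f k)) (\<lambda>t. \<alpha> t b) sequentially"
      proof (rule uniform_limitI)
        fix e :: real assume "0 < e"
        then have "eventually (\<lambda>k. dist (f k) b < e) sequentially" using lim by (rule tendstoD[rotated])
        then show "\<forall>\<^sub>F k in sequentially. \<forall>t\<in>UNIV. dist (\<alpha> t (f k)) (\<alpha> t b) < e"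
        proof (rule eventually_mono)
          fix k assume k: "dist (f k) b < e"
          have fk: "f k \<in> BB" using f by blast
          have "dist (\<alpha> t (f k)) (\<alpha> t b) \<le> dist (f k) b" for t
            using norm_\<alpha>_le[OF BB_diff[OF fk b], of t] \<alpha>_diff[OF fk b, of t] by (simp add: dist_norm)
          then show "\<forall>t\<in>UNIV. dist (\<alpha> t (f k)) (\<alpha> t b) < e" using k by (meson order_le_less_trans)
        qed
      qed
      then have "continuous_on UNIV (\<lambda>t. \<alpha> t b)"
        by (rule uniform_limit_theorem[rotated]) (use f in auto)
      then show "b \<in> {b \<in> BB. continuous_on UNIV (\<lambda>t. \<alpha> t b)}" using b by blast
    qed
    show "CV \<subseteq> {b \<in> BB. continuous_on UNIV (\<lambda>t. \<alpha> t b)}"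
    proof
      fix v assume v: "v \<in> CV"
      then obtain c where c: "\<forall>p\<in>gr v. d p = c" unfolding CV_def by blast
      have "v \<in> BB" using v V_BB unfolding CV_def VV_def by blast
      moreover have "continuous_on UNIV (\<lambda>t. \<alpha> t v)" unfolding \<alpha>_CV[OF v c]
        by (intro continuous_on_sc continuous_intros)
      ultimately show "v \<in> {b \<in> BB. continuous_on UNIV (\<lambda>t. \<alpha> t b)}" by blast
    qed
  qed
  then show ?thesis using assms by blast
qed

lemma \<alpha>_fixed: "{b \<in> BB. \<forall>t. \<alpha> t b = b} = DD"
proof (intro equalityI subsetI)
  fix b assume "b \<in> {b \<in> BB. \<forall>t. \<alpha> t b = b}"
  then have b: "b \<in> BB" "\<And>t. \<alpha> t b = b" by auto
  have "ev v x b = 0" if v: "v \<in> V n" and x: "x \<in> dom v" and ne: "(x, mp v x) \<notin> Id" for n v x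
  proof -
    let ?d = "d (x, mp v x)"
    have "?d \<noteq> 0" using zc_0[OF dom_R[OF v x]] ne by auto
    \<comment> \<open>At this time the action multiplies the coefficient by -1, so a fixed element
      has coefficient 0 there.\<close>
    then have "2 * pi * (1 / (2 * ?d)) * ?d = pi" by simp
    then have "ev v x b = - ev v x b" using ev_\<alpha>[OF v x b(1), of "1 / (2 * ?d)"] b(2) by simp
    then show ?thesis by simp
  qed
  then show "b \<in> DD" using DD_iff_support[OF b(1)] by blast
next
  fix b assume b: "b \<in> DD"
  then have bB: "b \<in> BB" using DD_BB by blast
  have "\<alpha> t b = b" for t
  proof (rule ev_eqI[OF \<alpha>_BB[OF bB] bB])
    fix n v x assume v: "v \<in> V n" and x: "x \<in> dom v"
    show "ev v x (\<alpha> t b) = ev v x b"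
    proof (cases "(x, mp v x) \<in> Id")
      case True
      then have "d (x, mp v x) = 0" using zc_refl[OF dom_chr[OF x]] by simp
      then show ?thesis unfolding ev_\<alpha>[OF v x bB] by simp
    next
      case False
      then show ?thesis unfolding ev_\<alpha>[OF v x bB] using DD_iff_support[OF bB] b v x by auto
    qed
  qed
  then show "b \<in> {b \<in> BB. \<forall>t. \<alpha> t b = b}" using bB by blast
qed

lemma continuous_twisted_\<alpha>:
  "b \<in> BB \<Longrightarrow> continuous_on {0..1} (\<lambda>t. sc (cis (2 * pi * real n * t)) (\<alpha> t b))"
  by (intro continuous_on_sc continuous_intros continuous_on_subset[OF continuous_\<alpha>]) auto

text \<open>The integral of \<open>cis (2 * pi * (n + k) * t)\<close> vanishes unless the degree k
  is -n. So the conditions for n \<ge> 1 say that all coefficients of negative degree, those off P,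
  are 0.\<close>

lemma ev_fourier_\<alpha>:
  assumes v: "v \<in> V m" and x: "x \<in> dom v" and b: "b \<in> BB"
  shows "ev v x (integral {0..1} (\<lambda>t. sc (cis (2 * pi * real n * t)) (\<alpha> t b)))
    = (if d (x, mp v x) = - real n then ev v x b else 0)"
proof -
  note c = dom_chr[OF x]
  obtain k :: int where k: "d (x, mp v x) = of_int k" using zc_int[OF dom_R[OF v x]] by blast
  have "ev v x (integral {0..1} (\<lambda>t. sc (cis (2 * pi * real n * t)) (\<alpha> t b)))
      = integral {0..1} (\<lambda>t. ev v x (sc (cis (2 * pi * real n * t)) (\<alpha> t b)))"
    by (rule ev_integral(2)[OF v c continuous_twisted_\<alpha>[OF b] BB_sc[OF \<alpha>_BB[OF b]]])
  also have "(\<lambda>t. ev v x (sc (cis (2 * pi * real n * t)) (\<alpha> t b))) = (\<lambda>t. cis (2 * pi * of_int (int n + k) * t) * ev v x b)"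
    unfolding ev_sc[OF v c \<alpha>_BB[OF b]] ev_\<alpha>[OF v x b] k mult.assoc[symmetric] cis_mult by (simp add: algebra_simps)
  also have "integral {0..1} \<dots> = (if int n + k = 0 then 1 else 0) * ev v x b"
    by (rule integral_unique[OF has_integral_mult_left[OF integral_cis]])
  also have "\<dots> = (if d (x, mp v x) = - real n then ev v x b else 0)" unfolding k
    by (auto simp: eq_neg_iff_add_eq_0 add.commute)
  finally show ?thesis .
qed

lemma A_fourier:
  "A = {b \<in> BB. \<forall>n::nat. n \<ge> 1 \<longrightarrow> integral {0..1} (\<lambda>t. sc (cis (2 * pi * real n * t)) (\<alpha> t b)) = 0}"
proof (intro equalityI subsetI)
  fix b assume b: "b \<in> A"
  then have bB: "b \<in> BB" using A_BB by blast
  have "integral {0..1} (\<lambda>t. sc (cis (2 * pi * real n * t)) (\<alpha> t b)) = 0" if "n \<ge> 1" for n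
  proof (rule ev_eq_0_imp_0)
    show "integral {0..1} (\<lambda>t. sc (cis (2 * pi * real n * t)) (\<alpha> t b)) \<in> BB"
    \<comment> \<open>\<open>ev_integral\<close> is stated for a given matrix unit and character. If
      there is no character, all coefficients vanish vacuously and the orbit is 0.\<close>
    proof (cases "\<exists>x. chr x")
      case True
      then obtain x where x: "chr x" by blast
      obtain k q where "q \<in> Q k" using chr_Q_exists[OF x] .
      from ev_integral(1)[OF Q_V[OF this] x continuous_twisted_\<alpha>[OF bB] BB_sc[OF \<alpha>_BB[OF bB]]] show ?thesis .
    next
      case False
      have "\<alpha> t b = 0" for t by (rule ev_eq_0_imp_0[OF \<alpha>_BB[OF bB]]) (use False dom_chr in blast)
      then show ?thesis using BB_0 by simp
    qed
    fix m v x assume v: "v \<in> V m" and x: "x \<in> dom v"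
    show "ev v x (integral {0..1} (\<lambda>t. sc (cis (2 * pi * real n * t)) (\<alpha> t b))) = 0"
      unfolding ev_fourier_\<alpha>[OF v x bB]
      using ev_A[OF b v x] zc_P[OF dom_R[OF v x]] that by auto
  qed
  then show "b \<in> {b \<in> BB. \<forall>n::nat. n \<ge> 1 \<longrightarrow> integral {0..1} (\<lambda>t. sc (cis (2 * pi * real n * t)) (\<alpha> t b)) = 0}"
    using bB by blast
next
  fix b assume "b \<in> {b \<in> BB. \<forall>n::nat. n \<ge> 1 \<longrightarrow> integral {0..1} (\<lambda>t. sc (cis (2 * pi * real n * t)) (\<alpha> t b)) = 0}"
  then have bB: "b \<in> BB" and 0: "\<And>n::nat. n \<ge> 1 \<Longrightarrow> integral {0..1} (\<lambda>t. sc (cis (2 * pi * real n * t)) (\<alpha> t b)) = 0" by auto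
  have "ev v x b = 0" if v: "v \<in> V m" and x: "x \<in> dom v" and nP: "(x, mp v x) \<notin> P" for m v x
  proof -
    obtain k :: int where k: "d (x, mp v x) = of_int k" using zc_int[OF dom_R[OF v x]] by blast
    have "k < 0" using zc_P[OF dom_R[OF v x]] nP k by simp
    then have "nat (- k) \<ge> 1" "d (x, mp v x) = - real (nat (- k))" using k by auto
    then show ?thesis using ev_fourier_\<alpha>[OF v x bB, of "nat (- k)"] 0[of "nat (- k)"] ev_0[OF dom_chr[OF x]] by simp
  qed
  then show "b \<in> A" using A_iff_support[OF bB] by blast
qed

lemma circle_action_\<alpha>: "circle_action \<alpha>"
  unfolding circle_action_def
proof (intro conjI allI ballI)
  show "bij_betw (\<alpha> t) BB BB" for t
  proof (rule bij_betw_byWitness[where f'="\<alpha> (- t)"])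
    show "\<forall>b\<in>BB. \<alpha> (- t) (\<alpha> t b) = b" "\<forall>b\<in>BB. \<alpha> t (\<alpha> (- t) b) = b"
      using \<alpha>_plus[of _ "- t" t] \<alpha>_plus[of _ t "- t"] \<alpha>_0 by auto
  qed (auto simp: \<alpha>_BB)
  show "\<alpha> (t + 1) x = \<alpha> t x" if "x \<in> BB" for t x by (rule \<alpha>_period[OF that])
  show "A = {b \<in> BB. \<forall>n::nat. n \<ge> 1 \<longrightarrow> integral {0..1} (\<lambda>t. sc (cis (2 * pi * real n * t)) (\<alpha> t b)) = 0}"
    by (rule A_fourier)
qed (simp_all add: \<alpha>_add \<alpha>_mult \<alpha>_sc \<alpha>_st \<alpha>_0 \<alpha>_plus continuous_\<alpha> \<alpha>_fixed)

end

section \<open>From a circle action to a cocycle\<close>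

locale taf_action = taf st ii V Q A
  for st :: "'a::{real_normed_algebra_1,banach} \<Rightarrow> 'a" and ii :: 'a and V Q :: "nat \<Rightarrow> 'a set" and A +
  fixes \<beta> :: "real \<Rightarrow> 'a \<Rightarrow> 'a"
  assumes \<beta>: "circle_action \<beta>"
begin

lemma \<beta>_BB: "b \<in> BB \<Longrightarrow> \<beta> t b \<in> BB"
  and \<beta>_mult: "a \<in> BB \<Longrightarrow> b \<in> BB \<Longrightarrow> \<beta> t (a * b) = \<beta> t a * \<beta> t b"
  and \<beta>_0: "b \<in> BB \<Longrightarrow> \<beta> 0 b = b"
  and \<beta>_plus: "b \<in> BB \<Longrightarrow> \<beta> (s + t) b = \<beta> s (\<beta> t b)"
  and \<beta>_period: "b \<in> BB \<Longrightarrow> \<beta> (t + 1) b = \<beta> t b"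
  and \<beta>_cont: "b \<in> BB \<Longrightarrow> continuous_on UNIV (\<lambda>t. \<beta> t b)"
  and \<beta>_fixed: "{b \<in> BB. \<forall>t. \<beta> t b = b} = DD"
  and \<beta>_A: "A = {b \<in> BB. \<forall>n::nat. n \<ge> 1 \<longrightarrow> integral {0..1} (\<lambda>t. sc (cis (2 * pi * real n * t)) (\<beta> t b)) = 0}"
proof -
  note c = \<beta>[unfolded circle_action_def]
  note c2 = conjunct2[OF c] note c3 = conjunct2[OF c2] note c4 = conjunct2[OF c3] note c5 = conjunct2[OF c4]
  note c6 = conjunct2[OF c5] note c7 = conjunct2[OF c6] note c8 = conjunct2[OF c7] note c9 = conjunct2[OF c8]
  show "b \<in> BB \<Longrightarrow> \<beta> t b \<in> BB" using conjunct1[OF c] by (meson bij_betwE)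
  show "a \<in> BB \<Longrightarrow> b \<in> BB \<Longrightarrow> \<beta> t (a * b) = \<beta> t a * \<beta> t b" using conjunct1[OF c2] by blast
  show "b \<in> BB \<Longrightarrow> \<beta> 0 b = b" using conjunct1[OF c5] by blast
  show "b \<in> BB \<Longrightarrow> \<beta> (s + t) b = \<beta> s (\<beta> t b)" using conjunct1[OF c6] by blast
  show "b \<in> BB \<Longrightarrow> \<beta> (t + 1) b = \<beta> t b" using conjunct1[OF c7] by blast
  show "b \<in> BB \<Longrightarrow> continuous_on UNIV (\<lambda>t. \<beta> t b)" using conjunct1[OF c8] by blast
  show "{b \<in> BB. \<forall>t. \<beta> t b = b} = DD" by (rule conjunct1[OF c9])
  show "A = {b \<in> BB. \<forall>n::nat. n \<ge> 1 \<longrightarrow> integral {0..1} (\<lambda>t. sc (cis (2 * pi * real n * t)) (\<beta> t b)) = 0}"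
    by (rule conjunct2[OF c9])
qed

lemma \<beta>_DD: "a \<in> DD \<Longrightarrow> \<beta> t a = a" using \<beta>_fixed by blast

text \<open>The factor by which the action rescales \<open>v\<close>, as \<open>\<beta>_V\<close>
  makes precise.\<close>

definition w :: "'a \<Rightarrow> real \<Rightarrow> 'a" where "w v t = st v * \<beta> t v"

lemma \<beta>_V: assumes v: "v \<in> V n" shows "\<beta> t v = v * w v t"
proof -
  have e: "v * st v * v = v" using V_partial_isometry[OF v] by (simp add: mult.assoc)
  have "\<beta> t (v * st v * v) = \<beta> t (v * st v) * \<beta> t v"
    using \<beta>_mult DD_BB range_DD[OF v] V_BB[OF v] by blast
  also have "\<dots> = v * st v * \<beta> t v" using \<beta>_DD[OF range_DD[OF v]] by simp
  finally show ?thesis unfolding e w_def by (simp add: mult.assoc)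
qed

lemma source_w: assumes v: "v \<in> V n" shows "st v * v * w v t = w v t"
proof -
  have "st v * v * st v = st v" using V_partial_isometry[OF V_st[OF v]] by (simp add: mult.assoc)
  then show ?thesis unfolding w_def by (metis mult.assoc)
qed

lemma w_BB: assumes v: "v \<in> V n" shows "w v t \<in> BB"
  unfolding w_def by (rule stV_mult_BB[OF v \<beta>_BB[OF V_BB[OF v]]])

text \<open>Both \<open>q\<close> and \<open>v * q * st v\<close> are diagonal, hence fixed. Passing
  \<open>q\<close> through \<open>\<beta> t v\<close> and back through \<open>st v\<close> shows
  that it commutes with \<open>w v t\<close>, and the diagonal is maximal abelian.\<close>

lemma w_DD: assumes v: "v \<in> V n" shows "w v t \<in> DD"
proof (rule commutant_DD[OF w_BB[OF v]])
  fix m q assume q: "q \<in> Q m"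
  have vq: "v * q * st v \<in> DD" using DD_conj[OF Q_DD[OF q] V_st[OF v]] by simp
  have c: "q * (st v * v) = st v * v * q" using DD_comm[OF Q_DD[OF q] source_DD[OF v]] .
  have "v * q = v * (st v * v) * q" using V_partial_isometry[OF v] by simp
  also have "\<dots> = v * (st v * v * q)" by (simp only: mult.assoc)
  also have "\<dots> = v * q * st v * v" unfolding c[symmetric] by (simp only: mult.assoc)
  finally have e: "v * q = v * q * st v * v" .
  have "\<beta> t v * q = \<beta> t (v * q)" using \<beta>_mult[OF V_BB[OF v], of q t] \<beta>_DD[OF Q_DD[OF q]] DD_BB Q_DD[OF q] by auto
  also have "\<dots> = v * q * st v * \<beta> t v"
    using \<beta>_mult[of "v * q * st v" v t] e \<beta>_DD[OF vq] vq DD_BB V_BB[OF v] by auto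
  finally have "w v t * q = st v * (v * q * st v * \<beta> t v)" unfolding w_def by (simp add: mult.assoc)
  also have "\<dots> = st v * v * q * (st v * \<beta> t v)" by (simp only: mult.assoc)
  also have "\<dots> = q * (st v * v * w v t)" unfolding c[symmetric] w_def by (simp only: mult.assoc)
  finally show "w v t * q = q * w v t" unfolding source_w[OF v] .
qed

text \<open>As \<open>w v t\<close> is diagonal it is fixed by \<open>\<beta> s\<close>, so the
  factors multiply.\<close>

lemma w_plus: assumes v: "v \<in> V n" shows "w v (s + t) = w v s * w v t"
proof -
  have "\<beta> (s + t) v = \<beta> s (v * w v t)" using \<beta>_plus[OF V_BB[OF v]] \<beta>_V[OF v] by simp
  also have "\<dots> = \<beta> s v * w v t" using \<beta>_mult[OF V_BB[OF v] w_BB[OF v]] \<beta>_DD[OF w_DD[OF v]] by simp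
  finally show ?thesis unfolding w_def by (simp add: mult.assoc)
qed

lemma w_cont: assumes v: "v \<in> V n" shows "continuous_on UNIV (w v)"
  unfolding w_def by (intro continuous_on_mult_left \<beta>_cont V_BB[OF v])

lemma w_char:
  assumes v: "v \<in> V n" and x: "x \<in> dom v"
  shows "\<exists>k::int. \<forall>t. x (w v t) = cis (2 * pi * of_int k * t)"
proof (rule continuous_character_of_circle)
  note c = dom_chr[OF x]
  show "continuous_on UNIV (\<lambda>t. x (w v t))"
    by (rule continuous_on_compose2[OF continuous_on_chr[OF c] w_cont[OF v]]) (auto intro: w_DD[OF v])
  show "x (w v (s + t)) = x (w v s) * x (w v t)" for s t
    unfolding w_plus[OF v] by (rule chr_mult[OF c w_DD[OF v] w_DD[OF v]])
  have w0: "w v 0 = st v * v" unfolding w_def using \<beta>_0[OF V_BB[OF v]] by simp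
  then show "x (w v 0) = 1" using dom_source[OF x] by simp
  have "w v 1 = w v 0" unfolding w_def using \<beta>_period[OF V_BB[OF v], of 0] by simp
  then show "x (w v 1) = 1" using w0 dom_source[OF x] by simp
qed

lemma w_restrict:
  assumes v: "v \<in> V n" and q: "q \<in> Q N" and x: "chr x" "x q = 1" shows "x (w (v * q) t) = x (w v t)"
proof -
  have "\<beta> t (v * q) = \<beta> t v * q" using \<beta>_mult[OF V_BB[OF v], of q t] \<beta>_DD[OF Q_DD[OF q]] DD_BB Q_DD[OF q] by auto
  then have "w (v * q) t = q * w v t * q" unfolding w_def by (simp add: st_mult Q_st[OF q] mult.assoc)
  then show ?thesis using x by (simp add: chr_mult[OF x(1)] DD_mult Q_DD[OF q] w_DD[OF v])
qed

lemma w_cong: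
  assumes v: "v \<in> V n" and u: "u \<in> V m" and "(x, y) \<in> gr v" "(x, y) \<in> gr u" shows "x (w v t) = x (w u t)"
proof -
  define N where "N = max n m"
  have N: "n \<le> N" "m \<le> N" unfolding N_def by auto
  obtain q where q: "q \<in> Q N" "x q = 1" using gr_restrict[OF v N(1) assms(3)] by metis
  have c: "chr x" using gr_chr v assms by blast
  show ?thesis using w_restrict[OF v q(1) c q(2)] w_restrict[OF u q(1) c q(2)]
      gr_common(1)[OF v u N q assms(3,4)] by simp
qed

text \<open>The winding number of the circle function \<open>x (w v t)\<close>, for any matrix unit
  through the point; well defined by \<open>w_cong\<close> and \<open>cis_int_eq\<close>.\<close>

definition deg :: "('a \<Rightarrow> complex) \<times> ('a \<Rightarrow> complex) \<Rightarrow> int" where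
  "deg p = (THE k. \<exists>n. \<exists>v\<in>V n. p \<in> gr v \<and> (\<forall>t. fst p (w v t) = cis (2 * pi * of_int k * t)))"

lemma deg_eqI:
  assumes v: "v \<in> V n" and g: "(x, y) \<in> gr v" and k: "\<And>t. x (w v t) = cis (2 * pi * of_int k * t)"
  shows "deg (x, y) = k"
  unfolding deg_def
proof (rule the_equality)
  show "\<exists>n. \<exists>v\<in>V n. (x, y) \<in> gr v \<and> (\<forall>t. fst (x, y) (w v t) = cis (2 * pi * of_int k * t))"
    using v g k by auto
  fix l :: int assume "\<exists>n. \<exists>v\<in>V n. (x, y) \<in> gr v \<and> (\<forall>t. fst (x, y) (w v t) = cis (2 * pi * of_int l * t))"
  then obtain m u where u: "u \<in> V m" "(x, y) \<in> gr u" "\<And>t. x (w u t) = cis (2 * pi * of_int l * t)" by auto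
  show "l = k" by (rule cis_int_eq) (use w_cong[OF v u(1) g u(2)] u(3) k in metis)
qed

lemma deg: assumes v: "v \<in> V n" and g: "(x, y) \<in> gr v" shows "x (w v t) = cis (2 * pi * of_int (deg (x, y)) * t)"
proof -
  have "x \<in> dom v" using g gr_iff by blast
  then obtain k :: int where k: "\<And>t. x (w v t) = cis (2 * pi * of_int k * t)" using w_char[OF v] by blast
  then show ?thesis using deg_eqI[OF v g k] by simp
qed

text \<open>\<open>w (u * v) t\<close> is the conjugate of \<open>w u t\<close> by \<open>v\<close>
  times \<open>w v t\<close>; evaluated at \<open>x\<close>, the conjugate takes the value of
  \<open>w u t\<close> at \<open>y\<close>.\<close>

lemma deg_add: assumes "(x, y) \<in> R" "(y, z) \<in> R" shows "deg (x, z) = deg (x, y) + deg (y, z)"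
proof -
  obtain n v u where vu: "v \<in> V n" "u \<in> V n" "(x, y) \<in> gr v" "(y, z) \<in> gr u" using R_level[OF assms] .
  note g = gr_mult[OF vu]
  have x: "x \<in> dom v" "y = mp v x" using vu gr_iff by auto
  note c = dom_chr[OF x(1)]
  show ?thesis
  proof (rule deg_eqI[OF g])
    fix t
    have "\<beta> t (u * v) = \<beta> t u * \<beta> t v" using \<beta>_mult V_BB vu by blast
    then have "w (u * v) t = st v * w u t * v * w v t"
      unfolding w_def[of "u * v"] w_def[of u] \<beta>_V[OF vu(1)] by (simp add: st_mult mult.assoc)
    then have "x (w (u * v) t) = x (st v * w u t * v) * x (w v t)"
      using chr_mult[OF c DD_conj[OF w_DD[OF vu(2)] vu(1)] w_DD[OF vu(1)]] by simp
    also have "x (st v * w u t * v) = y (w u t)" unfolding x(2) mp_apply[OF w_DD[OF vu(2)]] ..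
    finally show "x (w (u * v) t) = cis (2 * pi * of_int (deg (x, y) + deg (y, z)) * t)"
      unfolding deg[OF vu(1,3)] deg[OF vu(2,4)] cis_mult by (simp add: algebra_simps)
  qed
qed

lemma deg_locally_constant:
  assumes v: "v \<in> V n" and g: "(x, y) \<in> gr v"
  obtains N s where "s \<in> Q N" "v * s \<in> V N" "(x, y) \<in> gr (v * s)" "\<And>p. p \<in> gr (v * s) \<Longrightarrow> deg p = deg (x, y)"
proof -
  let ?k = "deg (x, y)"
  let ?f = "\<lambda>t. sc (cis (2 * pi * of_int (- ?k) * t)) (w v t)"
  \<comment> \<open>The Fourier coefficient of \<open>w v\<close> at the frequency of
    \<open>(x, y)\<close>. It is diagonal, and at another point of the graph its value is 1 if the
    degree is the same and 0 otherwise; so the degree is constant wherever it is nonzero.\<close>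
  define e0 where "e0 = integral {0..1} ?f"
  have cont: "continuous_on {0..1} ?f"
    by (intro continuous_on_sc continuous_intros continuous_on_subset[OF w_cont[OF v]]) auto
  have fD: "?f t \<in> DD" for t by (intro DD_sc w_DD[OF v])
  have e: "e0 \<in> DD \<and> x' e0 = (if deg (x', y') = ?k then 1 else 0)" if g': "(x', y') \<in> gr v" for x' y'
  proof -
    have c: "chr x'" using gr_chr v g' by blast
    have scl: "x' (r *\<^sub>R a) = r *\<^sub>R x' a" if "a \<in> DD" for r a
      using chr_sc[OF c that, of "of_real r"] by (simp add: sc_of_real scaleR_conv_of_real)
    note i = integral_functional[where \<phi>=x', OF cont fD csubspace_DD closed_DD chr_add[OF c] scl chr_norm_le[OF c]]
    have "(\<lambda>t. x' (?f t)) = (\<lambda>t. cis (2 * pi * of_int (deg (x', y') - ?k) * t))"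
      unfolding chr_sc[OF c w_DD[OF v]] deg[OF v g'] cis_mult by (simp add: algebra_simps)
    then have "integral {0..1} (\<lambda>t. x' (?f t)) = (if deg (x', y') - ?k = 0 then 1 else 0)"
      using integral_unique[OF integral_cis[of "deg (x', y') - ?k"]] by simp
    then show ?thesis using i unfolding e0_def by simp
  qed
  have e0: "e0 \<in> DD" "x e0 \<noteq> 0" using e[OF g] by auto
  obtain N s where s: "s \<in> Q N" "v * s \<in> V N" "(x, y) \<in> gr (v * s)"
    "\<And>x' y'. (x', y') \<in> gr (v * s) \<Longrightarrow> (x', y') \<in> gr v \<and> x' e0 \<noteq> 0"
    using gr_local[OF v g e0] by metis
  have "deg p = ?k" if p: "p \<in> gr (v * s)" for p
  proof -
    obtain x' y' where xy: "p = (x', y')" by fastforce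
    have "(x', y') \<in> gr v" "x' e0 \<noteq> 0" using s(4) p xy by auto
    then show ?thesis using e[of x' y'] xy by (auto split: if_splits)
  qed
  then show thesis using that s by blast
qed

lemma DD_eq_0: assumes a: "a \<in> DD" and 0: "\<And>x. chr x \<Longrightarrow> x a = 0" shows "a = 0"
proof (rule ev_eq_0_imp_0)
  show aB: "a \<in> BB" using a DD_BB by blast
  fix n v x assume v: "v \<in> V n" and x: "x \<in> dom v"
  show "ev v x a = 0"
  proof (cases "(x, mp v x) \<in> Id")
    case True
    then have "v \<in> Q n" using gr_diag[OF v, of x] x gr_iff by auto
    then have "E (st v * a) = v * a" using E_id[OF DD_mult[OF Q_DD a]] Q_st by metis
    then show ?thesis unfolding ev_def using chr_mult[OF dom_chr[OF x] Q_DD[OF \<open>v \<in> Q n\<close>] a] 0[OF dom_chr[OF x]] by simp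
  next
    case False
    then show ?thesis using DD_iff_support[OF aB] a v x by blast
  qed
qed

text \<open>At a point of degree -k with k \<ge> 1, the k-th Fourier coefficient of \<open>v\<close>
  vanishes because \<open>v\<close> is in \<open>A\<close>, yet its matrix coefficient there is the
  integral of the constant 1.\<close>

lemma deg_P: assumes "(x, y) \<in> P" shows "deg (x, y) \<ge> 0"
proof (rule ccontr)
  assume neg: "\<not> ?thesis"
  define k where "k = nat (- deg (x, y))"
  have k: "k \<ge> 1" "int k + deg (x, y) = 0" using neg unfolding k_def by auto
  obtain n v where v: "v \<in> V n" "v \<in> A" "(x, y) \<in> gr v" using PE[OF assms] .
  note c = gr_chr(1)[OF v(1,3)]
  let ?f = "\<lambda>t. sc (cis (2 * pi * real k * t)) (\<beta> t v)"
  have cont: "continuous_on {0..1} ?f"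
    by (intro continuous_on_sc continuous_intros continuous_on_subset[OF \<beta>_cont[OF V_BB[OF v(1)]]]) auto
  have "integral {0..1} ?f = 0" using v(2) k(1) \<beta>_A by blast
  then have "integral {0..1} (\<lambda>t. ev v x (?f t)) = 0"
    using ev_integral(2)[OF v(1) c cont BB_sc[OF \<beta>_BB[OF V_BB[OF v(1)]]]] ev_0[OF c] by simp
  moreover have "ev v x (?f t) = cis (2 * pi * of_int (int k + deg (x, y)) * t)" for t
  proof -
    have "ev v x (\<beta> t v) = x (w v t)" unfolding ev_def w_def[symmetric] E_id[OF w_DD[OF v(1)]] ..
    then show ?thesis
      unfolding ev_sc[OF v(1) c \<beta>_BB[OF V_BB[OF v(1)]]] deg[OF v(1,3)] by (simp add: cis_mult algebra_simps)
  qed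
  ultimately show False using integral_unique[OF integral_cis[of "int k + deg (x, y)"]] k(2) by simp
qed

text \<open>Degree 0 persists on the graph of a cut \<open>u\<close>, so \<open>w u t\<close> equals
  the source projection and \<open>u\<close> is fixed by the action. Then \<open>u\<close> is
  diagonal, and so is its graph.\<close>

lemma deg_0: assumes "(x, y) \<in> R" "deg (x, y) = 0" shows "y = x"
proof -
  obtain n v where v: "v \<in> V n" "(x, y) \<in> gr v" using RE[OF assms(1)] .
  obtain N s where s: "s \<in> Q N" "v * s \<in> V N" "(x, y) \<in> gr (v * s)" "\<And>p. p \<in> gr (v * s) \<Longrightarrow> deg p = 0"
    using deg_locally_constant[OF v] assms(2) by metis
  define u where "u = v * s"
  have u: "u \<in> V N" "(x, y) \<in> gr u" "\<And>p. p \<in> gr u \<Longrightarrow> deg p = 0" using s unfolding u_def by auto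
  have "\<beta> t u = u" for t
  proof -
    have "w u t - st u * u = 0"
    proof (rule DD_eq_0[OF DD_diff[OF w_DD[OF u(1)] source_DD[OF u(1)]]])
      fix x' assume x': "chr x'"
      have "x' (w u t) = x' (st u * u)"
      proof (cases "x' (st u * u) = 1")
        case True
        then have "(x', mp u x') \<in> gr u" using x' unfolding gr_iff dom_def by simp
        then show ?thesis using deg[OF u(1), of x' "mp u x'" t] u(3) True by simp
      next
        case False
        then have 0: "x' (st u * u) = 0" using chr_Q[OF x' V_source[OF u(1)]] by blast
        have "x' (st u * u * w u t) = 0" using chr_mult[OF x' source_DD[OF u(1)] w_DD[OF u(1)]] 0 by simp
        then show ?thesis using 0 source_w[OF u(1)] by simp
      qed
      then show "x' (w u t - st u * u) = 0" using chr_diff[OF x' w_DD[OF u(1)] source_DD[OF u(1)]] by simp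
    qed
    then show ?thesis using \<beta>_V[OF u(1)] V_partial_isometry[OF u(1)] by simp
  qed
  then have "u \<in> DD" using \<beta>_fixed V_BB[OF u(1)] by blast
  moreover have x: "x \<in> dom u" "y = mp u x" using u(2) gr_iff by auto
  moreover have "ev u x u = 1" using ev_V[OF u(1) u(1) x(1)] u(2) x(2) by simp
  ultimately have "(x, y) \<in> Id" using DD_iff_support[OF V_BB[OF u(1)]] u(1) by force
  then show ?thesis by simp
qed

lemma Z_cocycle_deg: "Z_cocycle (\<lambda>p. of_int (deg p))"
  unfolding Z_cocycle_def cocycle_def
proof (intro conjI ballI allI impI; (elim conjE)?)
  show "continuous_map RT euclideanreal (\<lambda>p. of_int (deg p))"
  proof (rule continuous_RT_if_locally_constant)
    fix p assume "p \<in> R"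
    then obtain n v where v: "v \<in> V n" "p \<in> gr v" by (rule RE)
    obtain x y where xy: "p = (x, y)" by fastforce
    obtain N s where s: "v * s \<in> V N" "p \<in> gr (v * s)" "\<And>p'. p' \<in> gr (v * s) \<Longrightarrow> deg p' = deg p"
      using deg_locally_constant[OF v(1) v(2)[unfolded xy]] unfolding xy by metis
    have "\<forall>p'\<in>gr (v * s). real_of_int (deg p') = real_of_int (deg p)" using s(3) by (intro ballI arg_cong[of _ _ real_of_int])
    then show "\<exists>v\<in>VV. p \<in> gr v \<and> (\<forall>p'\<in>gr v. real_of_int (deg p') = real_of_int (deg p))"
      using s(1,2) unfolding VV_def by blast
  qed
  show "real_of_int (deg (x, y)) + real_of_int (deg (y, z)) = real_of_int (deg (x, z))" if "(x, y) \<in> R" "(y, z) \<in> R" for x y z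
    using deg_add[OF that] by simp
  show "real_of_int (deg p) \<in> \<int>" for p by simp
  show "P = {p \<in> R. 0 \<le> real_of_int (deg p)}"
  proof (intro equalityI subsetI)
    fix p assume "p \<in> P"
    then show "p \<in> {p \<in> R. 0 \<le> real_of_int (deg p)}" using P_R deg_P[of "fst p" "snd p"] by auto
  next
    fix p assume p: "p \<in> {p \<in> R. 0 \<le> real_of_int (deg p)}"
    obtain x y where xy: "p = (x, y)" by fastforce
    have r: "(x, y) \<in> R" "deg (x, y) \<ge> 0" using p xy by auto
    have c: "chr x" using R_chr r by blast
    show "p \<in> P"
    proof (rule ccontr)
      assume nP: "p \<notin> P"
      \<comment> \<open>The reversed point lies in P and also has nonnegative degree, so both
        degrees are 0 and the point is diagonal, hence in P after all.\<close>
      then have "(y, x) \<in> P" using R_P[OF r(1)] xy by blast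
      then have "deg (y, x) \<ge> 0" by (rule deg_P)
      moreover have "deg (x, x) = 0" using deg_add[of x x x] P_refl[OF c] P_R by auto
      ultimately have "deg (x, y) = 0" using deg_add[OF r(1) R_sym[OF r(1)]] r(2) by simp
      then have "y = x" by (rule deg_0[OF r(1)])
      then show False using nP xy P_refl[OF c] by simp
    qed
  qed
qed

end

section \<open>Strongly maximal TAF algebras\<close>

locale strongly_maximal = cstar st ii
  for st :: "'a::{real_normed_algebra_1,banach} \<Rightarrow> 'a" and ii :: 'a +
  fixes A :: "'a set" and r :: "nat \<Rightarrow> nat" and m :: "nat \<Rightarrow> nat \<Rightarrow> nat"
    and e :: "nat \<Rightarrow> nat \<Rightarrow> nat \<Rightarrow> nat \<Rightarrow> 'a"
  assumes taf: "sm_TAF st ii A r m e"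
begin

abbreviation idx :: "nat \<Rightarrow> (nat \<times> nat \<times> nat) set" where "idx \<equiv> mu_idx r m"

definition mu :: "nat \<Rightarrow> nat \<times> nat \<times> nat \<Rightarrow> 'a" where "mu n = (\<lambda>(k, i, j). e n k i j)"

definition V :: "nat \<Rightarrow> 'a set" where "V n = mu n ` idx n"

definition Q :: "nat \<Rightarrow> 'a set" where "Q n = {e n k i i |k i. (k, i, i) \<in> idx n}"

lemma A_props: "csubspace ii A" "closed A" "mult_closed A" "matrix_unit_system st ii r m e"
    "closure (\<Union>n. Bn ii r m e n) = cstar_gen st ii A"
    "\<And>n. A \<inter> Bn ii r m e n = Tn ii r m e n"
    "A = closure (\<Union>n. A \<inter> Bn ii r m e n)"
  using taf unfolding sm_TAF_def by blast+

lemma finite_idx: "finite (idx n)"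
proof -
  have "idx n = (SIGMA k:{..<r n}. {..<m n k} \<times> {..<m n k})" unfolding mu_idx_def by auto
  then show ?thesis by simp
qed

lemma idx_sym: "(k, i, j) \<in> idx n \<Longrightarrow> (k, j, i) \<in> idx n"
  and idx_left: "(k, i, j) \<in> idx n \<Longrightarrow> (k, i, i) \<in> idx n"
  and idx_right: "(k, i, j) \<in> idx n \<Longrightarrow> (k, j, j) \<in> idx n"
  unfolding mu_idx_def by auto

lemma e_nonzero: "(k, i, j) \<in> idx n \<Longrightarrow> e n k i j \<noteq> 0"
  and e_st: "(k, i, j) \<in> idx n \<Longrightarrow> st (e n k i j) = e n k j i"
  using A_props(4) unfolding matrix_unit_system_def by fast+

lemma e_mult: "(k, i, j) \<in> idx n \<Longrightarrow> (k', i', j') \<in> idx n \<Longrightarrow>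
    e n k i j * e n k' i' j' = (if k = k' \<and> j = i' then e n k i j' else 0)"
  using A_props(4) unfolding matrix_unit_system_def by fast

lemma e_sum:
  assumes "(k, i, j) \<in> idx n"
  obtains F where "F \<subseteq> idx (Suc n)" "finite F" "e n k i j = sum (mu (Suc n)) F"
proof -
  have "\<exists>F. finite F \<and> F \<subseteq> idx (Suc n) \<and> e n k i j = (\<Sum>(k', i', j') \<in> F. e (Suc n) k' i' j')"
    using A_props(4) assms unfolding matrix_unit_system_def by fast
  then show thesis using that unfolding mu_def by blast
qed

lemma V_cases: assumes "v \<in> V n" obtains k i j where "(k, i, j) \<in> idx n" "v = e n k i j"
  using assms unfolding V_def mu_def by auto

lemma e_V: "(k, i, j) \<in> idx n \<Longrightarrow> e n k i j \<in> V n"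
  unfolding V_def mu_def by force

lemma e_Q: "(k, i, i) \<in> idx n \<Longrightarrow> e n k i i \<in> Q n"
  unfolding Q_def by blast

lemma e_diag_eq:
  assumes "(k, i, i) \<in> idx n" "(k', i', i') \<in> idx n" "e n k i i = e n k' i' i'" shows "k = k' \<and> i = i'"
proof (rule ccontr)
  assume "\<not> ?thesis"
  then have "e n k i i * e n k' i' i' = 0" using e_mult[OF assms(1,2)] by auto
  moreover have "e n k' i' i' * e n k' i' i' = e n k' i' i'" using e_mult[OF assms(2,2)] by simp
  ultimately show False using assms(3) e_nonzero[OF assms(2)] by simp
qed

lemma Bn_eq: "Bn ii r m e n = cspan ii (V n)"
  unfolding Bn_def V_def mu_def ..

text \<open>Compression by two diagonal matrix units detects whether a given matrix unit occurs in
  the sum.\<close>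

lemma coefficient:
  assumes F: "F \<subseteq> idx N" "finite F" and ab: "(k, a, b) \<in> idx N"
  shows "e N k a a * sum (mu N) F * e N k b b = (if (k, a, b) \<in> F then e N k a b else 0)"
proof -
  have "e N k a a * sum (mu N) F * e N k b b = (\<Sum>f\<in>F. e N k a a * mu N f * e N k b b)"
    by (simp add: sum_distrib_left sum_distrib_right)
  also have "\<dots> = (\<Sum>f\<in>F. if f = (k, a, b) then e N k a b else 0)"
  proof (intro sum.cong refl)
    fix f assume "f \<in> F"
    obtain k' c d where f: "f = (k', c, d)" by (metis prod.exhaust)
    have cd: "(k', c, d) \<in> idx N" using \<open>f \<in> F\<close> F(1) f by blast
    show "e N k a a * mu N f * e N k b b = (if f = (k, a, b) then e N k a b else 0)"
      unfolding f mu_def using e_mult[OF idx_left[OF ab] cd] e_mult[OF _ idx_right[OF ab], of k' a d] idx_left[OF ab] cd ab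
      by (auto simp: mu_idx_def)
  qed
  also have "\<dots> = (if (k, a, b) \<in> F then e N k a b else 0)" using F(2) by simp
  finally show ?thesis .
qed

lemma Tn_lower:
  assumes ab: "(k, a, b) \<in> idx N" "b < a" and x: "x \<in> Tn ii r m e N" shows "e N k a a * x * e N k b b = 0"
proof -
  have "Tn ii r m e N \<subseteq> {x. e N k a a * x * e N k b b = 0}" unfolding Tn_def
  proof (rule cspan_minimal)
    show "csubspace ii {x. e N k a a * x * e N k b b = 0}"
      unfolding csubspace_def by (simp add: distrib_left distrib_right)
    show "(\<lambda>(k, i, j). e N k i j) ` {(k, i, j) \<in> idx N. i \<le> j} \<subseteq> {x. e N k a a * x * e N k b b = 0}"
    proof clarify
      fix k' i j assume ij: "(k', i, j) \<in> idx N" "i \<le> j"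
      have "e N k a a * sum (mu N) {(k', i, j)} * e N k b b = 0"
        using coefficient[of "{(k', i, j)}" N, OF _ _ ab(1)] ij ab(2) by auto
      then show "e N k a a * e N k' i j * e N k b b = 0" unfolding mu_def by simp
    qed
  qed
  then show ?thesis using x by blast
qed

lemma e_A_iff: assumes ij: "(k, i, j) \<in> idx n" shows "e n k i j \<in> A \<longleftrightarrow> i \<le> j"
proof
  assume "i \<le> j"
  then have "e n k i j \<in> Tn ii r m e n" unfolding Tn_def using ij by (intro cspan_base) force
  then show "e n k i j \<in> A" using A_props(6)[of n] by blast
next
  assume "e n k i j \<in> A"
  moreover have "e n k i j \<in> Bn ii r m e n" unfolding Bn_eq by (intro cspan_base e_V ij)
  ultimately have T: "e n k i j \<in> Tn ii r m e n" using A_props(6)[of n] by blast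
  show "i \<le> j"
  proof (rule ccontr)
    assume "\<not> i \<le> j"
    then have "e n k i i * e n k i j * e n k j j = 0" using Tn_lower[OF ij _ T] by simp
    then show False using e_mult[OF idx_left[OF ij] ij] e_mult[OF ij idx_right[OF ij]] e_nonzero[OF ij] by simp
  qed
qed

text \<open>A diagonal matrix unit lies in \<open>A\<close>, so at the next level it has no entry
  below the diagonal; being self-adjoint it has none above it either.\<close>

lemma diag_sum:
  assumes i: "(k, i, i) \<in> idx n"
  obtains F where "F \<subseteq> idx (Suc n)" "finite F" "e n k i i = sum (mu (Suc n)) F" "\<And>k' a b. (k', a, b) \<in> F \<Longrightarrow> a = b"
proof -
  obtain F where F: "F \<subseteq> idx (Suc n)" "finite F" "e n k i i = sum (mu (Suc n)) F" using e_sum[OF i] .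
  let ?p = "e n k i i" and ?N = "Suc n"
  have "?p \<in> A" using e_A_iff[OF i] by simp
  moreover have "?p \<in> Bn ii r m e ?N" unfolding Bn_eq F(3)
    by (intro csubspace_sum[OF csubspace_cspan] cspan_base) (use F(1) in \<open>auto simp: V_def\<close>)
  ultimately have T: "?p \<in> Tn ii r m e ?N" using A_props(6)[of ?N] by blast
  have "a = b" if ab: "(k', a, b) \<in> F" for k' a b
  proof -
    have ab': "(k', a, b) \<in> idx ?N" using ab F(1) by blast
    have c: "e ?N k' a a * ?p * e ?N k' b b = e ?N k' a b" using coefficient[OF F(1,2) ab'] ab F(3) by simp
    have "st (e ?N k' a a * ?p * e ?N k' b b) = e ?N k' b b * ?p * e ?N k' a a"
      using e_st[OF i] e_st[OF idx_left[OF ab']] e_st[OF idx_right[OF ab']] by (simp add: st_mult mult.assoc)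
    then have c': "e ?N k' b b * ?p * e ?N k' a a = e ?N k' b a" unfolding c e_st[OF ab'] by simp
    have "\<not> b < a" using Tn_lower[OF ab' _ T] c e_nonzero[OF ab'] by auto
    moreover have "\<not> a < b" using Tn_lower[OF idx_sym[OF ab'] _ T] c' e_nonzero[OF idx_sym[OF ab']] by auto
    ultimately show ?thesis by simp
  qed
  then show thesis using that F by blast
qed

lemma e_row:
  assumes F: "F \<subseteq> idx N" "finite F" and a: "(k, a, a) \<in> idx N"
  shows "e N k a a * sum (mu N) F = (\<Sum>b\<in>{b. (k, a, b) \<in> F}. e N k a b)"
proof -
  have "e N k a a * sum (mu N) F = (\<Sum>f\<in>F. if f \<in> (\<lambda>b. (k, a, b)) ` {b. (k, a, b) \<in> F} then mu N f else 0)"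
    unfolding sum_distrib_left
  proof (intro sum.cong refl)
    fix f assume "f \<in> F"
    obtain k' c d where f: "f = (k', c, d)" by (metis prod.exhaust)
    have cd: "(k', c, d) \<in> idx N" using \<open>f \<in> F\<close> F(1) f by blast
    show "e N k a a * mu N f = (if f \<in> (\<lambda>b. (k, a, b)) ` {b. (k, a, b) \<in> F} then mu N f else 0)"
      using e_mult[OF a cd] \<open>f \<in> F\<close> unfolding f mu_def by auto
  qed
  also have "\<dots> = sum (mu N) (F \<inter> (\<lambda>b. (k, a, b)) ` {b. (k, a, b) \<in> F})"
    by (rule sum.inter_restrict[OF F(2), symmetric])
  also have "F \<inter> (\<lambda>b. (k, a, b)) ` {b. (k, a, b) \<in> F} = (\<lambda>b. (k, a, b)) ` {b. (k, a, b) \<in> F}" by auto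
  also have "sum (mu N) \<dots> = (\<Sum>b\<in>{b. (k, a, b) \<in> F}. e N k a b)"
    by (subst sum.reindex) (auto simp: inj_on_def mu_def)
  finally show ?thesis .
qed

text \<open>Distinct rows of the support of a matrix unit are disjoint, since their overlap is an off-diagonal
  coefficient of the range projection.\<close>
lemma partial_injection:
  assumes ij: "(k, i, j) \<in> idx n" and F: "F \<subseteq> idx (Suc n)" "finite F" "e n k i j = sum (mu (Suc n)) F"
    and ac: "(k', a, b) \<in> F" "(k', c, b) \<in> F"
  shows "a = c"
proof (rule ccontr)
  assume ne: "a \<noteq> c"
  let ?N = "Suc n" and ?v = "e n k i j"
  have ab: "(k', a, b) \<in> idx ?N" and cb: "(k', c, b) \<in> idx ?N" using ac F(1) by blast+
  have acx: "(k', a, c) \<in> idx ?N" using ab cb unfolding mu_idx_def by auto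
  \<comment> \<open>The columns shared by the rows \<open>a\<close> and \<open>c\<close>. Their
    number becomes the coefficient of \<open>e ?N k' a c\<close> in the range projection.\<close>
  define S where "S = {b. (k', a, b) \<in> F} \<inter> {b. (k', c, b) \<in> F}"
  have finr: "finite {b. (k', x, b) \<in> F}" for x
    using finite_vimageI[OF F(2), of "\<lambda>b. (k', x, b)"] by (simp add: inj_on_def vimage_def)
  have ra: "e ?N k' a a * ?v = (\<Sum>b\<in>{b. (k', a, b) \<in> F}. e ?N k' a b)"
    unfolding F(3) by (rule e_row[OF F(1,2) idx_left[OF ab]])
  have rc: "e ?N k' c c * ?v = (\<Sum>b\<in>{b. (k', c, b) \<in> F}. e ?N k' c b)"
    unfolding F(3) by (rule e_row[OF F(1,2) idx_left[OF cb]])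
  have "st ?v * e ?N k' c c = st (e ?N k' c c * ?v)" by (simp add: st_mult e_st[OF idx_left[OF cb]])
  also have "\<dots> = (\<Sum>b\<in>{b. (k', c, b) \<in> F}. e ?N k' b c)"
    unfolding rc st_sum using F(1) by (intro sum.cong refl e_st) blast
  finally have rc': "st ?v * e ?N k' c c = (\<Sum>b\<in>{b. (k', c, b) \<in> F}. e ?N k' b c)" .
  have "e ?N k' a a * (?v * st ?v) * e ?N k' c c = (e ?N k' a a * ?v) * (st ?v * e ?N k' c c)" by (simp only: mult.assoc)
  also have "\<dots> = (\<Sum>b\<in>{b. (k', a, b) \<in> F}. \<Sum>b'\<in>{b. (k', c, b) \<in> F}. e ?N k' a b * e ?N k' b' c)"
    unfolding ra rc' by (rule sum_product)
  also have "\<dots> = (\<Sum>b\<in>{b. (k', a, b) \<in> F}. \<Sum>b'\<in>{b. (k', c, b) \<in> F}. if b = b' then e ?N k' a c else 0)"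
  proof (intro sum.cong refl)
    fix x y assume "x \<in> {b. (k', a, b) \<in> F}" "y \<in> {b. (k', c, b) \<in> F}"
    then have "(k', a, x) \<in> idx ?N" "(k', y, c) \<in> idx ?N" using F(1) idx_sym by blast+
    then show "e ?N k' a x * e ?N k' y c = (if x = y then e ?N k' a c else 0)" using e_mult by simp
  qed
  also have "\<dots> = (\<Sum>b\<in>{b. (k', a, b) \<in> F}. if b \<in> {b. (k', c, b) \<in> F} then e ?N k' a c else 0)"
    by (simp only: sum.delta'[OF finr])
  also have "\<dots> = (\<Sum>b\<in>S. e ?N k' a c)" unfolding S_def by (rule sum.inter_restrict[OF finr, symmetric])
  also have "\<dots> = of_nat (card S) * e ?N k' a c" by simp
  finally have 1: "e ?N k' a a * (?v * st ?v) * e ?N k' c c = of_nat (card S) * e ?N k' a c" .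
  have vv: "?v * st ?v = e n k i i" unfolding e_st[OF ij] using e_mult[OF ij idx_sym[OF ij]] by simp
  obtain G where G: "G \<subseteq> idx ?N" "finite G" "e n k i i = sum (mu ?N) G" "\<And>k' a b. (k', a, b) \<in> G \<Longrightarrow> a = b"
    using diag_sum[OF idx_left[OF ij]] by metis
  have "e ?N k' a a * e n k i i * e ?N k' c c = 0" using coefficient[OF G(1,2) acx] G(3,4) ne by auto
  then have "of_nat (card S) * e ?N k' a c = 0" using 1 vv by simp
  then have "real (card S) *\<^sub>R e ?N k' a c = 0" by (simp add: scaleR_conv_of_real)
  then have "card S = 0" using e_nonzero[OF acx] by simp
  moreover have "b \<in> S" "finite S" unfolding S_def using ac finr by auto
  ultimately show False by auto
qed

sublocale matrix_units st ii V Q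
proof
  show "finite (V n)" for n unfolding V_def by (simp add: finite_idx)
  show "Q n \<subseteq> V n" for n unfolding Q_def using e_V by blast
  fix n v assume "v \<in> V n"
  then obtain k i j where ij: "(k, i, j) \<in> idx n" and v: "v = e n k i j" by (rule V_cases)
  show "v \<noteq> 0" unfolding v by (rule e_nonzero[OF ij])
  show "st v \<in> V n" unfolding v e_st[OF ij] by (rule e_V[OF idx_sym[OF ij]])
  have vv: "st v * v = e n k j j" unfolding v e_st[OF ij] using e_mult[OF idx_sym[OF ij] ij] by simp
  have vv': "v * st v = e n k i i" unfolding v e_st[OF ij] using e_mult[OF ij idx_sym[OF ij]] by simp
  show "st v * v \<in> Q n" unfolding vv by (rule e_Q[OF idx_right[OF ij]])
  show "v * (st v * v) = v" unfolding vv unfolding v using e_mult[OF ij idx_right[OF ij]] by simp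
  fix w assume "w \<in> V n"
  then obtain k' i' j' where ij': "(k', i', j') \<in> idx n" and w: "w = e n k' i' j'" by (rule V_cases)
  show "v * w = 0 \<or> v * w \<in> V n"
    unfolding v w e_mult[OF ij ij'] using e_V[of k i j' n] ij ij' unfolding mu_idx_def by auto
  have ww: "st w * w = e n k' j' j'" unfolding w e_st[OF ij'] using e_mult[OF idx_sym[OF ij'] ij'] by simp
  have ww': "w * st w = e n k' i' i'" unfolding w e_st[OF ij'] using e_mult[OF ij' idx_sym[OF ij']] by simp
  show "v = w" if eq: "st v * v = st w * w" "v * st v = w * st w"
  proof -
    have "k = k' \<and> j = j'" by (rule e_diag_eq[OF idx_right[OF ij] idx_right[OF ij'] eq(1)[unfolded vv ww]])
    moreover have "k = k' \<and> i = i'" by (rule e_diag_eq[OF idx_left[OF ij] idx_left[OF ij'] eq(2)[unfolded vv' ww']])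
    ultimately show ?thesis unfolding v w by simp
  qed
next
  fix n q assume "q \<in> Q n"
  then show "st q = q" unfolding Q_def using e_st by auto
next
  fix n p q assume "p \<in> Q n" "q \<in> Q n"
  then obtain k i k' i' where *: "(k, i, i) \<in> idx n" "p = e n k i i" "(k', i', i') \<in> idx n" "q = e n k' i' i'"
    unfolding Q_def by blast
  show "p * q = (if p = q then p else 0)"
    using e_mult[OF *(1,3)] e_diag_eq[OF *(1,3)] unfolding *(2,4) by auto
next
  fix n v q assume "v \<in> V n" and "q \<in> Q (Suc n)"
  then obtain k i j k' b where ij: "(k, i, j) \<in> idx n" and v: "v = e n k i j"
    and b: "(k', b, b) \<in> idx (Suc n)" and q: "q = e (Suc n) k' b b" by (elim V_cases) (auto simp: Q_def)
  obtain F where F: "F \<subseteq> idx (Suc n)" "finite F" "e n k i j = sum (mu (Suc n)) F" using e_sum[OF ij] .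
  have trm: "mu (Suc n) f * q = (if fst f = k' \<and> snd (snd f) = b then mu (Suc n) f else 0)" if "f \<in> F" for f
  proof -
    obtain l c d where f: "f = (l, c, d)" by (metis prod.exhaust)
    have "(l, c, d) \<in> idx (Suc n)" using that F(1) f by blast
    then show ?thesis unfolding f mu_def q using e_mult[OF _ b] by auto
  qed
  have vq: "v * q = (\<Sum>f\<in>F. mu (Suc n) f * q)" unfolding v F(3) by (rule sum_distrib_right)
  \<comment> \<open>By \<open>partial_injection\<close> at most one summand ends in column
    \<open>b\<close>, so the cut is zero or a single matrix unit.\<close>
  show "v * q = 0 \<or> v * q \<in> V (Suc n)"
  proof (cases "\<exists>a. (k', a, b) \<in> F")
    case False
    then have "v * q = 0" unfolding vq using trm by (intro sum.neutral) auto
    then show ?thesis by simp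
  next
    case True
    then obtain a where a: "(k', a, b) \<in> F" by blast
    have "v * q = (\<Sum>f\<in>F. if f = (k', a, b) then e (Suc n) k' a b else 0)"
      unfolding vq
    proof (intro sum.cong refl)
      fix f assume f: "f \<in> F"
      show "mu (Suc n) f * q = (if f = (k', a, b) then e (Suc n) k' a b else 0)"
        unfolding trm[OF f] using partial_injection[OF ij F a] f by (cases f) (auto simp: mu_def)
    qed
    then have "v * q = e (Suc n) k' a b" using a F(2) by simp
    moreover have "(k', a, b) \<in> idx (Suc n)" using a F(1) by blast
    ultimately show ?thesis using e_V by simp
  qed
next
  fix n v assume "v \<in> V n"
  then obtain k i j where ij: "(k, i, j) \<in> idx n" and v: "v = e n k i j" by (rule V_cases)
  obtain F where F: "F \<subseteq> idx (Suc n)" "finite F" "e n k i j = sum (mu (Suc n)) F" using e_sum[OF ij] .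
  have finQ: "finite (Q (Suc n))"
    by (rule finite_subset[of _ "mu (Suc n) ` idx (Suc n)"]) (auto simp: Q_def mu_def finite_idx intro!: image_eqI)
  have trm: "(\<Sum>q\<in>Q (Suc n). mu (Suc n) f * q) = mu (Suc n) f" if "f \<in> F" for f
  proof -
    obtain l c d where f: "f = (l, c, d)" by (metis prod.exhaust)
    have cd: "(l, c, d) \<in> idx (Suc n)" using that F(1) f by blast
    have "mu (Suc n) f * q = (if q = e (Suc n) l d d then mu (Suc n) f else 0)" if q: "q \<in> Q (Suc n)" for q
    proof -
      obtain l' b where b: "(l', b, b) \<in> idx (Suc n)" "q = e (Suc n) l' b b" using q unfolding Q_def by blast
      show ?thesis using e_mult[OF cd b(1)] e_diag_eq[OF b(1) idx_right[OF cd]] unfolding f mu_def b(2) by auto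
    qed
    then show ?thesis using finQ e_Q[OF idx_right[OF cd]] by simp
  qed
  have "(\<Sum>q\<in>Q (Suc n). v * q) = (\<Sum>q\<in>Q (Suc n). \<Sum>f\<in>F. mu (Suc n) f * q)"
    unfolding v F(3) by (simp add: sum_distrib_right)
  also have "\<dots> = (\<Sum>f\<in>F. \<Sum>q\<in>Q (Suc n). mu (Suc n) f * q)" by (rule sum.swap)
  also have "\<dots> = v" using trm unfolding v F(3) by simp
  finally show "(\<Sum>q\<in>Q (Suc n). v * q) = v" .
next
  fix n p q assume "p \<in> Q n" "q \<in> Q (Suc n)"
  then obtain k i k' b where i: "(k, i, i) \<in> idx n" and p: "p = e n k i i"
    and b: "(k', b, b) \<in> idx (Suc n)" and q: "q = e (Suc n) k' b b" unfolding Q_def by blast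
  obtain F where F: "F \<subseteq> idx (Suc n)" "finite F" "e n k i i = sum (mu (Suc n)) F" "\<And>k' a b. (k', a, b) \<in> F \<Longrightarrow> a = b"
    using diag_sum[OF i] by metis
  have "p * q = (\<Sum>f\<in>F. mu (Suc n) f * q)" unfolding p F(3) by (rule sum_distrib_right)
  also have "\<dots> = (\<Sum>f\<in>F. if f = (k', b, b) then q else 0)"
  proof (intro sum.cong refl)
    fix f assume f: "f \<in> F"
    obtain l c d where fe: "f = (l, c, d)" by (metis prod.exhaust)
    have cd: "(l, c, d) \<in> idx (Suc n)" "c = d" using f F(1,4) fe by blast+
    show "mu (Suc n) f * q = (if f = (k', b, b) then q else 0)"
      using e_mult[OF cd(1) b] cd(2) unfolding fe mu_def q by auto
  qed
  also have "\<dots> = (if (k', b, b) \<in> F then q else 0)" using F(2) by simp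
  finally show "p * q = 0 \<or> p * q = q" by auto
qed

sublocale taf st ii V Q A
proof
  show "csubspace ii A" "closed A" "mult_closed A" by (rule A_props)+
  fix n v assume "v \<in> V n"
  then obtain k i j where ij: "(k, i, j) \<in> idx n" and v: "v = e n k i j" by (rule V_cases)
  show "v \<in> A \<or> st v \<in> A" unfolding v e_st[OF ij] e_A_iff[OF ij] e_A_iff[OF idx_sym[OF ij]] by linarith
  show "v \<in> Q n" if "v \<in> A" "st v \<in> A"
    using that ij e_Q unfolding v e_st[OF ij] e_A_iff[OF ij] e_A_iff[OF idx_sym[OF ij]] by force
next
  fix n q assume "q \<in> Q n"
  then show "q \<in> A" unfolding Q_def using e_A_iff by auto
next
  have "Tn ii r m e n \<subseteq> cspan ii (VV \<inter> A)" for n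
    unfolding Tn_def
  proof (rule cspan_mono, rule subsetI)
    fix x assume "x \<in> (\<lambda>(k, i, j). e n k i j) ` {(k, i, j) \<in> idx n. i \<le> j}"
    then obtain k i j where ij: "(k, i, j) \<in> idx n" "i \<le> j" and x: "x = e n k i j" by auto
    have "x \<in> A" unfolding x e_A_iff[OF ij(1)] by (rule ij(2))
    moreover have "x \<in> VV" unfolding x VV_def using e_V[OF ij(1)] by blast
    ultimately show "x \<in> VV \<inter> A" by blast
  qed
  then have "(\<Union>n. A \<inter> Bn ii r m e n) \<subseteq> cspan ii (VV \<inter> A)" using A_props(6) by blast
  then have "A \<subseteq> closure (cspan ii (VV \<inter> A))" using A_props(7) closure_mono by blast
  moreover have "closure (cspan ii (VV \<inter> A)) \<subseteq> A" by (intro closed_cspan_minimal A_props) auto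
  ultimately show "A = closure (cspan ii (VV \<inter> A))" by blast
qed

section \<open>Translation between the spectral triple and the abstract notions\<close>

lemma cstar_gen_eq: "cstar_gen st ii A = BB"
  unfolding A_props(5)[symmetric] BB_def cspan_VV Bn_eq ..

lemma all_mus_eq: "all_mus r m e = VV"
  unfolding all_mus_def VV_def V_def mu_def by force

lemma upper_mus_eq: "upper_mus r m e = VV \<inter> A"
proof (intro equalityI subsetI)
  fix v assume "v \<in> upper_mus r m e"
  then show "v \<in> VV \<inter> A" unfolding upper_mus_def VV_def using e_V e_A_iff by blast
next
  fix v assume "v \<in> VV \<inter> A"
  then obtain n where "v \<in> V n" "v \<in> A" unfolding VV_def by blast
  then show "v \<in> upper_mus r m e" unfolding upper_mus_def using e_A_iff by (elim V_cases) blast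
qed

lemma specR_eq: "specR st ii (diag st A) r m e = R"
  unfolding specR_def R_def all_mus_eq diag_eq_DD ..

lemma specP_eq: "specP st ii (diag st A) r m e = P"
  unfolding specP_def P_def upper_mus_eq diag_eq_DD ..

lemma specR_top_eq: "specR_top st ii (diag st A) r m e = RT"
  unfolding specR_top_def RT_def all_mus_eq diag_eq_DD ..

lemma Z_analytic_iff: "Z_analytic st ii A r m e \<longleftrightarrow> (\<exists>d. Z_cocycle d)"
  unfolding Z_analytic_def Z_cocycle_def specR_eq specP_eq specR_top_eq ..

lemma circle_action_iff: "(\<exists>\<alpha>. circle_action \<alpha>) \<longleftrightarrow> (\<exists>d. Z_cocycle d)"
proof
  assume "\<exists>\<alpha>. circle_action \<alpha>"
  then obtain \<alpha> where "circle_action \<alpha>" by blast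
  then interpret taf_action st ii V Q A \<alpha> by unfold_locales
  show "\<exists>d. Z_cocycle d" using Z_cocycle_deg by blast
next
  assume "\<exists>d. Z_cocycle d"
  then obtain d where "Z_cocycle d" by blast
  then interpret taf_cocycle st ii V Q A d by unfold_locales
  show "\<exists>\<alpha>. circle_action \<alpha>" using circle_action_\<alpha> by blast
qed

lemma graded_subspaces_iff:
  "(\<exists>An :: nat \<Rightarrow> 'a set.
        (\<forall>n. csubspace ii (An n) \<and> closed (An n) \<and> An n \<subseteq> A) \<and>
        An 0 = DD \<and>
        (\<forall>n k. n \<noteq> k \<longrightarrow> An n \<inter> An k = {0}) \<and>
        (\<forall>n k. prod_span ii (An n) (An k) \<subseteq> An (n + k)) \<and>
        closure (cspan ii (\<Union>n. An n)) = A) \<longleftrightarrow> (\<exists>d. Z_cocycle d)"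
    (is "(\<exists>An. ?C An) \<longleftrightarrow> _")
proof
  assume "\<exists>An. ?C An"
  then obtain An where "?C An" by blast
  then have "\<And>n. csubspace ii (An n)" "\<And>n. closed (An n)" "\<And>n. An n \<subseteq> A" "An 0 = DD"
    "\<And>n k. n \<noteq> k \<Longrightarrow> An n \<inter> An k = {0}" "\<And>n k. prod_span ii (An n) (An k) \<subseteq> An (n + k)"
    "closure (cspan ii (\<Union>n. An n)) = A" by simp_all
  from graded_imp_Z_cocycle[OF subspaces_imp_graded[OF this]] show "\<exists>d. Z_cocycle d" .
next
  assume "\<exists>d. Z_cocycle d"
  then obtain d where "Z_cocycle d" by blast
  then interpret taf_cocycle st ii V Q A d by unfold_locales
  show "\<exists>An. ?C An"
    using csubspace_An closed_An An_A An_0 An_disjoint An_prod An_dense by (intro exI[of _ An]) simp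
qed

lemma nested_iff:
  "(\<exists>(dm :: int \<Rightarrow> ('a \<Rightarrow> complex) set) f.
        nested_seq GT dm f \<and>
        (\<forall>n\<ge>0. openin (subtopology RT P) (graph_on (dm n) (f n))) \<and>
        P = (\<Union>n\<in>{0..}. graph_on (dm n) (f n)) \<and>
        disjoint_family_on (\<lambda>n. graph_on (dm n) (f n)) {0..}) \<longleftrightarrow> (\<exists>d. Z_cocycle d)"
    (is "?L \<longleftrightarrow> _")
proof
  assume ?L
  then show "\<exists>d. Z_cocycle d" by (elim exE conjE) (rule graded_imp_Z_cocycle[OF nested_imp_graded])
next
  assume "\<exists>d. Z_cocycle d"
  then obtain d where "Z_cocycle d" by blast
  then interpret taf_cocycle st ii V Q A d by unfold_locales
  show ?L by (rule Z_cocycle_imp_nested)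
qed

end

theorem theorem3p1:
  fixes st :: "'a::{real_normed_algebra_1,banach} \<Rightarrow> 'a" and ii :: 'a
    and A :: "'a set" and r :: "nat \<Rightarrow> nat" and m :: "nat \<Rightarrow> nat \<Rightarrow> nat"
    and e :: "nat \<Rightarrow> nat \<Rightarrow> nat \<Rightarrow> nat \<Rightarrow> 'a"
  assumes cstar: "cstar_algebra st ii"
    and taf: "sm_TAF st ii A r m e"
    defines "C1 \<equiv> (\<exists>\<alpha> :: real \<Rightarrow> 'a \<Rightarrow> 'a.
        (\<forall>t. bij_betw (\<alpha> t) (cstar_gen st ii A) (cstar_gen st ii A)) \<and>
        (\<forall>t. \<forall>x\<in>(cstar_gen st ii A). \<forall>y\<in>(cstar_gen st ii A). \<alpha> t (x + y) = \<alpha> t x + \<alpha> t y \<and> \<alpha> t (x * y) = \<alpha> t x * \<alpha> t y) \<and>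
        (\<forall>t c. \<forall>x\<in>(cstar_gen st ii A). \<alpha> t (csc ii c x) = csc ii c (\<alpha> t x)) \<and>
        (\<forall>t. \<forall>x\<in>(cstar_gen st ii A). \<alpha> t (st x) = st (\<alpha> t x)) \<and>
        (\<forall>x\<in>(cstar_gen st ii A). \<alpha> 0 x = x) \<and>
        (\<forall>s t. \<forall>x\<in>(cstar_gen st ii A). \<alpha> (s + t) x = \<alpha> s (\<alpha> t x)) \<and>
        (\<forall>t. \<forall>x\<in>(cstar_gen st ii A). \<alpha> (t + 1) x = \<alpha> t x) \<and>
        (\<forall>x\<in>(cstar_gen st ii A). continuous_on UNIV (\<lambda>t. \<alpha> t x)) \<and>
        {b \<in> (cstar_gen st ii A). \<forall>t. \<alpha> t b = b} = (diag st A) \<and>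
        A = {b \<in> (cstar_gen st ii A). \<forall>n::nat. n \<ge> 1 \<longrightarrow>
               integral {0..1} (\<lambda>t. csc ii (cis (2 * pi * real n * t)) (\<alpha> t b)) = 0})"
    and "C2 \<equiv> (\<exists>An :: nat \<Rightarrow> 'a set.
        (\<forall>n. csubspace ii (An n) \<and> closed (An n) \<and> An n \<subseteq> A) \<and>
        An 0 = (diag st A) \<and>
        (\<forall>n k. n \<noteq> k \<longrightarrow> An n \<inter> An k = {0}) \<and>
        (\<forall>n k. prod_span ii (An n) (An k) \<subseteq> An (n + k)) \<and>
        closure (cspan ii (\<Union>n. An n)) = A)"
    and "C3 \<equiv> Z_analytic st ii A r m e"
    and "C4 \<equiv> (\<exists>(dm :: int \<Rightarrow> ('a \<Rightarrow> complex) set) f.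
        nested_seq (gelfand_top ii (diag st A)) dm f \<and>
        (\<forall>n\<ge>0. openin (subtopology (specR_top st ii (diag st A) r m e) (specP st ii (diag st A) r m e)) (graph_on (dm n) (f n))) \<and>
        (specP st ii (diag st A) r m e) = (\<Union>n\<in>{0..}. graph_on (dm n) (f n)) \<and>
        disjoint_family_on (\<lambda>n. graph_on (dm n) (f n)) {0..})"
  shows "(C1 \<longleftrightarrow> C2) \<and> (C2 \<longleftrightarrow> C3) \<and> (C3 \<longleftrightarrow> C4)"
proof -
  interpret strongly_maximal st ii A r m e
    using cstar taf by unfold_locales
  have "C1 \<longleftrightarrow> (\<exists>d. Z_cocycle d)"
    unfolding C1_def cstar_gen_eq diag_eq_DD circle_action_iff[symmetric] circle_action_def ..
  moreover have "C2 \<longleftrightarrow> (\<exists>d. Z_cocycle d)"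
    unfolding C2_def diag_eq_DD by (rule graded_subspaces_iff)
  moreover have "C3 \<longleftrightarrow> (\<exists>d. Z_cocycle d)"
    unfolding C3_def by (rule Z_analytic_iff)
  moreover have "C4 \<longleftrightarrow> (\<exists>d. Z_cocycle d)"
    unfolding C4_def specP_eq specR_top_eq unfolding diag_eq_DD by (rule nested_iff)
  ultimately show ?thesis by blast
qed

end
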